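(* Let $(\Sigma_{A},\sigma)$ be a one-sided topologically exact subshift of finite type over the alphabet $\Sigma=\{1,\dots,l\}$, $l\ge2$, let $\mu_\phi$ be a Gibbs measure for a Hölder continuous potential $\phi\in C(\Sigma_A;\mathbb{R})$, fix a Haar basis for $(\Sigma_A,\mu_\phi)$, and let $(\mathcal{A},H,\pi,D)=(C(\Sigma_A;\mathbb{C}),L^2(\Sigma_A,\mathcal{B},\mu_\phi),\pi,D_{\mu_\phi})$ be the spectral triple defined in the context. Then Connes' pseudo-metric $d$ on the state space $\mathcal{S}(\mathcal{A})$ is a metric. Moreover, the topology induced by $d$ on $\mathcal{S}(\mathcal{A})$ coincides with the weak-$*$-topology on $\mathcal{S}(\mathcal{A})$. Hence the spectral triple $(\mathcal{A},H,\pi,D)$ is a spectral metric space.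
   Context: **Connes' pseudo-metric.** For a spectral triple $(\mathcal{A},H,\pi,D)$ with $\mathcal{A}$ unital, and states $p,q\in\mathcal{S}(\mathcal{A})$, $$d(p,q)=\sup\{|p(a)-q(a)| : a\in\mathcal{A},\ [D,\pi(a)] \text{ is densely defined and extends to a bounded operator on } H \text{ of norm}\le1\}.$$ A priori $d$ may take the value $\infty$. A spectral triple is called a spectral metric space if $d$ is a metric (in particular finite). **Subshift.** Fix $l\ge 2$ and an irreducible, aperiodic $l\times l$ matrix $A=[a_{j,k}]$ with entries in $\{0,1\}$. Put $\Sigma=\{1,\dots,l\}$, $\Sigma_A=\{\omega=(\omega_1,\omega_2,\dots)\in\Sigma^{\mathbb{N}} : a_{\omega_k,\omega_{k+1}}=1\ \forall k\in\mathbb{N}\}$, $\Sigma_A^k=\{(x_1,\dots,x_k)\in\Sigma^k : a_{x_i,x_{i+1}}=1 \text{ for } 1\le i<k\}$ for $k\ge 1$ (so $\Sigma_A^1=\Sigma$), and $\Sigma_A^*=\bigcup_{k\ge1}\Sigma_A^k$. For $x\in\Sigma_A^k$ the cylinder set is $[x]=\{\omega\in\Sigma_A : (\omega_1,\dots,\omega_k)=x\}$. $\Sigma_A$ carries the compact topology generated by cylinder sets, metrized by $(\omega,\upsilon)\mapsto2^{-\omega\wedge\upsilon}$, where $\omega\wedge\upsilon$ is the length of the longest common initial word; $\mathcal{B}$ is its Borel $\sigma$-algebra; Hölder continuity is with respect to this metric. The shift is $\sigma(\omega_1,\omega_2,\dots)=(\omega_2,\omega_3,\dots)$. Such a system is called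 a one-sided topologically exact subshift of finite type. For $x\in\Sigma_A^k$ put $\alpha(x)=\sum_{i=1}^{l}a_{x_k,i}$. **Gibbs measure.** For $\phi\in C(\Sigma_A;\mathbb{R})$, $S_k\phi=\sum_{m=0}^{k-1}\phi\circ\sigma^m$. The topological pressure $P(\phi,\sigma)$ is the real number $\sup\{h_\mu(\sigma)+\int\phi\,d\mu : \mu \text{ a } \sigma\text{-invariant Borel probability measure}\}$. A Gibbs measure for a Hölder continuous $\phi$ is a Borel probability measure $\mu_\phi$ on $\Sigma_A$ for which there is $c>1$ with $c^{-1}\le \mu_\phi([(\omega_1,\dots,\omega_k)])\,/\,e^{S_k\phi(\omega)-kP(\phi,\sigma)}\le c$ for all $k\in\mathbb{N}$, $\omega\in\Sigma_A$. **Haar basis.** For each $x\in\Sigma_A^k$, $k\ge1$, fix a bijection $\theta_x:\{y\in\Sigma : a_{x_k,y}=1\}\to\{1,\dots,\alpha(x)\}$, and write $x\theta_x^{-1}(j)$ for the word $(x_1,\dots,x_k,\theta_x^{-1}(j))$. On $\mathbb{R}^{\alpha(x)}$ use the inner product $\langle r,s\rangle_x=\sum_{j=1}^{\alpha(x)}\mu_\phi([x\theta_x^{-1}(j)])\,r_js_j$, with orthonormal basis $f_{x,j}=\mu_\phi([x\theta_x^{-1}(j)])^{-1/2}\delta_j$ ($\delta_j$ = $j$-th standard unit vector). Let $\Omega_x$ be the set of linear maps $U$ of $\mathbb{R}^{\alpha(x)}$ with positive determinant, preserving $\langle\cdot,\cdot\rangle_x$, and with $U(f_{x,\alpha(x)})=\mu_\phi([x])^{-1/2}(1,\dots,1)$.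 Fix $U_x\in\Omega_x$ for every $x\in\Sigma_A^*$ and, for $j\in\{1,\dots,\alpha(x)-1\}$, let $$e_{x,j}=\sum_{k=1}^{\alpha(x)}\mu_\phi([x\theta_x^{-1}(k)])^{-1/2}\,\langle f_{x,k},U_x(f_{x,j})\rangle_x\,\mathbf{1}_{[x\theta_x^{-1}(k)]}.$$ The functions $e_{x,j}$ ($x\in\Sigma_A^*$, $1\le j\le\alpha(x)-1$) together with $\mu_\phi([x])^{-1/2}\mathbf{1}_{[x]}$ ($x\in\Sigma$) form an orthonormal basis of $L^2(\Sigma_A,\mathcal{B},\mu_\phi)$, called a Haar basis for $(\Sigma_A,\mu_\phi)$. **The spectral triple.** $\pi(a)h=a\cdot h$ for $a\in C(\Sigma_A;\mathbb{C})$, $h\in L^2(\Sigma_A,\mathcal{B},\mu_\phi)$, and $$D_{\mu_\phi}=\sum_{x\in\Sigma}\frac{1}{\mu_\phi([x])}\langle\cdot,\mathbf{1}_{[x]}\rangle\mathbf{1}_{[x]}-\langle\cdot,\mathbf{1}_{\Sigma_A}\rangle\mathbf{1}_{\Sigma_A}+\sum_{y\in\Sigma_A^*}\frac{\alpha(y)-1}{\mu_\phi([y])}\sum_{k=1}^{\alpha(y)-1}\langle\cdot,e_{y,k}\rangle e_{y,k},$$ with domain $\mathrm{Dom}(D_{\mu_\phi})$ the dense subspace of all $h\in L^2(\Sigma_A,\mathcal{B},\mu_\phi)$ for which the series converges in $L^2$ (it contains all finite linear combinations of Haar basis elements). The commutator $[D_{\mu_\phi},\pi(a)]$ is defined on $\{h\in\mathrm{Dom}(D_{\mu_\phi})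 : \pi(a)h\in\mathrm{Dom}(D_{\mu_\phi})\}$. It is known that $(C(\Sigma_A;\mathbb{C}),L^2(\Sigma_A,\mathcal{B},\mu_\phi),\pi,D_{\mu_\phi})$ is a spectral triple (faithful $\pi$; $D$ essentially self-adjoint, unbounded, with compact resolvent; and the set of $a$ with $[D,\pi(a)]$ densely defined and bounded is dense). *)

theory Defs
  imports "HOL-Probability.Probability" "Jordan_Normal_Form.Determinant"
begin

section \<open>Subshifts of finite type\<close>

text \<open>
  Infinite words are functions \<open>nat \<Rightarrow> nat\<close> with letters in \<open>{1..l}\<close>; positions are counted
  from 0, so \<open>\<omega> 0\<close> is the first letter. Matrices over the alphabet are functions of two letters.
\<close>

fun letter_mat_pow :: "nat \<Rightarrow> (nat \<Rightarrow> nat \<Rightarrow> nat) \<Rightarrow> nat \<Rightarrow> nat \<Rightarrow> nat \<Rightarrow> nat" where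
  "letter_mat_pow l A 0 i j = (if i = j then 1 else 0)"
| "letter_mat_pow l A (Suc n) i j = (\<Sum>k=1..l. letter_mat_pow l A n i k * A k j)"

definition irreducible_mat :: "nat \<Rightarrow> (nat \<Rightarrow> nat \<Rightarrow> nat) \<Rightarrow> bool" where
  "irreducible_mat l A \<longleftrightarrow>
     (\<forall>i\<in>{1..l}. \<forall>j\<in>{1..l}. \<exists>n\<ge>1. letter_mat_pow l A n i j > 0)"

definition aperiodic_mat :: "nat \<Rightarrow> (nat \<Rightarrow> nat \<Rightarrow> nat) \<Rightarrow> bool" where
  "aperiodic_mat l A \<longleftrightarrow>
     (\<forall>i\<in>{1..l}. Gcd {n. n \<ge> 1 \<and> letter_mat_pow l A n i i > 0} = 1)"

definition shift_space :: "nat \<Rightarrow> (nat \<Rightarrow> nat \<Rightarrow> nat) \<Rightarrow> (nat \<Rightarrow> nat) set" where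
  "shift_space l A = {\<omega>. \<forall>k. \<omega> k \<in> {1..l} \<and> A (\<omega> k) (\<omega> (Suc k)) = 1}"

definition shift_map :: "(nat \<Rightarrow> nat) \<Rightarrow> nat \<Rightarrow> nat" where
  "shift_map \<omega> = (\<lambda>k. \<omega> (Suc k))"

definition adm_words :: "nat \<Rightarrow> (nat \<Rightarrow> nat \<Rightarrow> nat) \<Rightarrow> nat list set" where
  "adm_words l A = {x. x \<noteq> [] \<and> set x \<subseteq> {1..l} \<and>
     (\<forall>i. Suc i < length x \<longrightarrow> A (x ! i) (x ! Suc i) = 1)}"

definition prefix_of :: "nat \<Rightarrow> (nat \<Rightarrow> nat) \<Rightarrow> nat list" where
  "prefix_of k \<omega> = map \<omega> [0..<k]"

definition cylinder :: "nat \<Rightarrow> (nat \<Rightarrow> nat \<Rightarrow> nat) \<Rightarrow> nat list \<Rightarrow> (nat \<Rightarrow> nat) set" where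
  "cylinder l A x = {\<omega> \<in> shift_space l A. prefix_of (length x) \<omega> = x}"

definition shift_top :: "nat \<Rightarrow> (nat \<Rightarrow> nat \<Rightarrow> nat) \<Rightarrow> (nat \<Rightarrow> nat) topology" where
  "shift_top l A = topology_generated_by (cylinder l A ` adm_words l A)"

definition shift_borel :: "nat \<Rightarrow> (nat \<Rightarrow> nat \<Rightarrow> nat) \<Rightarrow> (nat \<Rightarrow> nat) measure" where
  "shift_borel l A = sigma (shift_space l A) {S. openin (shift_top l A) S}"

text \<open>
  For \<open>\<omega> \<noteq> \<upsilon>\<close> the length of the longest common initial word is the least (0-based) position
  at which the two sequences differ.
\<close>

definition shift_dist :: "(nat \<Rightarrow> nat) \<Rightarrow> (nat \<Rightarrow> nat) \<Rightarrow> real" where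
  "shift_dist \<omega> \<upsilon> = (if \<omega> = \<upsilon> then 0 else (1 / 2) ^ (LEAST n. \<omega> n \<noteq> \<upsilon> n))"

definition holder_potential :: "nat \<Rightarrow> (nat \<Rightarrow> nat \<Rightarrow> nat) \<Rightarrow> ((nat \<Rightarrow> nat) \<Rightarrow> real) \<Rightarrow> bool" where
  "holder_potential l A \<phi> \<longleftrightarrow>
     (\<exists>C \<beta>. \<beta> > 0 \<and> (\<forall>\<omega>\<in>shift_space l A. \<forall>\<upsilon>\<in>shift_space l A.
        \<bar>\<phi> \<omega> - \<phi> \<upsilon>\<bar> \<le> C * shift_dist \<omega> \<upsilon> powr \<beta>))"

section \<open>Entropy, pressure and Gibbs measures\<close>

definition partition_entropy :: "'a measure \<Rightarrow> 'a set set \<Rightarrow> real" where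
  "partition_entropy M P = - (\<Sum>C\<in>P. measure M C * ln (measure M C))"

text \<open>
  \<open>dyn_refinement M T P n\<close> is the join of the preimages of \<open>P\<close> under \<open>T ^^ k\<close> for \<open>k < n\<close>.
  It may contain the empty set, which does not contribute to the entropy.
\<close>

definition dyn_refinement :: "'a measure \<Rightarrow> ('a \<Rightarrow> 'a) \<Rightarrow> 'a set set \<Rightarrow> nat \<Rightarrow> 'a set set" where
  "dyn_refinement M T P n =
     {{x \<in> space M. \<forall>k<n. (T ^^ k) x \<in> c k} | c. \<forall>k<n. c k \<in> P}"

definition ks_entropy :: "'a measure \<Rightarrow> ('a \<Rightarrow> 'a) \<Rightarrow> ereal" where
  "ks_entropy M T =
     (SUP P \<in> {P. finite P \<and> P \<subseteq> sets M \<and> partition_on (space M) P}.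
        ereal (lim (\<lambda>n. partition_entropy M (dyn_refinement M T P n) / real n)))"

definition invariant_prob :: "nat \<Rightarrow> (nat \<Rightarrow> nat \<Rightarrow> nat) \<Rightarrow> (nat \<Rightarrow> nat) measure \<Rightarrow> bool" where
  "invariant_prob l A \<nu> \<longleftrightarrow> prob_space \<nu> \<and> sets \<nu> = sets (shift_borel l A) \<and>
     shift_map \<in> measurable \<nu> \<nu> \<and> distr \<nu> \<nu> shift_map = \<nu>"

definition pressure :: "nat \<Rightarrow> (nat \<Rightarrow> nat \<Rightarrow> nat) \<Rightarrow> ((nat \<Rightarrow> nat) \<Rightarrow> real) \<Rightarrow> real" where
  "pressure l A \<phi> = real_of_ereal
     (SUP \<nu> \<in> {\<nu>. invariant_prob l A \<nu>}. ks_entropy \<nu> shift_map + ereal (\<integral>\<omega>. \<phi> \<omega> \<partial>\<nu>))"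

definition birkhoff_sum :: "nat \<Rightarrow> ((nat \<Rightarrow> nat) \<Rightarrow> real) \<Rightarrow> (nat \<Rightarrow> nat) \<Rightarrow> real" where
  "birkhoff_sum k \<phi> \<omega> = (\<Sum>m<k. \<phi> ((shift_map ^^ m) \<omega>))"

definition gibbs_measure ::
    "nat \<Rightarrow> (nat \<Rightarrow> nat \<Rightarrow> nat) \<Rightarrow> ((nat \<Rightarrow> nat) \<Rightarrow> real) \<Rightarrow> (nat \<Rightarrow> nat) measure \<Rightarrow> bool" where
  "gibbs_measure l A \<phi> \<mu> \<longleftrightarrow> prob_space \<mu> \<and> sets \<mu> = sets (shift_borel l A) \<and>
     (\<exists>c>1. \<forall>k\<ge>1. \<forall>\<omega>\<in>shift_space l A.
        1 / c \<le> measure \<mu> (cylinder l A (prefix_of k \<omega>))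
                  / exp (birkhoff_sum k \<phi> \<omega> - real k * pressure l A \<phi>) \<and>
        measure \<mu> (cylinder l A (prefix_of k \<omega>))
                  / exp (birkhoff_sum k \<phi> \<omega> - real k * pressure l A \<phi>) \<le> c)"

section \<open>Haar bases\<close>

text \<open>
  Coordinates of the vectors attached to a word \<open>x\<close> run over \<open>{..<n_succ l A x}\<close>, following the
  0-based indexing of \<^typ>\<open>real vec\<close>; linear maps are given by their matrices in the standard basis.
\<close>

definition n_succ :: "nat \<Rightarrow> (nat \<Rightarrow> nat \<Rightarrow> nat) \<Rightarrow> nat list \<Rightarrow> nat" where
  "n_succ l A x = (\<Sum>i=1..l. A (last x) i)"

definition successors :: "nat \<Rightarrow> (nat \<Rightarrow> nat \<Rightarrow> nat) \<Rightarrow> nat list \<Rightarrow> nat set" where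
  "successors l A x = {y \<in> {1..l}. A (last x) y = 1}"

definition child_word ::
    "nat \<Rightarrow> (nat \<Rightarrow> nat \<Rightarrow> nat) \<Rightarrow> (nat list \<Rightarrow> nat \<Rightarrow> nat) \<Rightarrow> nat list \<Rightarrow> nat \<Rightarrow> nat list" where
  "child_word l A \<theta> x j = x @ [inv_into (successors l A x) (\<theta> x) j]"

definition child_mass ::
    "nat \<Rightarrow> (nat \<Rightarrow> nat \<Rightarrow> nat) \<Rightarrow> (nat \<Rightarrow> nat) measure \<Rightarrow> (nat list \<Rightarrow> nat \<Rightarrow> nat) \<Rightarrow>
     nat list \<Rightarrow> nat \<Rightarrow> real" where
  "child_mass l A \<mu> \<theta> x j = measure \<mu> (cylinder l A (child_word l A \<theta> x j))"

definition word_inner ::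
    "nat \<Rightarrow> (nat \<Rightarrow> nat \<Rightarrow> nat) \<Rightarrow> (nat \<Rightarrow> nat) measure \<Rightarrow> (nat list \<Rightarrow> nat \<Rightarrow> nat) \<Rightarrow>
     nat list \<Rightarrow> real vec \<Rightarrow> real vec \<Rightarrow> real" where
  "word_inner l A \<mu> \<theta> x r s =
     (\<Sum>j<n_succ l A x. child_mass l A \<mu> \<theta> x j * vec_index r j * vec_index s j)"

definition word_onb ::
    "nat \<Rightarrow> (nat \<Rightarrow> nat \<Rightarrow> nat) \<Rightarrow> (nat \<Rightarrow> nat) measure \<Rightarrow> (nat list \<Rightarrow> nat \<Rightarrow> nat) \<Rightarrow>
     nat list \<Rightarrow> nat \<Rightarrow> real vec" where
  "word_onb l A \<mu> \<theta> x j =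
     smult_vec (1 / sqrt (child_mass l A \<mu> \<theta> x j)) (unit_vec (n_succ l A x) j)"

definition haar_rotations ::
    "nat \<Rightarrow> (nat \<Rightarrow> nat \<Rightarrow> nat) \<Rightarrow> (nat \<Rightarrow> nat) measure \<Rightarrow> (nat list \<Rightarrow> nat \<Rightarrow> nat) \<Rightarrow>
     nat list \<Rightarrow> real mat set" where
  "haar_rotations l A \<mu> \<theta> x =
     {V \<in> carrier_mat (n_succ l A x) (n_succ l A x).
        Determinant.det V > 0 \<and>
        (\<forall>r\<in>carrier_vec (n_succ l A x). \<forall>s\<in>carrier_vec (n_succ l A x).
           word_inner l A \<mu> \<theta> x (mult_mat_vec V r) (mult_mat_vec V s) = word_inner l A \<mu> \<theta> x r s) \<and>
        mult_mat_vec V (word_onb l A \<mu> \<theta> x (n_succ l A x - 1)) =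
          vec (n_succ l A x) (\<lambda>_. 1 / sqrt (measure \<mu> (cylinder l A x)))}"

definition haar_data ::
    "nat \<Rightarrow> (nat \<Rightarrow> nat \<Rightarrow> nat) \<Rightarrow> (nat \<Rightarrow> nat) measure \<Rightarrow> (nat list \<Rightarrow> nat \<Rightarrow> nat) \<Rightarrow>
     (nat list \<Rightarrow> real mat) \<Rightarrow> bool" where
  "haar_data l A \<mu> \<theta> U \<longleftrightarrow> (\<forall>x\<in>adm_words l A.
     bij_betw (\<theta> x) (successors l A x) {..<n_succ l A x} \<and> U x \<in> haar_rotations l A \<mu> \<theta> x)"

definition haar_fun ::
    "nat \<Rightarrow> (nat \<Rightarrow> nat \<Rightarrow> nat) \<Rightarrow> (nat \<Rightarrow> nat) measure \<Rightarrow> (nat list \<Rightarrow> nat \<Rightarrow> nat) \<Rightarrow>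
     (nat list \<Rightarrow> real mat) \<Rightarrow> nat list \<Rightarrow> nat \<Rightarrow> (nat \<Rightarrow> nat) \<Rightarrow> complex" where
  "haar_fun l A \<mu> \<theta> U x j \<omega> =
     (\<Sum>k<n_succ l A x.
        of_real (1 / sqrt (child_mass l A \<mu> \<theta> x k) *
          word_inner l A \<mu> \<theta> x (word_onb l A \<mu> \<theta> x k) (mult_mat_vec (U x) (word_onb l A \<mu> \<theta> x j)))
        * indicator (cylinder l A (child_word l A \<theta> x k)) \<omega>)"

section \<open>Operators on square-integrable functions\<close>

text \<open>
  Elements of the Hilbert space of a measure \<open>M\<close> are handled through representatives, two of them
  being identified when they agree almost everywhere. The inner product is linear in the first
  argument. A (possibly unbounded) operator is given by its graph.
\<close>

definition L2 :: "'a measure \<Rightarrow> ('a \<Rightarrow> complex) set" where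
  "L2 M = {f \<in> borel_measurable M. integrable M (\<lambda>x. (cmod (f x))\<^sup>2)}"

definition L2_inner :: "'a measure \<Rightarrow> ('a \<Rightarrow> complex) \<Rightarrow> ('a \<Rightarrow> complex) \<Rightarrow> complex" where
  "L2_inner M f g = (\<integral>x. f x * cnj (g x) \<partial>M)"

definition L2_norm :: "'a measure \<Rightarrow> ('a \<Rightarrow> complex) \<Rightarrow> real" where
  "L2_norm M f = sqrt (\<integral>x. (cmod (f x))\<^sup>2 \<partial>M)"

type_synonym 'a op_graph = "(('a \<Rightarrow> complex) \<times> ('a \<Rightarrow> complex)) set"

definition bounded_operator ::
    "'a measure \<Rightarrow> real \<Rightarrow> (('a \<Rightarrow> complex) \<Rightarrow> 'a \<Rightarrow> complex) \<Rightarrow> bool" where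
  "bounded_operator M c T \<longleftrightarrow>
     (\<forall>f\<in>L2 M. T f \<in> L2 M \<and> L2_norm M (T f) \<le> c * L2_norm M f) \<and>
     (\<forall>f\<in>L2 M. \<forall>g\<in>L2 M. AE x in M. T (\<lambda>y. f y + g y) x = T f x + T g x) \<and>
     (\<forall>z. \<forall>f\<in>L2 M. AE x in M. T (\<lambda>y. z * f y) x = z * T f x)"

definition linear_graph :: "'a measure \<Rightarrow> 'a op_graph \<Rightarrow> bool" where
  "linear_graph M G \<longleftrightarrow> G \<subseteq> L2 M \<times> L2 M \<and> ((\<lambda>x. 0), (\<lambda>x. 0)) \<in> G \<and>
     (\<forall>(h, f)\<in>G. \<forall>(h', f')\<in>G. ((\<lambda>x. h x + h' x), (\<lambda>x. f x + f' x)) \<in> G) \<and>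
     (\<forall>z. \<forall>(h, f)\<in>G. ((\<lambda>x. z * h x), (\<lambda>x. z * f x)) \<in> G) \<and>
     (\<forall>(h, f)\<in>G. (AE x in M. h x = 0) \<longrightarrow> (AE x in M. f x = 0))"

definition densely_defined :: "'a measure \<Rightarrow> 'a op_graph \<Rightarrow> bool" where
  "densely_defined M G \<longleftrightarrow>
     (\<forall>g\<in>L2 M. \<forall>e>0. \<exists>h\<in>Domain G. L2_norm M (\<lambda>x. g x - h x) < e)"

definition extends_boundedly :: "'a measure \<Rightarrow> real \<Rightarrow> 'a op_graph \<Rightarrow> bool" where
  "extends_boundedly M c G \<longleftrightarrow>
     (\<exists>T. bounded_operator M c T \<and> (\<forall>(h, f)\<in>G. AE x in M. T h x = f x))"

definition graph_adjoint :: "'a measure \<Rightarrow> 'a op_graph \<Rightarrow> 'a op_graph" where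
  "graph_adjoint M G =
     {(g, k). g \<in> L2 M \<and> k \<in> L2 M \<and> (\<forall>(h, f)\<in>G. L2_inner M f g = L2_inner M h k)}"

definition graph_closure :: "'a measure \<Rightarrow> 'a op_graph \<Rightarrow> 'a op_graph" where
  "graph_closure M G =
     {(g, k). g \<in> L2 M \<and> k \<in> L2 M \<and>
        (\<forall>e>0. \<exists>(h, f)\<in>G. L2_norm M (\<lambda>x. g x - h x) < e \<and> L2_norm M (\<lambda>x. k x - f x) < e)}"

definition essentially_self_adjoint :: "'a measure \<Rightarrow> 'a op_graph \<Rightarrow> bool" where
  "essentially_self_adjoint M G \<longleftrightarrow> densely_defined M G \<and>
     graph_adjoint M (graph_closure M G) = graph_closure M G"

definition unbounded_graph :: "'a measure \<Rightarrow> 'a op_graph \<Rightarrow> bool" where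
  "unbounded_graph M G \<longleftrightarrow> \<not> (\<exists>c. \<forall>(h, f)\<in>G. L2_norm M f \<le> c * L2_norm M h)"

definition compact_operator ::
    "'a measure \<Rightarrow> (('a \<Rightarrow> complex) \<Rightarrow> 'a \<Rightarrow> complex) \<Rightarrow> bool" where
  "compact_operator M T \<longleftrightarrow> (\<exists>c. bounded_operator M c T) \<and>
     (\<forall>h :: nat \<Rightarrow> 'a \<Rightarrow> complex. (\<forall>n. h n \<in> L2 M \<and> L2_norm M (h n) \<le> 1) \<longrightarrow>
        (\<exists>r f. strict_mono r \<and> f \<in> L2 M \<and>
           (\<lambda>n. L2_norm M (\<lambda>x. T (h (r n)) x - f x)) \<longlonglongrightarrow> 0))"

text \<open>\<open>R\<close> is a bounded two-sided inverse of \<open>G - z\<close>.\<close>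

definition resolvent_at ::
    "'a measure \<Rightarrow> 'a op_graph \<Rightarrow> complex \<Rightarrow> (('a \<Rightarrow> complex) \<Rightarrow> 'a \<Rightarrow> complex) \<Rightarrow> bool" where
  "resolvent_at M G z R \<longleftrightarrow> (\<exists>c. bounded_operator M c R) \<and>
     (\<forall>g\<in>L2 M. (R g, (\<lambda>x. g x + z * R g x)) \<in> G) \<and>
     (\<forall>(h, f)\<in>G. AE x in M. R (\<lambda>y. f y - z * h y) x = h x)"

definition has_compact_resolvent :: "'a measure \<Rightarrow> 'a op_graph \<Rightarrow> bool" where
  "has_compact_resolvent M G \<longleftrightarrow>
     (\<exists>z R. resolvent_at M (graph_closure M G) z R \<and> compact_operator M R)"

section \<open>States, spectral triples and the pseudo-metric of Connes\<close>

text \<open>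
  Functions in the algebra of a space \<open>X\<close> are normalised to vanish off \<open>topspace X\<close>, which makes it
  closed under the pointwise operations; its unit is \<open>indicator (topspace X)\<close>. Functionals are
  extensional on the algebra, so that equality of functionals is equality of HOL functions.
\<close>

definition cont_alg :: "'a topology \<Rightarrow> ('a \<Rightarrow> complex) set" where
  "cont_alg X = {a. continuous_map X euclidean a \<and> (\<forall>x. x \<notin> topspace X \<longrightarrow> a x = 0)}"

definition state_space :: "'a topology \<Rightarrow> (('a \<Rightarrow> complex) \<Rightarrow> complex) set" where
  "state_space X = {p \<in> extensional (cont_alg X).
     (\<forall>a\<in>cont_alg X. \<forall>b\<in>cont_alg X. p (\<lambda>x. a x + b x) = p a + p b) \<and>
     (\<forall>z. \<forall>a\<in>cont_alg X. p (\<lambda>x. z * a x) = z * p a) \<and>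
     (\<forall>a\<in>cont_alg X. p (\<lambda>x. cnj (a x) * a x) \<in> \<real>\<^sub>\<ge>\<^sub>0) \<and>
     (SUP a \<in> {a \<in> cont_alg X. \<forall>x\<in>topspace X. cmod (a x) \<le> 1}. ereal (cmod (p a))) = 1}"

definition weak_star_top :: "'a topology \<Rightarrow> (('a \<Rightarrow> complex) \<Rightarrow> complex) topology" where
  "weak_star_top X = subtopology (product_topology (\<lambda>_. euclidean) (cont_alg X)) (state_space X)"

type_synonym ('a, 'b) rep = "('a \<Rightarrow> complex) \<Rightarrow> ('b \<Rightarrow> complex) \<Rightarrow> 'b \<Rightarrow> complex"

definition commutator :: "'b op_graph \<Rightarrow> ('a, 'b) rep \<Rightarrow> ('a \<Rightarrow> complex) \<Rightarrow> 'b op_graph" where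
  "commutator D \<pi> a =
     {(h, (\<lambda>x. g' x - \<pi> a g x)) | h g g'. (h, g) \<in> D \<and> (\<pi> a h, g') \<in> D}"

definition connes_dist ::
    "'a topology \<Rightarrow> 'b measure \<Rightarrow> ('a, 'b) rep \<Rightarrow> 'b op_graph \<Rightarrow>
     (('a \<Rightarrow> complex) \<Rightarrow> complex) \<Rightarrow> (('a \<Rightarrow> complex) \<Rightarrow> complex) \<Rightarrow> ereal" where
  "connes_dist X M \<pi> D p q =
     (SUP a \<in> {a \<in> cont_alg X. densely_defined M (commutator D \<pi> a) \<and>
                 extends_boundedly M 1 (commutator D \<pi> a)}. ereal (cmod (p a - q a)))"

definition faithful_representation :: "'a topology \<Rightarrow> 'b measure \<Rightarrow> ('a, 'b) rep \<Rightarrow> bool" where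
  "faithful_representation X M \<pi> \<longleftrightarrow>
     (\<forall>a\<in>cont_alg X. \<exists>c. bounded_operator M c (\<pi> a)) \<and>
     (\<forall>a\<in>cont_alg X. \<forall>b\<in>cont_alg X. \<forall>h\<in>L2 M. \<forall>z.
        (AE x in M. \<pi> (\<lambda>y. a y + z * b y) h x = \<pi> a h x + z * \<pi> b h x) \<and>
        (AE x in M. \<pi> (\<lambda>y. a y * b y) h x = \<pi> a (\<pi> b h) x)) \<and>
     (\<forall>a\<in>cont_alg X. \<forall>h\<in>L2 M. \<forall>g\<in>L2 M.
        L2_inner M (\<pi> a h) g = L2_inner M h (\<pi> (\<lambda>y. cnj (a y)) g)) \<and>
     (\<forall>h\<in>L2 M. AE x in M. \<pi> (indicator (topspace X)) h x = h x) \<and>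
     (\<forall>a\<in>cont_alg X. (\<forall>h\<in>L2 M. AE x in M. \<pi> a h x = 0) \<longrightarrow> a = (\<lambda>_. 0))"

definition spectral_triple ::
    "'a topology \<Rightarrow> 'b measure \<Rightarrow> ('a, 'b) rep \<Rightarrow> 'b op_graph \<Rightarrow> bool" where
  "spectral_triple X M \<pi> D \<longleftrightarrow>
     faithful_representation X M \<pi> \<and> linear_graph M D \<and> essentially_self_adjoint M D \<and>
     unbounded_graph M D \<and> has_compact_resolvent M D \<and>
     (\<forall>a\<in>cont_alg X. \<forall>e>0. \<exists>b\<in>cont_alg X. (\<forall>x\<in>topspace X. cmod (a x - b x) < e) \<and>
        densely_defined M (commutator D \<pi> b) \<and> (\<exists>c. extends_boundedly M c (commutator D \<pi> b)))"

definition finite_metric_on :: "'p set \<Rightarrow> ('p \<Rightarrow> 'p \<Rightarrow> ereal) \<Rightarrow> bool" where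
  "finite_metric_on S d \<longleftrightarrow> (\<forall>p\<in>S. \<forall>q\<in>S. \<bar>d p q\<bar> \<noteq> \<infinity>) \<and>
     Metric_space S (\<lambda>p q. real_of_ereal (d p q))"

definition spectral_metric_space ::
    "'a topology \<Rightarrow> 'b measure \<Rightarrow> ('a, 'b) rep \<Rightarrow> 'b op_graph \<Rightarrow> bool" where
  "spectral_metric_space X M \<pi> D \<longleftrightarrow> spectral_triple X M \<pi> D \<and>
     finite_metric_on (state_space X) (connes_dist X M \<pi> D)"

section \<open>The spectral triple of a Gibbs measure\<close>

definition mult_rep :: "('a, 'a) rep" where
  "mult_rep a h = (\<lambda>x. a x * h x)"

definition dirac_partial_sum ::
    "nat \<Rightarrow> (nat \<Rightarrow> nat \<Rightarrow> nat) \<Rightarrow> (nat \<Rightarrow> nat) measure \<Rightarrow> (nat list \<Rightarrow> nat \<Rightarrow> nat) \<Rightarrow>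
     (nat list \<Rightarrow> real mat) \<Rightarrow> nat list set \<Rightarrow> ((nat \<Rightarrow> nat) \<Rightarrow> complex) \<Rightarrow>
     (nat \<Rightarrow> nat) \<Rightarrow> complex" where
  "dirac_partial_sum l A \<mu> \<theta> U F h \<omega> =
     (\<Sum>x=1..l. of_real (1 / measure \<mu> (cylinder l A [x])) *
        L2_inner \<mu> h (indicator (cylinder l A [x])) * indicator (cylinder l A [x]) \<omega>)
     - L2_inner \<mu> h (indicator (shift_space l A)) * indicator (shift_space l A) \<omega>
     + (\<Sum>y\<in>F. of_real ((real (n_succ l A y) - 1) / measure \<mu> (cylinder l A y)) *
          (\<Sum>k<n_succ l A y - 1.
             L2_inner \<mu> h (haar_fun l A \<mu> \<theta> U y k) * haar_fun l A \<mu> \<theta> U y k \<omega>))"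

text \<open>
  The domain consists of those \<open>h\<close> for which the series over all admissible words converges in
  mean square. Its terms are mutually orthogonal, so unconditional convergence is the same as
  convergence along any enumeration of the words.
\<close>

definition dirac ::
    "nat \<Rightarrow> (nat \<Rightarrow> nat \<Rightarrow> nat) \<Rightarrow> (nat \<Rightarrow> nat) measure \<Rightarrow> (nat list \<Rightarrow> nat \<Rightarrow> nat) \<Rightarrow>
     (nat list \<Rightarrow> real mat) \<Rightarrow> (nat \<Rightarrow> nat) op_graph" where
  "dirac l A \<mu> \<theta> U =
     {(h, f). h \<in> L2 \<mu> \<and> f \<in> L2 \<mu> \<and>
        ((\<lambda>F. L2_norm \<mu> (\<lambda>\<omega>. dirac_partial_sum l A \<mu> \<theta> U F h \<omega> - f \<omega>)) \<longlongrightarrow> 0)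
          (finite_subsets_at_top (adm_words l A))}"

end

theory Submission
  imports Defs "HOL-Complex_Analysis.Great_Picard"
begin

text \<open>
  The Haar functions at a word \<open>y\<close> span the functions that are constant on the children of \<open>y\<close> and
  orthogonal to the indicator of \<open>y\<close>. Hence the Dirac operator depends on the averages of a function
  over cylinders only, and \<open>(h, f)\<close> belongs to its graph iff the increments of the averages of \<open>f\<close> from a
  word to its children are those of \<open>h\<close> multiplied by the eigenvalue of the word, the average of \<open>f\<close>
  being 0. In this form self-adjointness, the resolvent at \<open>-1\<close> and the commutators with locally
  constant functions are explicit.

  Let \<open>[D, a]\<close> be densely defined with a bounded extension of norm at most 1. The constant function need
  not lie in the domain of the commutator, but the domain is invariant under multiplication by
  indicators of cylinders. Pairing \<open>[D, a] (1\<^sub>z h)\<close> with \<open>1\<^sub>z\<^sub>'\<close> for disjoint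
  cylinders and letting \<open>h\<close> tend to 1 therefore bounds the difference of the averages of \<open>a\<close> over \<open>z\<close> and
  \<open>z'\<close> by the reciprocal of the kernel of \<open>D\<close>. As the masses of the cylinders of a Gibbs measure decay
  exponentially, all such \<open>a\<close> share a modulus of continuity, so modulo constants they form a totally
  bounded set. Their multiples are dense since they include all locally constant functions. These two
  facts make the pseudo-metric a metric for the weak-* topology.
\<close>

text \<open>Scaling decides which estimates are possible. Pairing the commutator with the indicators
  of two cylinders \<open>z\<close>, \<open>z'\<close> that branch at a word \<open>y\<close> gives
  the kernel at \<open>y\<close> times the difference of the averages times
  \<open>mass z * mass z'\<close>, whereas the bound is \<open>sqrt (mass z * mass z')\<close>. The
  kernel is of order \<open>mass y\<close> to the power -2, so for \<open>z\<close>,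
  \<open>z'\<close> of mass comparable to \<open>mass y\<close> the averages differ by at most a
  multiple of \<open>mass y\<close>, which is summable along a path. The obstacle is that the kernel
  is the difference of a contribution of the proper prefixes of \<open>y\<close> and one of
  \<open>y\<close> itself, and these can cancel. Such a \<open>y\<close> is replaced by a shorter
  word at which they do not cancel; what must be shown is that this costs only a bounded factor of
  mass. The Gibbs property is used through one constant: a lower bound for the mass of a cylinder
  relative to that of its parent.\<close>

section \<open>Square-integrable functions\<close>

lemma L2_measurable[measurable_dest]: "f \<in> L2 M \<Longrightarrow> f \<in> borel_measurable M"
  by (simp add: L2_def)

lemma L2_square_integrable: "f \<in> L2 M \<Longrightarrow> integrable M (\<lambda>x. (cmod (f x))\<^sup>2)"
  by (simp add: L2_def)

lemma L2_zero[simp]: "(\<lambda>x. 0) \<in> L2 M"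
  by (simp add: L2_def)

lemma L2_norm_zero[simp]: "L2_norm M (\<lambda>x. 0) = 0"
  by (simp add: L2_norm_def)

lemma L2_norm_nonneg[simp]: "0 \<le> L2_norm M f"
  by (simp add: L2_norm_def)

lemma L2_norm_square: "(L2_norm M f)\<^sup>2 = (\<integral>x. (cmod (f x))\<^sup>2 \<partial>M)"
  by (simp add: L2_norm_def)

lemma L2_dominated:
  assumes "f \<in> L2 M" "g \<in> borel_measurable M" "\<And>x. x \<in> space M \<Longrightarrow> cmod (g x) \<le> C * cmod (f x)"
  shows "g \<in> L2 M" and "0 \<le> C \<Longrightarrow> L2_norm M g \<le> C * L2_norm M f"
proof -
  have sq: "(cmod (g x))\<^sup>2 \<le> C\<^sup>2 * (cmod (f x))\<^sup>2" if "x \<in> space M" for x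
    using power_mono[OF assms(3)[OF that], of 2] by (simp add: power_mult_distrib)
  have int: "integrable M (\<lambda>x. C\<^sup>2 * (cmod (f x))\<^sup>2)"
    using L2_square_integrable[OF assms(1)] by simp
  have int_g: "integrable M (\<lambda>x. (cmod (g x))\<^sup>2)"
    by (rule Bochner_Integration.integrable_bound[OF int]) (use assms(2) sq in auto)
  then show "g \<in> L2 M"
    using assms(2) by (simp add: L2_def)
  have "(L2_norm M g)\<^sup>2 \<le> (\<integral>x. C\<^sup>2 * (cmod (f x))\<^sup>2 \<partial>M)"
    unfolding L2_norm_square by (intro integral_mono int_g int sq)
  also have "\<dots> = (C * L2_norm M f)\<^sup>2"
    by (simp add: power_mult_distrib L2_norm_square)
  finally have "(L2_norm M g)\<^sup>2 \<le> (C * L2_norm M f)\<^sup>2" .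
  then show "L2_norm M g \<le> C * L2_norm M f" if "0 \<le> C"
    by (rule power2_le_imp_le) (use that in auto)
qed

lemma L2_scale:
  assumes "f \<in> L2 M"
  shows "(\<lambda>x. c * f x) \<in> L2 M" and "L2_norm M (\<lambda>x. c * f x) = cmod c * L2_norm M f"
proof -
  show "(\<lambda>x. c * f x) \<in> L2 M"
    by (rule L2_dominated(1)[OF assms, where C = "cmod c"]) (use assms in \<open>auto simp: norm_mult\<close>)
  show "L2_norm M (\<lambda>x. c * f x) = cmod c * L2_norm M f"
    by (simp add: L2_norm_def norm_mult power_mult_distrib real_sqrt_mult)
qed

lemma borel_measurable_cnj[measurable]: "cnj \<in> borel_measurable borel"
  by (intro borel_measurable_continuous_onI continuous_intros)

lemma L2_cnj: "f \<in> L2 M \<Longrightarrow> (\<lambda>x. cnj (f x)) \<in> L2 M"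
  by (auto simp: L2_def)

lemma L2_mult_integrable:
  assumes "f \<in> L2 M" "g \<in> L2 M"
  shows "integrable M (\<lambda>x. f x * g x)"
proof (rule Bochner_Integration.integrable_bound)
  show "integrable M (\<lambda>x. (cmod (f x))\<^sup>2 + (cmod (g x))\<^sup>2)"
    using assms by (simp add: L2_square_integrable)
  have "cmod (f x) * cmod (g x) \<le> (cmod (f x))\<^sup>2 + (cmod (g x))\<^sup>2" for x
    using sum_squares_bound[of "cmod (f x)" "cmod (g x)"]
      mult_nonneg_nonneg[OF norm_ge_zero norm_ge_zero, of "f x" "g x"] by linarith
  then show "AE x in M. norm (f x * g x) \<le> norm ((cmod (f x))\<^sup>2 + (cmod (g x))\<^sup>2)"
    by (simp add: norm_mult)
qed (use assms in measurable)

lemma L2_inner_integrable: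
  "f \<in> L2 M \<Longrightarrow> g \<in> L2 M \<Longrightarrow> integrable M (\<lambda>x. f x * cnj (g x))"
  by (intro L2_mult_integrable L2_cnj)

lemma L2_add:
  assumes "f \<in> L2 M" "g \<in> L2 M"
  shows "(\<lambda>x. f x + g x) \<in> L2 M"
proof -
  have "integrable M (\<lambda>x. (cmod (f x + g x))\<^sup>2)"
  proof (rule Bochner_Integration.integrable_bound)
    show "integrable M (\<lambda>x. 2 * (cmod (f x))\<^sup>2 + 2 * (cmod (g x))\<^sup>2)"
      using assms by (simp add: L2_square_integrable)
    have "(cmod (f x + g x))\<^sup>2 \<le> 2 * (cmod (f x))\<^sup>2 + 2 * (cmod (g x))\<^sup>2" for x
    proof -
      have "(cmod (f x + g x))\<^sup>2 \<le> (cmod (f x) + cmod (g x))\<^sup>2"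
        by (intro power_mono norm_triangle_ineq) simp
      also have "\<dots> \<le> 2 * (cmod (f x))\<^sup>2 + 2 * (cmod (g x))\<^sup>2"
        using sum_squares_bound[of "cmod (f x)" "cmod (g x)"] by (simp add: power2_sum)
      finally show ?thesis .
    qed
    then show "AE x in M. norm ((cmod (f x + g x))\<^sup>2)
      \<le> norm (2 * (cmod (f x))\<^sup>2 + 2 * (cmod (g x))\<^sup>2)"
      by simp
  qed (use assms in measurable)
  then show ?thesis
    using assms by (auto simp: L2_def)
qed

lemma L2_diff:
  assumes "f \<in> L2 M" "g \<in> L2 M"
  shows "(\<lambda>x. f x - g x) \<in> L2 M"
  using L2_add[OF assms(1) L2_scale(1)[OF assms(2), of "-1"]] by simp

lemma L2_sum: "(\<And>i. i \<in> I \<Longrightarrow> f i \<in> L2 M) \<Longrightarrow> (\<lambda>x. \<Sum>i\<in>I. f i x) \<in> L2 M"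
proof (induction I rule: infinite_finite_induct)
  case (insert i I)
  then show ?case
    using L2_add[of "f i" M "\<lambda>x. \<Sum>i\<in>I. f i x"] by simp
qed simp_all

lemma L2_norm_add_square:
  assumes "f \<in> L2 M" "g \<in> L2 M"
  shows "(L2_norm M (\<lambda>x. f x + g x))\<^sup>2
    = (L2_norm M f)\<^sup>2 + 2 * Re (L2_inner M f g) + (L2_norm M g)\<^sup>2"
proof -
  have "(cmod (f x + g x))\<^sup>2 = (cmod (f x))\<^sup>2 + 2 * Re (f x * cnj (g x)) + (cmod (g x))\<^sup>2" for x
    unfolding cmod_power2 by (simp add: power2_eq_square algebra_simps)
  moreover have "(\<integral>x. Re (f x * cnj (g x)) \<partial>M) = Re (L2_inner M f g)"
    unfolding L2_inner_def by (intro integral_Re L2_inner_integrable assms)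
  moreover have "integrable M (\<lambda>x. Re (f x * cnj (g x)))"
    by (intro integrable_Re L2_inner_integrable assms)
  ultimately show ?thesis
    unfolding L2_norm_square
    using assms by (simp add: L2_square_integrable del: times_complex.sel)
qed

lemma L2_cauchy_schwarz_abs:
  assumes "f \<in> L2 M" "g \<in> L2 M"
  shows "(\<integral>x. cmod (f x) * cmod (g x) \<partial>M) \<le> L2_norm M f * L2_norm M g"
proof -
  define a b c where "a = (L2_norm M f)\<^sup>2" and "b = (\<integral>x. cmod (f x) * cmod (g x) \<partial>M)"
    and "c = (L2_norm M g)\<^sup>2"
  have int: "integrable M (\<lambda>x. cmod (f x) * cmod (g x))"
    using integrable_norm[OF L2_mult_integrable[OF assms]] by (simp add: norm_mult)
  \<comment> \<open>The squared norm of \<open>t * cmod f - cmod g\<close>, expanded as a quadratic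
    polynomial in \<open>t\<close>.\<close>
  have quad: "0 \<le> t\<^sup>2 * a - 2 * t * b + c" for t
  proof -
    have "0 \<le> (\<integral>x. (t * cmod (f x) - cmod (g x))\<^sup>2 \<partial>M)"
      by simp
    also have "\<dots> = (\<integral>x. t\<^sup>2 * (cmod (f x))\<^sup>2 - 2 * t * (cmod (f x) * cmod (g x)) + (cmod (g x))\<^sup>2 \<partial>M)"
      by (intro Bochner_Integration.integral_cong) (auto simp: power2_eq_square algebra_simps)
    also have "\<dots> = t\<^sup>2 * a - 2 * t * b + c"
      unfolding a_def b_def c_def L2_norm_square
      using assms int by (simp add: L2_square_integrable)
    finally show ?thesis .
  qed
  have b: "0 \<le> b"
    unfolding b_def by simp
  have "b\<^sup>2 \<le> a * c"
  proof (cases "a = 0")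
    case True
    show ?thesis
    proof (cases "b = 0")
      case False
      \<comment> \<open>Here the polynomial is linear, and this \<open>t\<close> gives it the value
        -1.\<close>
      then show ?thesis
        using quad[of "(c + 1) / (2 * b)"] True by (simp add: field_simps)
    qed (use True in simp)
  next
    case False
    then have "a > 0"
      by (simp add: a_def)
    then show ?thesis
      using quad[of "b / a"] by (simp add: field_simps power2_eq_square)
  qed
  then have "b\<^sup>2 \<le> (L2_norm M f * L2_norm M g)\<^sup>2"
    by (simp add: a_def c_def power_mult_distrib)
  then show ?thesis
    unfolding b_def by (rule power2_le_imp_le) simp
qed

lemma L2_cauchy_schwarz:
  assumes "f \<in> L2 M" "g \<in> L2 M"
  shows "cmod (L2_inner M f g) \<le> L2_norm M f * L2_norm M g"
proof -
  have "cmod (L2_inner M f g) \<le> (\<integral>x. cmod (f x * cnj (g x)) \<partial>M)"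
    unfolding L2_inner_def by simp
  also have "\<dots> = (\<integral>x. cmod (f x) * cmod (g x) \<partial>M)"
    by (simp add: norm_mult)
  finally show ?thesis
    using L2_cauchy_schwarz_abs[OF assms] by linarith
qed

lemma L2_norm_triangle:
  assumes "f \<in> L2 M" "g \<in> L2 M"
  shows "L2_norm M (\<lambda>x. f x + g x) \<le> L2_norm M f + L2_norm M g"
proof -
  have "Re (L2_inner M f g) \<le> L2_norm M f * L2_norm M g"
    using L2_cauchy_schwarz[OF assms] complex_Re_le_cmod order_trans by blast
  then have "(L2_norm M (\<lambda>x. f x + g x))\<^sup>2 \<le> (L2_norm M f + L2_norm M g)\<^sup>2"
    unfolding L2_norm_add_square[OF assms] by (simp add: power2_sum)
  then show ?thesis
    by (rule power2_le_imp_le) simp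
qed

lemma L2_norm_diff_commute: "L2_norm M (\<lambda>x. f x - g x) = L2_norm M (\<lambda>x. g x - f x)"
  by (simp add: L2_norm_def norm_minus_commute)

lemma L2_norm_diff_triangle:
  assumes "f \<in> L2 M" "g \<in> L2 M" "h \<in> L2 M"
  shows "L2_norm M (\<lambda>x. f x - h x) \<le> L2_norm M (\<lambda>x. f x - g x) + L2_norm M (\<lambda>x. g x - h x)"
  using L2_norm_triangle[OF L2_diff[OF assms(1,2)] L2_diff[OF assms(2,3)]] by simp

text \<open>Pythagoras. It serves twice: for the best approximation by functions of \<open>n\<close>
  letters, and for the remainder of the Dirac series.\<close>

lemma L2_norm_le_orthogonal:
  assumes "f \<in> L2 M" "g \<in> L2 M" "L2_inner M f g = 0"
  shows "L2_norm M f \<le> L2_norm M (\<lambda>x. f x + g x)"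
  by (rule power2_le_imp_le) (use L2_norm_add_square[OF assms(1,2)] assms(3) in auto)

lemma L2_norm_eq_0_iff:
  assumes "f \<in> L2 M"
  shows "L2_norm M f = 0 \<longleftrightarrow> (AE x in M. f x = 0)"
  unfolding L2_norm_def
  using integral_nonneg_eq_0_iff_AE[OF L2_square_integrable[OF assms]] by simp

lemma L2_inner_scale_left: "L2_inner M (\<lambda>x. c * f x) g = c * L2_inner M f g"
  by (simp add: L2_inner_def mult.assoc)

lemma L2_inner_scale_right: "L2_inner M f (\<lambda>x. c * g x) = cnj c * L2_inner M f g"
  by (simp add: L2_inner_def mult.left_commute)

lemma L2_inner_sum_left:
  assumes "u \<in> L2 M" "\<And>i. i \<in> I \<Longrightarrow> g i \<in> L2 M"
  shows "L2_inner M (\<lambda>x. \<Sum>i\<in>I. g i x) u = (\<Sum>i\<in>I. L2_inner M (g i) u)"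
  unfolding L2_inner_def using assms
  by (simp add: sum_distrib_right L2_inner_integrable)

lemma L2_inner_sum_right:
  assumes "u \<in> L2 M" "\<And>i. i \<in> I \<Longrightarrow> g i \<in> L2 M"
  shows "L2_inner M u (\<lambda>x. \<Sum>i\<in>I. g i x) = (\<Sum>i\<in>I. L2_inner M u (g i))"
  unfolding L2_inner_def using assms
  by (simp add: sum_distrib_left L2_inner_integrable)

lemma L2_inner_diff_left:
  assumes "f \<in> L2 M" "g \<in> L2 M" "h \<in> L2 M"
  shows "L2_inner M (\<lambda>x. f x - g x) h = L2_inner M f h - L2_inner M g h"
  unfolding L2_inner_def using assms by (simp add: left_diff_distrib L2_inner_integrable)

lemma L2_inner_commute: "L2_inner M f g = cnj (L2_inner M g f)"
proof -
  have "cnj (L2_inner M g f) = (\<integral>x. cnj (g x * cnj (f x)) \<partial>M)"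
    unfolding L2_inner_def by (rule Bochner_Integration.integral_cnj[symmetric])
  then show ?thesis
    by (simp add: L2_inner_def mult.commute)
qed

text \<open>The filter is arbitrary because the Dirac series converges along finite sets of words,
  not along a sequence.\<close>

lemma tendsto_L2_inner:
  assumes "((\<lambda>i. L2_norm M (\<lambda>x. g i x - f x)) \<longlongrightarrow> 0) net"
    and "\<And>i. g i \<in> L2 M" "f \<in> L2 M" "h \<in> L2 M"
  shows "((\<lambda>i. L2_inner M (g i) h) \<longlongrightarrow> L2_inner M f h) net"
proof (rule Lim_transform2[OF tendsto_const])
  have "((\<lambda>i. L2_norm M (\<lambda>x. g i x - f x) * L2_norm M h) \<longlongrightarrow> 0) net"
    using tendsto_mult[OF assms(1) tendsto_const[of "L2_norm M h"]] by simp
  then have "((\<lambda>i. L2_inner M (\<lambda>x. g i x - f x) h) \<longlongrightarrow> 0) net"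
    by (rule Lim_null_comparison[rotated])
      (auto intro!: always_eventually L2_cauchy_schwarz L2_diff assms)
  from tendsto_minus[OF this] show "((\<lambda>i. L2_inner M f h - L2_inner M (g i) h) \<longlongrightarrow> 0) net"
    using assms by (simp add: L2_inner_diff_left)
qed

section \<open>Bounded functions on a probability space\<close>

context prob_space
begin

lemma L2_bounded:
  assumes "f \<in> borel_measurable M" "\<And>x. x \<in> space M \<Longrightarrow> cmod (f x) \<le> C" "0 \<le> C"
  shows "f \<in> L2 M" and "L2_norm M f \<le> C"
proof -
  have one: "(\<lambda>_. 1) \<in> L2 M" "L2_norm M (\<lambda>_. 1) = 1"
    by (auto simp: L2_def L2_norm_def prob_space)
  show "f \<in> L2 M"
    by (rule L2_dominated(1)[OF one(1), where C = C]) (use assms in auto)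
  show "L2_norm M f \<le> C"
    using L2_dominated(2)[OF one(1), where C = C and g = f] assms one(2) by auto
qed

lemma L2_indicator: "A \<in> sets M \<Longrightarrow> (indicator A :: 'a \<Rightarrow> complex) \<in> L2 M"
  by (rule L2_bounded(1)[where C = 1]) (auto simp: indicator_def)

lemma L2_norm_indicator:
  assumes "A \<in> sets M"
  shows "L2_norm M (indicator A) = sqrt (measure M A)"
proof -
  have "(cmod (indicator A x))\<^sup>2 = indicator A x" for x
    by (simp add: indicator_def)
  then show ?thesis
    using assms by (simp add: L2_norm_def)
qed

lemma L2_integrable:
  assumes "f \<in> L2 M"
  shows "integrable M f"
  using L2_mult_integrable[OF assms L2_bounded(1)[of "\<lambda>_. 1" 1]] by simp

end

section \<open>Cylinders and averages\<close>

text \<open>\<open>letter_mat_pow\<close> multiplies by \<open>A\<close> on the right, so the last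
  step of a path is at hand, while the first one has to be extracted by induction.\<close>

lemma letter_mat_pow_first_step:
  assumes "letter_mat_pow l A n i j > 0" "n \<ge> 1" "j \<in> {1..l}"
  shows "\<exists>k\<in>{1..l}. A i k > 0"
  using assms
proof (induction n arbitrary: j)
  case (Suc n)
  from Suc.prems(1) have "(\<Sum>k=1..l. letter_mat_pow l A n i k * A k j) \<noteq> 0"
    by (simp only: letter_mat_pow.simps)
  then obtain k where k: "k \<in> {1..l}" "letter_mat_pow l A n i k * A k j > 0"
    by (metis (no_types, lifting) gr0I sum.neutral)
  show ?case
  proof (cases "n = 0")
    case True
    with k have "A i j > 0"
      by (auto split: if_splits)
    then show ?thesis
      using Suc.prems by blast
  next
    case False
    then show ?thesis
      using Suc.IH[of k] k by simp
  qed
qed simp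

lemma length_prefix_of[simp]: "length (prefix_of n \<omega>) = n"
  by (simp add: prefix_of_def)

lemma prefix_of_0[simp]: "prefix_of 0 \<omega> = []"
  by (simp add: prefix_of_def)

lemma prefix_of_Suc: "prefix_of (Suc n) \<omega> = prefix_of n \<omega> @ [\<omega> n]"
  by (simp add: prefix_of_def)

lemma prefix_of_eq_Nil[simp]: "prefix_of n \<omega> = [] \<longleftrightarrow> n = 0"
  by (simp add: prefix_of_def)

lemma take_prefix_of[simp]: "take m (prefix_of n \<omega>) = prefix_of (min m n) \<omega>"
  by (simp add: prefix_of_def take_map take_upt min_def)

lemma nth_prefix_of[simp]: "i < n \<Longrightarrow> prefix_of n \<omega> ! i = \<omega> i"
  by (simp add: prefix_of_def)

lemma prefix_of_eq_iff: "prefix_of n \<omega> = prefix_of n \<upsilon> \<longleftrightarrow> (\<forall>i<n. \<omega> i = \<upsilon> i)"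
  by (auto simp: prefix_of_def)

section \<open>The tree of admissible words\<close>

locale subshift =
  fixes l :: nat and A :: "nat \<Rightarrow> nat \<Rightarrow> nat"
  assumes two_letters: "l \<ge> 2"
    and A01: "\<And>i j. i \<in> {1..l} \<Longrightarrow> j \<in> {1..l} \<Longrightarrow> A i j \<in> {0, 1}"
    and irreducible: "irreducible_mat l A"
    and aperiodic: "aperiodic_mat l A"
begin

abbreviation "X \<equiv> shift_space l A"
abbreviation "cyl \<equiv> cylinder l A"
abbreviation "adm \<equiv> adm_words l A"
text \<open>The empty word is added as the root of a tree in which all letters are its children. The
  choice of the first letter, which the Haar basis treats separately, then becomes a branching like
  any other.\<close>

abbreviation "nodes \<equiv> insert [] (adm_words l A)"

definition children :: "nat list \<Rightarrow> nat set" where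
  "children w = {i. w @ [i] \<in> adm}"

definition level :: "nat \<Rightarrow> nat list set" where
  "level n = {w \<in> nodes. length w = n}"

lemma cyl_Nil[simp]: "cyl [] = X"
  by (simp add: cylinder_def)

lemma cyl_subset: "cyl w \<subseteq> X"
  by (auto simp: cylinder_def)

lemma in_cyl_iff: "\<omega> \<in> cyl w \<longleftrightarrow> \<omega> \<in> X \<and> prefix_of (length w) \<omega> = w"
  by (auto simp: cylinder_def)

lemma in_cyl_prefix_of: "\<omega> \<in> X \<Longrightarrow> \<omega> \<in> cyl (prefix_of n \<omega>)"
  by (simp add: in_cyl_iff)

text \<open>Irreducibility excludes dead ends: every letter lies on a closed path, whose first step
  is a successor.\<close>

lemma ex_successor:
  assumes "i \<in> {1..l}"
  shows "\<exists>j. j \<in> {1..l} \<and> A i j = 1"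
proof -
  obtain n where "n \<ge> 1" "letter_mat_pow l A n i i > 0"
    using irreducible assms unfolding irreducible_mat_def by blast
  then obtain j where "j \<in> {1..l}" "A i j > 0"
    using letter_mat_pow_first_step[of l A n i i] assms by auto
  then show ?thesis
    using A01[OF assms, of j] by auto
qed

lemma prefix_of_adm:
  assumes "\<omega> \<in> X" "n \<ge> 1"
  shows "prefix_of n \<omega> \<in> adm"
proof -
  have "set (prefix_of n \<omega>) \<subseteq> {1..l}"
    using assms(1) by (auto simp: prefix_of_def shift_space_def)
  moreover have "A (prefix_of n \<omega> ! i) (prefix_of n \<omega> ! Suc i) = 1" if "Suc i < n" for i
    using assms(1) that by (simp add: shift_space_def)
  ultimately show ?thesis
    using assms(2) by (auto simp: adm_words_def)
qed

lemma prefix_of_nodes: "\<omega> \<in> X \<Longrightarrow> prefix_of n \<omega> \<in> nodes"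
  using prefix_of_adm[of \<omega> n] by (cases "n = 0") auto

text \<open>One successor \<open>s i\<close> is fixed for every letter \<open>i\<close>, and the
  word is continued by iterating \<open>s\<close> from its last letter.\<close>

lemma adm_extends:
  assumes "w \<in> adm"
  obtains \<omega> where "\<omega> \<in> cyl w"
proof -
  obtain s where s: "\<And>i. i \<in> {1..l} \<Longrightarrow> s i \<in> {1..l} \<and> A i (s i) = 1"
    using ex_successor by metis
  define tail where "tail = (\<lambda>n. (s ^^ n) (last w))"
  have w: "w \<noteq> []" "set w \<subseteq> {1..l}" "\<And>i. Suc i < length w \<Longrightarrow> A (w ! i) (w ! Suc i) = 1"
    using assms by (auto simp: adm_words_def)
  have last: "last w \<in> {1..l}"
    using w(1,2) last_in_set by blast
  have tail: "tail n \<in> {1..l}" for n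
    by (induction n) (use last s in \<open>simp_all add: tail_def\<close>)
  \<comment> \<open>\<open>tail 0\<close> is the last letter of \<open>w\<close>, which is already
    in place; the continuation starts with \<open>tail 1\<close> at position
    \<open>length w\<close>.\<close>
  define \<omega> where "\<omega> n = (if n < length w then w ! n else tail (n + 1 - length w))" for n
  have "\<omega> n \<in> {1..l}" for n
    using w(2) tail nth_mem[of n w] by (auto simp: \<omega>_def simp del: nth_mem)
  moreover have "A (\<omega> n) (\<omega> (Suc n)) = 1" for n
  proof -
    consider "Suc n < length w" | "Suc n = length w" | "length w \<le> n"
      by linarith
    then show ?thesis
    proof cases
      case 1
      then show ?thesis using w(3) by (simp add: \<omega>_def)
    next
      case 2
      then have "last w = w ! n"
        using w(1) by (metis diff_Suc_1 last_conv_nth)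
      then show ?thesis
        using 2 s[of "last w"] tail[of 0] by (simp add: \<omega>_def tail_def flip: 2)
    next
      case 3
      then show ?thesis
        using s[OF tail[of "Suc n - length w"]] by (simp add: \<omega>_def Suc_diff_le tail_def)
    qed
  qed
  ultimately have "\<omega> \<in> X"
    by (simp add: shift_space_def)
  moreover have "prefix_of (length w) \<omega> = w"
    by (auto simp: prefix_of_def \<omega>_def intro: nth_equalityI)
  ultimately show ?thesis
    using that by (simp add: in_cyl_iff)
qed

lemma node_extends:
  assumes "w \<in> nodes"
  obtains \<omega> where "\<omega> \<in> cyl w"
proof (cases "w = []")
  case True
  have "[1] \<in> adm"
    using two_letters by (simp add: adm_words_def)
  then show ?thesis
    using adm_extends that True by (metis cyl_Nil cyl_subset subsetD)
qed (use assms adm_extends that in blast)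

lemma children_prefix_of: "\<omega> \<in> X \<Longrightarrow> \<omega> n \<in> children (prefix_of n \<omega>)"
  using prefix_of_adm[of \<omega> "Suc n"] by (simp add: children_def prefix_of_Suc)

text \<open>Closure under prefixes is read off a point of the cylinder; this avoids arguing about
  the list conditions in \<open>adm_words\<close>.\<close>

lemma butlast_node:
  assumes "w @ [i] \<in> adm"
  shows "w \<in> nodes"
proof -
  obtain \<omega> where "\<omega> \<in> cyl (w @ [i])"
    using adm_extends[OF assms] .
  then show ?thesis
    using prefix_of_nodes[of \<omega> "length w"] by (auto simp: in_cyl_iff prefix_of_Suc)
qed

lemma nodes_take:
  assumes "w \<in> nodes"
  shows "take n w \<in> nodes"
proof -
  obtain \<omega> where "\<omega> \<in> X" "w = prefix_of (length w) \<omega>"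
    using node_extends[OF assms] by (metis in_cyl_iff)
  then show ?thesis
    using prefix_of_nodes by (metis take_prefix_of)
qed

lemma children_subset: "children w \<subseteq> {1..l}"
  by (auto simp: children_def adm_words_def)

lemma finite_children[simp]: "finite (children w)"
  using children_subset finite_subset by blast

lemma children_nonempty: "w \<in> nodes \<Longrightarrow> children w \<noteq> {}"
  using children_prefix_of by (metis empty_iff in_cyl_iff node_extends)

lemma children_Nil: "children [] = {1..l}"
  by (auto simp: children_def adm_words_def)

lemma children_adm:
  assumes "w \<in> adm"
  shows "children w = successors l A w"
proof -
  have w: "w \<noteq> []" "set w \<subseteq> {1..l}" "\<And>i. Suc i < length w \<Longrightarrow> A (w ! i) (w ! Suc i) = 1"
    using assms by (auto simp: adm_words_def)
  have "w @ [i] \<in> adm \<longleftrightarrow> i \<in> {1..l} \<and> A (last w) i = 1" for i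
  proof
    assume *: "w @ [i] \<in> adm"
    then have "A ((w @ [i]) ! j) ((w @ [i]) ! Suc j) = 1" if "Suc j < length (w @ [i])" for j
      using that unfolding adm_words_def by blast
    from this[of "length w - 1"]
    have "A ((w @ [i]) ! (length w - 1)) ((w @ [i]) ! Suc (length w - 1)) = 1"
      using w(1) by simp
    then show "i \<in> {1..l} \<and> A (last w) i = 1"
      using * w(1) by (auto simp: adm_words_def nth_append last_conv_nth split: if_splits)
  next
    assume *: "i \<in> {1..l} \<and> A (last w) i = 1"
    have "A ((w @ [i]) ! j) ((w @ [i]) ! Suc j) = 1" if "Suc j < Suc (length w)" for j
    proof (cases "Suc j < length w")
      case True
      then show ?thesis using w(3) by (simp add: nth_append)
    next
      case False
      then have "Suc j = length w" using that by simp
      moreover from this have "last w = w ! j" using w(1) by (metis diff_Suc_1 last_conv_nth)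
      ultimately show ?thesis using * by (simp add: nth_append)
    qed
    then show "w @ [i] \<in> adm"
      using * w by (simp add: adm_words_def)
  qed
  then show ?thesis
    by (auto simp: children_def successors_def)
qed

lemma n_succ_adm:
  assumes "w \<in> adm"
  shows "n_succ l A w = card (children w)"
proof -
  have last: "last w \<in> {1..l}"
    using assms last_in_set unfolding adm_words_def by blast
  have "n_succ l A w = (\<Sum>i\<in>{1..l}. if A (last w) i = 1 then 1 else 0)"
    unfolding n_succ_def using A01[OF last] by (intro sum.cong) auto
  also have "\<dots> = card {i \<in> {1..l}. A (last w) i = 1}"
    by (simp add: sum.If_cases Int_def)
  finally show ?thesis
    by (simp add: children_adm[OF assms] successors_def)
qed

lemma finite_level[simp]: "finite (level n)"
proof (rule finite_subset)
  show "level n \<subseteq> {w. set w \<subseteq> {1..l} \<and> length w = n}"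
    by (auto simp: level_def adm_words_def)
qed (simp add: finite_lists_length_eq)

lemma prefix_of_level: "\<omega> \<in> X \<Longrightarrow> prefix_of n \<omega> \<in> level n"
  using prefix_of_nodes by (simp add: level_def)

lemma level_length: "w \<in> level n \<Longrightarrow> length w = n"
  by (simp add: level_def)

lemma level_node: "w \<in> level n \<Longrightarrow> w \<in> nodes"
  by (simp add: level_def)

text \<open>The cylinders of one length partition the space, so one summand survives. The
  coefficients lie in a semiring because both real and complex ones occur.\<close>

lemma sum_level:
  fixes c :: "nat list \<Rightarrow> 'a::semiring_1"
  assumes "\<omega> \<in> X"
  shows "(\<Sum>w\<in>level n. c w * indicator (cyl w) \<omega>) = c (prefix_of n \<omega>)"
proof -
  have "(\<Sum>w\<in>level n. c w * indicator (cyl w) \<omega>)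
      = (\<Sum>w\<in>level n. if w = prefix_of n \<omega> then c w else 0)"
    using assms by (intro sum.cong) (auto simp: indicator_def in_cyl_iff level_length)
  then show ?thesis
    using prefix_of_level[OF assms] by simp
qed

lemma sum_children_indicator:
  fixes c :: "nat \<Rightarrow> complex"
  assumes "\<omega> \<in> X"
  shows "(\<Sum>i\<in>children w. c i * indicator (cyl (w @ [i])) \<omega>)
    = indicator (cyl w) \<omega> * c (\<omega> (length w))"
proof -
  have "(\<Sum>i\<in>children w. c i * indicator (cyl (w @ [i])) \<omega>)
      = (\<Sum>i\<in>children w. if i = \<omega> (length w) then indicator (cyl w) \<omega> * c i else 0)"
    using assms by (intro sum.cong) (auto simp: indicator_def in_cyl_iff prefix_of_Suc)
  also have "\<dots> = indicator (cyl w) \<omega> * c (\<omega> (length w))"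
    using children_prefix_of[OF assms, of "length w"]
    by (auto simp: indicator_def in_cyl_iff)
  finally show ?thesis .
qed

lemma topspace_shift[simp]: "topspace (shift_top l A) = X"
proof -
  have "\<Union>(cyl ` adm) = X"
    using cyl_subset in_cyl_prefix_of[of _ 1] prefix_of_adm[of _ 1] by fastforce
  then show ?thesis
    by (simp add: shift_top_def)
qed

lemma openin_cyl: "w \<in> nodes \<Longrightarrow> openin (shift_top l A) (cyl w)"
proof (cases "w = []")
  case True
  then show ?thesis
    using openin_topspace[of "shift_top l A"] by (simp only: cyl_Nil topspace_shift)
qed (simp add: shift_top_def topology_generated_by_Basis)

end

text \<open>This abstracts what is needed of a Gibbs measure: every child receives at least the
  fraction \<open>\<kappa>\<close> of the mass of its parent. The parent may be the root.\<close>

locale shift_measure = subshift l A for l A +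
  fixes \<mu> :: "(nat \<Rightarrow> nat) measure" and \<kappa> :: real
  assumes prob_mu: "prob_space \<mu>"
    and sets_mu: "sets \<mu> = sets (shift_borel l A)"
    and kappa_pos: "0 < \<kappa>"
    and kappa_mass: "\<And>w i. w @ [i] \<in> adm_words l A \<Longrightarrow>
      \<kappa> * measure \<mu> (cylinder l A w) \<le> measure \<mu> (cylinder l A (w @ [i]))"
begin

sublocale prob_space \<mu>
  by (rule prob_mu)

abbreviation "mass w \<equiv> measure \<mu> (cylinder l A w)"

lemma space_mu[simp]: "space \<mu> = X"
proof -
  have "{S. openin (shift_top l A) S} \<subseteq> Pow X"
    using openin_subset[of "shift_top l A"] by auto
  then show ?thesis
    using sets_eq_imp_space_eq[OF sets_mu] by (simp add: shift_borel_def space_measure_of_conv)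
qed

lemma sets_mu_sigma: "sets \<mu> = sigma_sets X {S. openin (shift_top l A) S}"
proof -
  have "{S. openin (shift_top l A) S} \<subseteq> Pow X"
    using openin_subset[of "shift_top l A"] by auto
  then show ?thesis
    by (simp add: sets_mu shift_borel_def sets_measure_of_conv)
qed

lemma open_sets: "openin (shift_top l A) S \<Longrightarrow> S \<in> sets \<mu>"
  by (auto simp: sets_mu_sigma)

text \<open>Cylinders along \<open>\<omega>\<close> are nested, so of two of them the one with the
  longer prefix lies in the intersection.\<close>

lemma open_contains_cyl:
  assumes "openin (shift_top l A) S" "\<omega> \<in> S"
  shows "\<exists>n. cyl (prefix_of n \<omega>) \<subseteq> S"
proof -
  have "generate_topology_on (cyl ` adm) S"
    using assms(1) by (simp add: shift_top_def openin_topology_generated_by_iff)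
  then show ?thesis
    using assms(2)
  proof (induction rule: generate_topology_on.induct)
    case (Int a b)
    then obtain m n where mn: "cyl (prefix_of m \<omega>) \<subseteq> a" "cyl (prefix_of n \<omega>) \<subseteq> b"
      by auto
    have "cyl (prefix_of (max m n) \<omega>) \<subseteq> cyl (prefix_of m \<omega>)"
         "cyl (prefix_of (max m n) \<omega>) \<subseteq> cyl (prefix_of n \<omega>)"
      by (auto simp: in_cyl_iff prefix_of_eq_iff)
    then show ?case
      using mn by blast
  next
    case (UN K)
    then show ?case by (meson Sup_upper order_trans UnionE)
  next
    case (Basis s)
    then obtain w where "s = cyl w" by auto
    then show ?case
      using Basis by (metis in_cyl_iff order_refl)
  qed auto
qed

text \<open>Stated for all lists, so that measurability carries no side condition: the cylinder of a
  word that is not admissible is empty.\<close>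

lemma cyl_sets[measurable]: "cyl w \<in> sets \<mu>"
proof (cases "w \<in> nodes")
  case True
  then show ?thesis by (simp add: openin_cyl open_sets)
next
  case False
  then have "cyl w = {}"
    using prefix_of_nodes by (metis all_not_in_conv in_cyl_iff)
  then show ?thesis by simp
qed

text \<open>There are countably many words, so every open set is a countable union of
  cylinders.\<close>

lemma sets_mu_cyl: "sets \<mu> = sigma_sets X (cyl ` nodes)"
proof (intro equalityI subsetI)
  fix S assume "S \<in> sets \<mu>"
  then have "S \<in> sigma_sets X {S. openin (shift_top l A) S}"
    by (simp add: sets_mu_sigma)
  then show "S \<in> sigma_sets X (cyl ` nodes)"
  proof (rule sigma_sets_mono[THEN subsetD, rotated], intro subsetI)
    fix S assume "S \<in> {S. openin (shift_top l A) S}"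
    then have "openin (shift_top l A) S" by simp
    have S: "S = \<Union>(cyl ` {w \<in> nodes. cyl w \<subseteq> S})"
    proof (intro equalityI subsetI)
      fix \<omega> assume "\<omega> \<in> S"
      then have "\<omega> \<in> X"
        using \<open>openin (shift_top l A) S\<close> openin_subset by fastforce
      moreover obtain n where "cyl (prefix_of n \<omega>) \<subseteq> S"
        using open_contains_cyl[OF \<open>openin (shift_top l A) S\<close> \<open>\<omega> \<in> S\<close>] by blast
      ultimately show "\<omega> \<in> \<Union>(cyl ` {w \<in> nodes. cyl w \<subseteq> S})"
        using in_cyl_prefix_of[of \<omega> n] prefix_of_nodes[of \<omega> n] by blast
    qed auto
    have "countable (cyl ` {w \<in> nodes. cyl w \<subseteq> S})"
      by auto
    then show "S \<in> sigma_sets X (cyl ` nodes)"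
      using cyl_subset by (subst S, intro sigma_sets_UNION) auto
  qed
next
  fix S assume "S \<in> sigma_sets X (cyl ` nodes)"
  moreover have sub: "cyl ` nodes \<subseteq> sets \<mu>"
    using cyl_sets by blast
  ultimately show "S \<in> sets \<mu>"
    using sets.sigma_sets_subset[OF sub] unfolding space_mu by blast
qed

lemma mass_Nil[simp]: "mass [] = 1"
  using prob_space by simp

lemma mass_space[simp]: "measure \<mu> X = 1"
  using prob_space by simp

lemma kappa_mass_child: "i \<in> children w \<Longrightarrow> \<kappa> * mass w \<le> mass (w @ [i])"
  using kappa_mass by (simp add: children_def)

text \<open>The root has mass 1, and each further letter keeps at least the factor
  \<open>\<kappa>\<close>.\<close>

lemma mass_pos:
  assumes "w \<in> nodes"
  shows "0 < mass w"
proof -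
  have "0 < mass (prefix_of n \<omega>)" if "\<omega> \<in> X" for n \<omega>
  proof (induction n)
    case (Suc n)
    then show ?case
      using kappa_mass_child[OF children_prefix_of[OF that, of n]] kappa_pos
      by (simp add: prefix_of_Suc) (meson mult_pos_pos order_less_le_trans)
  qed simp
  then show ?thesis
    using node_extends[OF assms] by (metis in_cyl_iff)
qed

lemma cyl_children: "cyl w = (\<Union>i\<in>children w. cyl (w @ [i]))"
  using children_prefix_of by (auto simp: in_cyl_iff prefix_of_Suc) (metis)

lemma disjoint_children: "disjoint_family_on (\<lambda>i. cyl (w @ [i])) I"
  by (auto simp: disjoint_family_on_def in_cyl_iff prefix_of_Suc)

lemma mass_children: "(\<Sum>i\<in>children w. mass (w @ [i])) = mass w"
  by (subst (2) cyl_children)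
    (intro finite_measure_finite_Union[symmetric] disjoint_children, auto)

lemma mass_antimono: "mass (w @ v) \<le> mass w"
proof (intro finite_measure_mono subsetI)
  fix \<omega> assume "\<omega> \<in> cyl (w @ v)"
  then have "\<omega> \<in> X" "take (length w) (prefix_of (length (w @ v)) \<omega>) = w"
    by (auto simp: in_cyl_iff)
  then show "\<omega> \<in> cyl w"
    by (simp add: in_cyl_iff)
qed simp

lemma mass_child_le: "mass (w @ [i]) \<le> mass w"
  by (rule mass_antimono)

section \<open>Integrals and averages over cylinders\<close>

definition cyl_int :: "nat list \<Rightarrow> ((nat \<Rightarrow> nat) \<Rightarrow> complex) \<Rightarrow> complex" where
  "cyl_int w h = (\<integral>\<omega>. indicator (cyl w) \<omega> * h \<omega> \<partial>\<mu>)"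

definition av :: "nat list \<Rightarrow> ((nat \<Rightarrow> nat) \<Rightarrow> complex) \<Rightarrow> complex" where
  "av w h = cyl_int w h / of_real (mass w)"

lemma integrable_cyl[intro]:
  fixes h :: "(nat \<Rightarrow> nat) \<Rightarrow> complex"
  shows "integrable \<mu> h \<Longrightarrow> integrable \<mu> (\<lambda>\<omega>. indicator (cyl w) \<omega> * h \<omega>)"
  using integrable_mult_indicator[OF cyl_sets, of h w]
  by (simp add: scaleR_conv_of_real of_real_indicator)

lemma cyl_int_add:
  "integrable \<mu> f \<Longrightarrow> integrable \<mu> g \<Longrightarrow> cyl_int w (\<lambda>\<omega>. f \<omega> + g \<omega>) = cyl_int w f + cyl_int w g"
  using integrable_cyl[of f w] integrable_cyl[of g w] by (simp add: cyl_int_def distrib_left)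

lemma cyl_int_diff:
  "integrable \<mu> f \<Longrightarrow> integrable \<mu> g \<Longrightarrow> cyl_int w (\<lambda>\<omega>. f \<omega> - g \<omega>) = cyl_int w f - cyl_int w g"
  using integrable_cyl[of f w] integrable_cyl[of g w] by (simp add: cyl_int_def right_diff_distrib)

lemma cyl_int_scale: "cyl_int w (\<lambda>\<omega>. c * f \<omega>) = c * cyl_int w f"
  by (simp add: cyl_int_def mult.left_commute)

lemma cyl_int_sum:
  "(\<And>i. i \<in> I \<Longrightarrow> integrable \<mu> (f i)) \<Longrightarrow> cyl_int w (\<lambda>\<omega>. \<Sum>i\<in>I. f i \<omega>) = (\<Sum>i\<in>I. cyl_int w (f i))"
  using integrable_cyl[of "f _" w] by (simp add: cyl_int_def sum_distrib_left)

lemma cyl_int_cong: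
  "(\<And>\<omega>. \<omega> \<in> cyl w \<Longrightarrow> f \<omega> = g \<omega>) \<Longrightarrow> cyl_int w f = cyl_int w g"
  unfolding cyl_int_def by (intro Bochner_Integration.integral_cong) (auto simp: indicator_def)

lemma cyl_int_const: "cyl_int w (\<lambda>_. c) = c * of_real (mass w)"
proof -
  have "(\<integral>\<omega>. (indicator (cyl w) \<omega> :: complex) \<partial>\<mu>) = (\<integral>\<omega>. complex_of_real (indicator (cyl w) \<omega>) \<partial>\<mu>)"
    by (intro Bochner_Integration.integral_cong) (auto simp: indicator_def)
  also have "\<dots> = of_real (mass w)"
    by (subst integral_complex_of_real) (simp add: Int_absorb2 cyl_subset)
  finally show ?thesis
    by (simp add: cyl_int_def mult.commute)
qed

lemma cyl_int_children:
  assumes "integrable \<mu> h"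
  shows "cyl_int w h = (\<Sum>i\<in>children w. cyl_int (w @ [i]) h)"
proof -
  have "cyl_int w h = (\<integral>\<omega>. (\<Sum>i\<in>children w. indicator (cyl (w @ [i])) \<omega> * h \<omega>) \<partial>\<mu>)"
    unfolding cyl_int_def
  proof (intro Bochner_Integration.integral_cong refl)
    fix \<omega> assume "\<omega> \<in> space \<mu>"
    then show "indicator (cyl w) \<omega> * h \<omega> = (\<Sum>i\<in>children w. indicator (cyl (w @ [i])) \<omega> * h \<omega>)"
      using sum_children_indicator[of \<omega> "\<lambda>_. h \<omega>" w] by (simp only: mult.commute space_mu)
  qed
  also have "\<dots> = (\<Sum>i\<in>children w. cyl_int (w @ [i]) h)"
    unfolding cyl_int_def by (intro Bochner_Integration.integral_sum integrable_cyl assms)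
  finally show ?thesis .
qed

lemma av_add: "integrable \<mu> f \<Longrightarrow> integrable \<mu> g \<Longrightarrow> av w (\<lambda>\<omega>. f \<omega> + g \<omega>) = av w f + av w g"
  by (simp add: av_def cyl_int_add add_divide_distrib)

lemma av_diff: "integrable \<mu> f \<Longrightarrow> integrable \<mu> g \<Longrightarrow> av w (\<lambda>\<omega>. f \<omega> - g \<omega>) = av w f - av w g"
  by (simp add: av_def cyl_int_diff diff_divide_distrib)

lemma av_scale: "av w (\<lambda>\<omega>. c * f \<omega>) = c * av w f"
  by (simp add: av_def cyl_int_scale)

lemma av_sum: "(\<And>i. i \<in> I \<Longrightarrow> integrable \<mu> (f i)) \<Longrightarrow> av w (\<lambda>\<omega>. \<Sum>i\<in>I. f i \<omega>) = (\<Sum>i\<in>I. av w (f i))"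
  by (simp add: av_def cyl_int_sum sum_divide_distrib)

lemma av_cong: "(\<And>\<omega>. \<omega> \<in> cyl w \<Longrightarrow> f \<omega> = g \<omega>) \<Longrightarrow> av w f = av w g"
  using cyl_int_cong[of w f g] by (simp add: av_def)

lemma cyl_int_av: "w \<in> nodes \<Longrightarrow> cyl_int w h = of_real (mass w) * av w h"
  using mass_pos[of w] by (simp add: av_def)

lemma av_const:
  assumes "w \<in> nodes" "\<And>\<omega>. \<omega> \<in> cyl w \<Longrightarrow> f \<omega> = c"
  shows "av w f = c"
  using cyl_int_cong[of w f "\<lambda>_. c"] assms mass_pos[of w] by (simp add: av_def cyl_int_const)

lemma av_mult_const:
  assumes "\<And>\<omega>. \<omega> \<in> cyl w \<Longrightarrow> f \<omega> = c"
  shows "av w (\<lambda>\<omega>. f \<omega> * h \<omega>) = c * av w h"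
  using av_cong[of w "\<lambda>\<omega>. f \<omega> * h \<omega>" "\<lambda>\<omega>. c * h \<omega>"] assms by (simp add: av_scale)

text \<open>The martingale property of the averages, with the masses as weights.\<close>

lemma av_children:
  assumes "integrable \<mu> h" "w \<in> nodes"
  shows "of_real (mass w) * av w h = (\<Sum>i\<in>children w. of_real (mass (w @ [i])) * av (w @ [i]) h)"
  using cyl_int_children[OF assms(1), of w] cyl_int_av[OF assms(2)]
  by (simp add: cyl_int_av children_def)

lemma cmod_cyl_int_le:
  assumes "h \<in> L2 \<mu>"
  shows "cmod (cyl_int w h) \<le> sqrt (mass w) * L2_norm \<mu> h"
proof -
  have "cyl_int w h = L2_inner \<mu> h (indicator (cyl w))"
    unfolding cyl_int_def L2_inner_def
    by (intro Bochner_Integration.integral_cong) (auto simp: indicator_def)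
  then show ?thesis
    using L2_cauchy_schwarz[OF assms L2_indicator[OF cyl_sets], of w] L2_norm_indicator[OF cyl_sets]
    by (simp add: mult.commute)
qed

lemma cmod_av_le:
  assumes "h \<in> L2 \<mu>" "w \<in> nodes"
  shows "cmod (av w h) \<le> L2_norm \<mu> h / sqrt (mass w)"
proof -
  have "cmod (av w h) = cmod (cyl_int w h) / mass w"
    using mass_pos[OF assms(2)] by (simp add: av_def norm_divide)
  also have "\<dots> \<le> sqrt (mass w) * L2_norm \<mu> h / mass w"
    using cmod_cyl_int_le[OF assms(1)] by (simp add: divide_right_mono)
  also have "\<dots> = L2_norm \<mu> h / sqrt (mass w)"
    using mass_pos[OF assms(2)] by (simp add: field_simps)
  finally show ?thesis .
qed

section \<open>Locally constant functions and martingale differences\<close>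

text \<open>The value 0 off the space matches the normalisation in \<open>cont_alg\<close>, so these
  functions belong to the algebra.\<close>

definition cyl_fun :: "nat \<Rightarrow> ((nat \<Rightarrow> nat) \<Rightarrow> complex) \<Rightarrow> bool" where
  "cyl_fun n f \<longleftrightarrow> (\<forall>\<omega>. \<omega> \<notin> X \<longrightarrow> f \<omega> = 0) \<and>
     (\<forall>\<omega>\<in>X. \<forall>\<upsilon>\<in>X. prefix_of n \<omega> = prefix_of n \<upsilon> \<longrightarrow> f \<omega> = f \<upsilon>)"

text \<open>The value at a chosen sample point. It is used for functions constant on the cylinder,
  and to sample a continuous function.\<close>

definition value_on :: "nat list \<Rightarrow> ((nat \<Rightarrow> nat) \<Rightarrow> complex) \<Rightarrow> complex" where
  "value_on w f = f (SOME \<omega>. \<omega> \<in> cyl w)"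

lemma cyl_fun_value:
  assumes "cyl_fun n f" "\<omega> \<in> cyl w" "n \<le> length w"
  shows "f \<omega> = value_on w f"
proof -
  define \<upsilon> where "\<upsilon> = (SOME \<omega>. \<omega> \<in> cyl w)"
  have "\<upsilon> \<in> cyl w"
    unfolding \<upsilon>_def using assms(2) by (rule someI[of "\<lambda>\<omega>. \<omega> \<in> cyl w"])
  then have "take n (prefix_of (length w) \<omega>) = take n (prefix_of (length w) \<upsilon>)"
    and X: "\<omega> \<in> X" "\<upsilon> \<in> X"
    using assms(2) by (auto simp: in_cyl_iff)
  then have "prefix_of n \<omega> = prefix_of n \<upsilon>"
    using assms(3) by (simp add: min_def)
  then have "f \<omega> = f \<upsilon>"
    using assms(1) X unfolding cyl_fun_def by blast
  then show ?thesis
    by (simp add: value_on_def \<upsilon>_def)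
qed

lemma cyl_fun_expand:
  assumes "cyl_fun n f"
  shows "f = (\<lambda>\<omega>. \<Sum>w\<in>level n. value_on w f * indicator (cyl w) \<omega>)"
proof
  fix \<omega>
  show "f \<omega> = (\<Sum>w\<in>level n. value_on w f * indicator (cyl w) \<omega>)"
  proof (cases "\<omega> \<in> X")
    case True
    then show ?thesis
      using cyl_fun_value[OF assms in_cyl_prefix_of[OF True, of n]]
        sum_level[OF True, of "\<lambda>w. value_on w f"] by simp
  next
    case False
    then have "\<omega> \<notin> cyl w" for w
      using cyl_subset by blast
    then show ?thesis
      using assms False by (simp add: cyl_fun_def)
  qed
qed

lemma cyl_fun_measurable[measurable_dest]: "cyl_fun n f \<Longrightarrow> f \<in> borel_measurable \<mu>"
  by (subst cyl_fun_expand, assumption) measurable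

lemma cyl_fun_bounded:
  assumes "cyl_fun n f"
  obtains C where "0 \<le> C" "\<And>\<omega>. cmod (f \<omega>) \<le> C"
proof
  show "0 \<le> (\<Sum>w\<in>level n. cmod (value_on w f))"
    by (simp add: sum_nonneg)
  show "cmod (f \<omega>) \<le> (\<Sum>w\<in>level n. cmod (value_on w f))" for \<omega>
    by (subst cyl_fun_expand[OF assms], rule sum_norm_le) (auto simp: norm_mult indicator_def)
qed

lemma cyl_fun_L2: "cyl_fun n f \<Longrightarrow> f \<in> L2 \<mu>"
  by (metis L2_bounded(1) cyl_fun_bounded cyl_fun_measurable)

lemma cyl_fun_integrable: "cyl_fun n f \<Longrightarrow> integrable \<mu> f"
  by (intro L2_integrable cyl_fun_L2)

lemma cyl_fun_mono:
  assumes "cyl_fun m f" "m \<le> n"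
  shows "cyl_fun n f"
proof -
  have "prefix_of m \<omega> = prefix_of m \<upsilon>" if "prefix_of n \<omega> = prefix_of n \<upsilon>" for \<omega> \<upsilon>
    using that assms(2) by (auto simp: prefix_of_eq_iff)
  then show ?thesis
    using assms(1) unfolding cyl_fun_def by blast
qed

text \<open>\<open>F 0 0 = 0\<close> preserves the normalisation off the space.\<close>

lemma cyl_fun_combine:
  assumes "cyl_fun n f" "cyl_fun n g" "F 0 0 = 0"
  shows "cyl_fun n (\<lambda>\<omega>. F (f \<omega>) (g \<omega>))"
  unfolding cyl_fun_def
proof (intro conjI ballI allI impI)
  fix \<omega> \<upsilon> assume "\<omega> \<in> X" "\<upsilon> \<in> X" "prefix_of n \<omega> = prefix_of n \<upsilon>"
  then have "f \<omega> = f \<upsilon>" "g \<omega> = g \<upsilon>"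
    using assms(1,2) unfolding cyl_fun_def by blast+
  then show "F (f \<omega>) (g \<omega>) = F (f \<upsilon>) (g \<upsilon>)"
    by simp
qed (use assms in \<open>simp add: cyl_fun_def\<close>)

lemma cyl_fun_add: "cyl_fun n f \<Longrightarrow> cyl_fun n g \<Longrightarrow> cyl_fun n (\<lambda>\<omega>. f \<omega> + g \<omega>)"
  by (rule cyl_fun_combine) simp_all

lemma cyl_fun_diff: "cyl_fun n f \<Longrightarrow> cyl_fun n g \<Longrightarrow> cyl_fun n (\<lambda>\<omega>. f \<omega> - g \<omega>)"
  by (rule cyl_fun_combine) simp_all

lemma cyl_fun_mult: "cyl_fun n f \<Longrightarrow> cyl_fun n g \<Longrightarrow> cyl_fun n (\<lambda>\<omega>. f \<omega> * g \<omega>)"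
  by (rule cyl_fun_combine) simp_all

lemma cyl_fun_scale: "cyl_fun n f \<Longrightarrow> cyl_fun n (\<lambda>\<omega>. c * f \<omega>)"
  by (rule cyl_fun_combine[where F = "\<lambda>x y. c * x"]) simp_all

lemma cyl_fun_cnj: "cyl_fun n f \<Longrightarrow> cyl_fun n (\<lambda>\<omega>. cnj (f \<omega>))"
  by (rule cyl_fun_combine[where F = "\<lambda>x y. cnj x"]) simp_all

lemma cyl_fun_zero: "cyl_fun n (\<lambda>_. 0)"
  by (simp add: cyl_fun_def)

lemma cyl_fun_sum: "(\<And>i. i \<in> I \<Longrightarrow> cyl_fun n (f i)) \<Longrightarrow> cyl_fun n (\<lambda>\<omega>. \<Sum>i\<in>I. f i \<omega>)"
  by (induction I rule: infinite_finite_induct) (auto simp: cyl_fun_zero cyl_fun_add)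

lemma cyl_fun_prefix: "cyl_fun n (\<lambda>\<omega>. indicator X \<omega> * c (prefix_of n \<omega>))"
  by (simp add: cyl_fun_def)

lemma cyl_fun_indicator: "length w \<le> n \<Longrightarrow> cyl_fun n (indicator (cyl w))"
proof (rule cyl_fun_mono[of "length w"])
  show "cyl_fun (length w) (indicator (cyl w))"
    by (auto simp: cyl_fun_def indicator_def in_cyl_iff)
qed

lemma integral_cyl_fun:
  assumes "cyl_fun n f" "integrable \<mu> h"
  shows "(\<integral>\<omega>. f \<omega> * h \<omega> \<partial>\<mu>) = (\<Sum>w\<in>level n. value_on w f * cyl_int w h)"
proof -
  have "(\<integral>\<omega>. f \<omega> * h \<omega> \<partial>\<mu>)
      = (\<integral>\<omega>. (\<Sum>w\<in>level n. value_on w f * (indicator (cyl w) \<omega> * h \<omega>)) \<partial>\<mu>)"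
    by (subst cyl_fun_expand[OF assms(1)]) (simp only: sum_distrib_right mult.assoc)
  also have "\<dots> = (\<Sum>w\<in>level n. \<integral>\<omega>. value_on w f * (indicator (cyl w) \<omega> * h \<omega>) \<partial>\<mu>)"
    by (intro Bochner_Integration.integral_sum integrable_mult_right integrable_cyl assms(2))
  finally show ?thesis
    by (simp add: cyl_int_def)
qed

text \<open>
  \<open>E n\<close> is the conditional expectation on the first \<open>n\<close> letters and \<open>P y\<close> the orthogonal projection onto the
  span of the Haar functions at \<open>y\<close>. For the root \<open>[]\<close> it is the projection onto the functions of the
  first letter that are orthogonal to the constants.
\<close>

definition E :: "nat \<Rightarrow> ((nat \<Rightarrow> nat) \<Rightarrow> complex) \<Rightarrow> (nat \<Rightarrow> nat) \<Rightarrow> complex" where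
  "E n h \<omega> = indicator X \<omega> * av (prefix_of n \<omega>) h"

definition P :: "nat list \<Rightarrow> ((nat \<Rightarrow> nat) \<Rightarrow> complex) \<Rightarrow> (nat \<Rightarrow> nat) \<Rightarrow> complex" where
  "P y h \<omega> = indicator (cyl y) \<omega> * (av (prefix_of (Suc (length y)) \<omega>) h - av y h)"

lemma cyl_fun_E: "cyl_fun n (E n h)"
  unfolding E_def by (rule cyl_fun_prefix)

lemma P_eq_E: "P y h = (\<lambda>\<omega>. indicator (cyl y) \<omega> * (E (Suc (length y)) h \<omega> - E (length y) h \<omega>))"
  by (auto simp: P_def E_def fun_eq_iff indicator_def in_cyl_iff)

lemma cyl_fun_P: "length y < n \<Longrightarrow> cyl_fun n (P y h)"
  unfolding P_eq_E
  by (intro cyl_fun_mult cyl_fun_diff cyl_fun_indicator cyl_fun_mono[OF cyl_fun_E]) auto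

lemma P_L2: "P y h \<in> L2 \<mu>"
  using cyl_fun_L2[OF cyl_fun_P] by blast

lemma P_integrable: "integrable \<mu> (P y h)"
  using cyl_fun_integrable[OF cyl_fun_P] by blast

lemma E_L2: "E n h \<in> L2 \<mu>"
  using cyl_fun_L2[OF cyl_fun_E] .

lemma E_integrable: "integrable \<mu> (E n h)"
  using cyl_fun_integrable[OF cyl_fun_E] .

lemma av_E_below:
  assumes "w \<in> nodes" "n \<le> length w"
  shows "av w (E n h) = av (take n w) h"
proof (rule av_const[OF assms(1)])
  fix \<omega> assume "\<omega> \<in> cyl w"
  then have "\<omega> \<in> X" "take n w = take n (prefix_of (length w) \<omega>)"
    by (auto simp: in_cyl_iff)
  then show "E n h \<omega> = av (take n w) h"
    using assms(2) by (simp add: E_def min_def)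
qed

text \<open>The tower property, by descending induction on the length of \<open>w\<close> from
  \<open>n\<close>: an average is the weighted mean of the averages over the children.\<close>

lemma av_E_above:
  assumes "integrable \<mu> h" "w \<in> nodes" "length w \<le> n"
  shows "av w (E n h) = av w h"
proof -
  have "\<forall>w\<in>nodes. length w = k \<longrightarrow> av w (E n h) = av w h" if "k \<le> n" for k
    using that
  proof (induction k rule: inc_induct)
    case base
    then show ?case
      using av_E_below[of _ n h] by auto
  next
    case (step k)
    show ?case
    proof (intro ballI impI)
      fix w assume w: "w \<in> nodes" "length w = k"
      have "of_real (mass w) * av w (E n h)
          = (\<Sum>i\<in>children w. of_real (mass (w @ [i])) * av (w @ [i]) (E n h))"
        by (rule av_children[OF E_integrable w(1)])
      also have "\<dots> = (\<Sum>i\<in>children w. of_real (mass (w @ [i])) * av (w @ [i]) h)"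
        using step.IH w by (intro sum.cong) (auto simp: children_def)
      also have "\<dots> = of_real (mass w) * av w h"
        by (rule av_children[OF assms(1) w(1), symmetric])
      finally show "av w (E n h) = av w h"
        using mass_pos[OF w(1)] by simp
    qed
  qed
  then show ?thesis
    using assms(2,3) by blast
qed

text \<open>\<open>P y h\<close> lives on \<open>cyl y\<close>, is constant on the children of
  \<open>y\<close> and has mean 0 over \<open>y\<close>. So the average over a word not strictly
  below \<open>y\<close> vanishes, and a word strictly below \<open>y\<close> sees only the child of
  \<open>y\<close> that it passes through.\<close>

lemma av_P:
  assumes "integrable \<mu> h" "z \<in> nodes" "y \<in> nodes"
  shows "av z (P y h) = (if length y < length z \<and> take (length y) z = y
    then av (take (Suc (length y)) z) h - av y h else 0)"
proof (cases "length y < length z")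
  case True
  show ?thesis
  proof (cases "take (length y) z = y")
    case yes: True
    have "av z (P y h) = 1 * av z (\<lambda>\<omega>. E (Suc (length y)) h \<omega> - E (length y) h \<omega>)"
      unfolding P_eq_E
    proof (rule av_mult_const)
      fix \<omega> assume "\<omega> \<in> cyl z"
      then have "\<omega> \<in> X" "y = take (length y) (prefix_of (length z) \<omega>)"
        using yes by (auto simp: in_cyl_iff)
      then show "indicator (cyl y) \<omega> = (1 :: complex)"
        using True by (simp add: in_cyl_iff min_def)
    qed
    also have "\<dots> = av (take (Suc (length y)) z) h - av (take (length y) z) h"
      using True by (simp add: av_diff E_integrable av_E_below[OF assms(2)])
    finally show ?thesis
      using True yes by simp
  next
    case False
    have "av z (P y h) = 0"
    proof (rule av_const[OF assms(2)])
      fix \<omega> assume "\<omega> \<in> cyl z"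
      then have "prefix_of (length y) \<omega> = take (length y) z"
        using True by (metis in_cyl_iff less_imp_le_nat min.absorb1 take_prefix_of)
      then show "P y h \<omega> = 0"
        using False by (simp add: P_def in_cyl_iff)
    qed
    then show ?thesis
      using False by simp
  qed
next
  case False
  have y0: "cyl_int y (P y h) = 0"
  proof -
    have "cyl_int y (P y h) = cyl_int y (\<lambda>\<omega>. E (Suc (length y)) h \<omega> - E (length y) h \<omega>)"
      by (rule cyl_int_cong) (simp add: P_eq_E)
    then show ?thesis
      using assms by (simp add: cyl_int_diff E_integrable cyl_int_av av_E_above)
  qed
  have "cyl_int z (P y h) = 0"
  proof (cases "take (length z) y = z")
    case True
    have "(\<lambda>\<omega>. indicator (cyl z) \<omega> * P y h \<omega>) = (\<lambda>\<omega>. indicator (cyl y) \<omega> * P y h \<omega>)"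
    proof
      fix \<omega> show "indicator (cyl z) \<omega> * P y h \<omega> = indicator (cyl y) \<omega> * P y h \<omega>"
      proof (cases "\<omega> \<in> cyl y")
      case in_y: True
      then have "\<omega> \<in> X" "take (length z) (prefix_of (length y) \<omega>) = z"
        using True by (auto simp: in_cyl_iff)
      then have "\<omega> \<in> cyl z"
        using False by (simp add: in_cyl_iff min_def)
      then show ?thesis
        using in_y by simp
      qed (simp add: P_def)
    qed
    then show ?thesis
      using y0 by (simp only: cyl_int_def)
  next
    case no: False
    have "indicator (cyl z) \<omega> * P y h \<omega> = 0" for \<omega>
    proof (rule ccontr)
      assume *: "indicator (cyl z) \<omega> * P y h \<omega> \<noteq> 0"
      then have "\<omega> \<in> cyl z" "\<omega> \<in> cyl y"
        by (auto simp: P_def indicator_def split: if_splits)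
      then have "prefix_of (length z) \<omega> = z" "prefix_of (length y) \<omega> = y"
        by (auto simp: in_cyl_iff)
      then have "take (length z) y = z"
        using False by (metis linorder_not_less min.absorb1 take_prefix_of)
      then show False
        using no by simp
    qed
    then have "(\<lambda>\<omega>. indicator (cyl z) \<omega> * P y h \<omega>) = (\<lambda>_. 0)"
      by blast
    then show ?thesis
      by (simp only: cyl_int_def) simp
  qed
  then show ?thesis
    using False by (simp add: av_def)
qed

lemma av_Nil_P: "integrable \<mu> h \<Longrightarrow> y \<in> nodes \<Longrightarrow> av [] (P y h) = 0"
  by (simp add: av_P)

text \<open>The increments across the edges of the tree diagonalise all projections at once:
  \<open>P y\<close> keeps those that start at \<open>y\<close> and deletes the others.\<close>

lemma diff_P:
  assumes "integrable \<mu> h" "w @ [i] \<in> adm" "y \<in> nodes"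
  shows "av (w @ [i]) (P y h) - av w (P y h) = (if y = w then av (w @ [i]) h - av w h else 0)"
proof -
  have nodes: "w @ [i] \<in> nodes" "w \<in> nodes"
    using assms(2) butlast_node by auto
  consider "y = w" | "length y < length w" | "y \<noteq> w" "\<not> length y < length w"
    by blast
  then show ?thesis
  proof cases
    case 2
    then show ?thesis
      using assms nodes by (auto simp: av_P)
  next
    case 3
    then have "\<not> (length y < length (w @ [i]) \<and> take (length y) (w @ [i]) = y)"
      by (cases "length y = length w") auto
    then show ?thesis
      using 3 assms nodes by (simp only: av_P if_False) simp
  qed (use assms nodes in \<open>simp add: av_P\<close>)
qed

section \<open>Sums of projections along a path, and their symmetry\<close>

definition below :: "nat \<Rightarrow> nat list set" where
  "below n = {w \<in> nodes. length w < n}"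

lemma below_eq: "below n = (\<Union>m<n. level m)"
  by (auto simp: below_def level_def)

lemma finite_below[simp]: "finite (below n)"
  by (simp add: below_eq)

lemma sum_below:
  fixes g :: "nat list \<Rightarrow> complex"
  shows "(\<Sum>w\<in>below n. g w) = (\<Sum>m<n. \<Sum>w\<in>level m. g w)"
  unfolding below_eq by (intro sum.UNION_disjoint) (auto dest: level_length)

text \<open>At a given point only its prefixes contribute, one of each length, so a sum over the
  tree becomes a sum along a path.\<close>

lemma sum_below_P:
  assumes "\<omega> \<in> X"
  shows "(\<Sum>y\<in>below n. c y * P y h \<omega>)
    = (\<Sum>m<n. c (prefix_of m \<omega>) * (av (prefix_of (Suc m) \<omega>) h - av (prefix_of m \<omega>) h))"
  unfolding sum_below
proof (intro sum.cong refl)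
  fix m
  have "(\<Sum>y\<in>level m. c y * P y h \<omega>)
      = (\<Sum>y\<in>level m. (c y * (av (prefix_of (Suc m) \<omega>) h - av y h)) * indicator (cyl y) \<omega>)"
    by (intro sum.cong) (auto simp: P_def level_length)
  then show "(\<Sum>y\<in>level m. c y * P y h \<omega>)
      = c (prefix_of m \<omega>) * (av (prefix_of (Suc m) \<omega>) h - av (prefix_of m \<omega>) h)"
    using sum_level[OF assms, where 'a = complex] by simp
qed

lemma P_outside: "\<omega> \<notin> X \<Longrightarrow> P y h \<omega> = 0"
  using cyl_subset by (auto simp: P_def indicator_def)

lemma sum_P_below: "(\<Sum>y\<in>below n. P y h \<omega>) = E n h \<omega> - E 0 h \<omega>"
proof (cases "\<omega> \<in> X")
  case True
  show ?thesis
    using sum_below_P[OF True, where n = n and c = "\<lambda>_. 1" and h = h] True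
      sum_lessThan_telescope[where f = "\<lambda>m. av (prefix_of m \<omega>) h" and m = n]
    by (simp add: E_def)
qed (simp add: P_outside E_def)

lemma P_expand:
  assumes "\<omega> \<in> X"
  shows "P y h \<omega> = (\<Sum>i\<in>children y. (av (y @ [i]) h - av y h) * indicator (cyl (y @ [i])) \<omega>)"
  using assms by (subst sum_children_indicator) (auto simp: P_def indicator_def in_cyl_iff prefix_of_Suc)

text \<open>The right-hand side is symmetric in \<open>h\<close> and \<open>g\<close>. This yields
  the self-adjointness of \<open>P y\<close> without a basis.\<close>

lemma P_pairing:
  assumes "integrable \<mu> h" "integrable \<mu> g" "y \<in> nodes"
  shows "(\<integral>\<omega>. P y h \<omega> * g \<omega> \<partial>\<mu>) = (\<Sum>i\<in>children y. of_real (mass (y @ [i])) * av (y @ [i]) h * av (y @ [i]) g)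
    - of_real (mass y) * av y h * av y g"
proof -
  have "(\<integral>\<omega>. P y h \<omega> * g \<omega> \<partial>\<mu>)
      = (\<integral>\<omega>. (\<Sum>i\<in>children y. (av (y @ [i]) h - av y h) * (indicator (cyl (y @ [i])) \<omega> * g \<omega>)) \<partial>\<mu>)"
    by (intro Bochner_Integration.integral_cong)
      (auto simp: P_expand sum_distrib_right mult.assoc simp del: sum_mult_indicator)
  also have "\<dots> = (\<Sum>i\<in>children y. (av (y @ [i]) h - av y h) * cyl_int (y @ [i]) g)"
    unfolding cyl_int_def
    by (subst Bochner_Integration.integral_sum)
      (auto intro!: integrable_mult_right integrable_cyl assms)
  also have "\<dots> = (\<Sum>i\<in>children y. of_real (mass (y @ [i])) * av (y @ [i]) h * av (y @ [i]) g
      - av y h * (of_real (mass (y @ [i])) * av (y @ [i]) g))"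
    by (intro sum.cong) (auto simp: cyl_int_av children_def algebra_simps)
  also have "\<dots> = (\<Sum>i\<in>children y. of_real (mass (y @ [i])) * av (y @ [i]) h * av (y @ [i]) g)
      - av y h * (of_real (mass y) * av y g)"
    by (simp add: sum_subtractf av_children[OF assms(2,3)] sum_distrib_left)
  finally show ?thesis
    by (simp add: algebra_simps)
qed

lemma P_symmetric:
  assumes "integrable \<mu> h" "integrable \<mu> g" "y \<in> nodes"
  shows "(\<integral>\<omega>. P y h \<omega> * g \<omega> \<partial>\<mu>) = (\<integral>\<omega>. h \<omega> * P y g \<omega> \<partial>\<mu>)"
proof -
  have "(\<integral>\<omega>. h \<omega> * P y g \<omega> \<partial>\<mu>) = (\<integral>\<omega>. P y g \<omega> * h \<omega> \<partial>\<mu>)"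
    by (simp add: mult.commute)
  then show ?thesis
    using P_pairing[OF assms] P_pairing[OF assms(2,1,3)] by (simp add: mult.commute mult.left_commute)
qed

lemma av_cnj: "av w (\<lambda>\<omega>. cnj (h \<omega>)) = cnj (av w h)"
proof -
  have "cnj (\<integral>\<omega>. indicator (cyl w) \<omega> * h \<omega> \<partial>\<mu>) = (\<integral>\<omega>. cnj (indicator (cyl w) \<omega> * h \<omega>) \<partial>\<mu>)"
    by (rule Bochner_Integration.integral_cnj[symmetric])
  also have "\<dots> = (\<integral>\<omega>. indicator (cyl w) \<omega> * cnj (h \<omega>) \<partial>\<mu>)"
    by (intro Bochner_Integration.integral_cong) (auto simp: indicator_def)
  finally show ?thesis
    by (simp add: av_def cyl_int_def)
qed

lemma P_cnj: "P y (\<lambda>\<omega>. cnj (h \<omega>)) \<omega> = cnj (P y h \<omega>)"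
  by (simp add: P_def av_cnj indicator_def)

lemma P_inner:
  assumes "h \<in> L2 \<mu>" "g \<in> L2 \<mu>" "y \<in> nodes"
  shows "L2_inner \<mu> (P y h) g = L2_inner \<mu> h (P y g)"
  unfolding L2_inner_def
  using P_symmetric[OF L2_integrable[OF assms(1)] L2_integrable[OF L2_cnj[OF assms(2)]] assms(3)]
  by (simp add: P_cnj)

section \<open>Density of locally constant functions\<close>

text \<open>Density is first shown in the mean, where induction over integrable functions is
  available, and is carried over to mean square afterwards.\<close>

definition approximable :: "((nat \<Rightarrow> nat) \<Rightarrow> complex) \<Rightarrow> bool" where
  "approximable f \<longleftrightarrow> integrable \<mu> f \<and>
     (\<forall>e>0. \<exists>n g. cyl_fun n g \<and> (\<integral>\<omega>. cmod (f \<omega> - g \<omega>) \<partial>\<mu>) < e)"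

lemma L1_triangle:
  fixes f g h :: "(nat \<Rightarrow> nat) \<Rightarrow> complex"
  assumes "integrable \<mu> f" "integrable \<mu> g" "integrable \<mu> h"
  shows "(\<integral>\<omega>. cmod (f \<omega> - h \<omega>) \<partial>\<mu>) \<le> (\<integral>\<omega>. cmod (f \<omega> - g \<omega>) \<partial>\<mu>) + (\<integral>\<omega>. cmod (g \<omega> - h \<omega>) \<partial>\<mu>)"
proof -
  have "(\<integral>\<omega>. cmod (f \<omega> - h \<omega>) \<partial>\<mu>) \<le> (\<integral>\<omega>. cmod (f \<omega> - g \<omega>) + cmod (g \<omega> - h \<omega>) \<partial>\<mu>)"
    using assms by (intro integral_mono) (auto intro: norm_diff_triangle_ineq norm_diff_triangle_le)
  then show ?thesis
    using assms by simp
qed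

lemma approximable_cyl_fun: "cyl_fun n f \<Longrightarrow> approximable f"
  unfolding approximable_def using cyl_fun_integrable by fastforce

lemma approximable_add:
  assumes "approximable f" "approximable g"
  shows "approximable (\<lambda>\<omega>. f \<omega> + g \<omega>)"
  unfolding approximable_def
proof (intro conjI allI impI)
  have int: "integrable \<mu> f" "integrable \<mu> g"
    using assms by (auto simp: approximable_def)
  then show "integrable \<mu> (\<lambda>\<omega>. f \<omega> + g \<omega>)"
    by simp
  fix e :: real assume "e > 0"
  obtain m f' where f': "cyl_fun m f'" "(\<integral>\<omega>. cmod (f \<omega> - f' \<omega>) \<partial>\<mu>) < e / 2"
    using assms(1) \<open>e > 0\<close> by (auto simp: approximable_def dest: spec[of _ "e / 2"])
  obtain n g' where g': "cyl_fun n g'" "(\<integral>\<omega>. cmod (g \<omega> - g' \<omega>) \<partial>\<mu>) < e / 2"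
    using assms(2) \<open>e > 0\<close> by (auto simp: approximable_def dest: spec[of _ "e / 2"])
  have int': "integrable \<mu> f'" "integrable \<mu> g'"
    using f'(1) g'(1) by (auto intro: cyl_fun_integrable)
  have "(\<integral>\<omega>. cmod (f \<omega> + g \<omega> - (f' \<omega> + g' \<omega>)) \<partial>\<mu>)
      \<le> (\<integral>\<omega>. cmod (f \<omega> - f' \<omega>) + cmod (g \<omega> - g' \<omega>) \<partial>\<mu>)"
    using int int' by (intro integral_mono) (auto simp: norm_diff_triangle_ineq)
  also have "\<dots> = (\<integral>\<omega>. cmod (f \<omega> - f' \<omega>) \<partial>\<mu>) + (\<integral>\<omega>. cmod (g \<omega> - g' \<omega>) \<partial>\<mu>)"
    using int int' by (intro Bochner_Integration.integral_add) auto
  also have "\<dots> < e"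
    using f'(2) g'(2) by linarith
  finally have "(\<integral>\<omega>. cmod (f \<omega> + g \<omega> - (f' \<omega> + g' \<omega>)) \<partial>\<mu>) < e" .
  moreover have "cyl_fun (max m n) (\<lambda>\<omega>. f' \<omega> + g' \<omega>)"
    using f'(1) g'(1) by (intro cyl_fun_add) (auto intro: cyl_fun_mono)
  ultimately show "\<exists>n k. cyl_fun n k \<and> (\<integral>\<omega>. cmod (f \<omega> + g \<omega> - k \<omega>) \<partial>\<mu>) < e"
    by (intro exI conjI) auto
qed

lemma approximable_scale:
  assumes "approximable f"
  shows "approximable (\<lambda>\<omega>. c * f \<omega>)"
proof (cases "c = 0")
  case True
  then show ?thesis
    using approximable_cyl_fun[OF cyl_fun_zero] by simp
next
  case False
  show ?thesis
    unfolding approximable_def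
  proof (intro conjI allI impI)
    show "integrable \<mu> (\<lambda>\<omega>. c * f \<omega>)"
      using assms by (simp add: approximable_def)
    fix e :: real assume "e > 0"
    then have "e / cmod c > 0"
      using False by simp
    then obtain m f' where f': "cyl_fun m f'" "(\<integral>\<omega>. cmod (f \<omega> - f' \<omega>) \<partial>\<mu>) < e / cmod c"
      using assms unfolding approximable_def by blast
    have "(\<integral>\<omega>. cmod (c * f \<omega> - c * f' \<omega>) \<partial>\<mu>) = cmod c * (\<integral>\<omega>. cmod (f \<omega> - f' \<omega>) \<partial>\<mu>)"
      by (simp add: norm_mult flip: right_diff_distrib)
    also have "\<dots> < e"
      using f'(2) False by (simp add: field_simps)
    finally show "\<exists>n g. cyl_fun n g \<and> (\<integral>\<omega>. cmod (c * f \<omega> - g \<omega>) \<partial>\<mu>) < e"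
      using cyl_fun_scale[OF f'(1)] by blast
  qed
qed

lemma approximable_lim:
  assumes "\<And>i. approximable (s i)" "integrable \<mu> f"
    and "\<And>\<omega>. \<omega> \<in> X \<Longrightarrow> (\<lambda>i. s i \<omega>) \<longlonglongrightarrow> f \<omega>"
    and "\<And>i \<omega>. \<omega> \<in> X \<Longrightarrow> cmod (s i \<omega>) \<le> w \<omega>" "integrable \<mu> w"
  shows "approximable f"
  unfolding approximable_def
proof (intro conjI allI impI)
  show "integrable \<mu> f" by fact
  fix e :: real assume "e > 0"
  have int: "integrable \<mu> (s i)" for i
    using assms(1) by (simp add: approximable_def)
  have "(\<lambda>i. \<integral>\<omega>. cmod (f \<omega> - s i \<omega>) \<partial>\<mu>) \<longlonglongrightarrow> (\<integral>\<omega>. 0 \<partial>\<mu>)"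
  proof (rule integral_dominated_convergence[where w = "\<lambda>\<omega>. cmod (f \<omega>) + w \<omega>"])
    show "AE \<omega> in \<mu>. (\<lambda>i. cmod (f \<omega> - s i \<omega>)) \<longlonglongrightarrow> 0"
      using assms(3) by (auto intro!: AE_I2 tendsto_eq_intros)
    show "AE \<omega> in \<mu>. norm (cmod (f \<omega> - s i \<omega>)) \<le> cmod (f \<omega>) + w \<omega>" for i
      using assms(4) by (auto intro!: AE_I2 order_trans[OF norm_triangle_ineq4])
  qed (use assms int in auto)
  then obtain i where i: "(\<integral>\<omega>. cmod (f \<omega> - s i \<omega>) \<partial>\<mu>) < e / 2"
    using \<open>e > 0\<close> order_tendstoD(2)[of _ 0 sequentially "e / 2"]
    by (auto simp: eventually_sequentially)
  obtain n g where g: "cyl_fun n g" "(\<integral>\<omega>. cmod (s i \<omega> - g \<omega>) \<partial>\<mu>) < e / 2"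
    using assms(1)[of i] \<open>e > 0\<close> by (auto simp: approximable_def dest: spec[of _ "e / 2"])
  then show "\<exists>n g. cyl_fun n g \<and> (\<integral>\<omega>. cmod (f \<omega> - g \<omega>) \<partial>\<mu>) < e"
    using L1_triangle[OF assms(2) int[of i] cyl_fun_integrable[OF g(1)]] i by force
qed

text \<open>Dynkin's argument: the sets with approximable indicator are closed under complements and
  countable disjoint unions, and they contain an intersection-stable generator.\<close>

lemma approximable_indicator:
  assumes "S \<in> sets \<mu>"
  shows "approximable (indicator S)"
proof -
  \<comment> \<open>Two cylinders are nested or disjoint; the empty set is added for the second
    case.\<close>
  have "Int_stable (insert {} (cyl ` nodes))"
  proof (rule Int_stableI)
    fix a b assume "a \<in> insert {} (cyl ` nodes)" "b \<in> insert {} (cyl ` nodes)"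
    then consider "a \<inter> b = {}" | w v where "a = cyl w" "b = cyl v" "w \<in> nodes" "v \<in> nodes" "a \<inter> b \<noteq> {}"
      by blast
    then show "a \<inter> b \<in> insert {} (cyl ` nodes)"
    proof cases
      case 2
      then obtain \<omega> where \<omega>: "\<omega> \<in> X" "prefix_of (length w) \<omega> = w" "prefix_of (length v) \<omega> = v"
        by (auto simp: in_cyl_iff)
      have "cyl (prefix_of m \<omega>) \<inter> cyl (prefix_of n \<omega>) = cyl (prefix_of (max m n) \<omega>)" for m n
        by (auto simp: in_cyl_iff prefix_of_eq_iff less_max_iff_disj)
      from this[of "length w" "length v"] have "a \<inter> b = cyl (prefix_of (max (length w) (length v)) \<omega>)"
        using 2 \<omega> by simp
      then show ?thesis
        using prefix_of_nodes[OF \<omega>(1)] by blast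
    qed simp
  qed
  moreover have "insert {} (cyl ` nodes) \<subseteq> Pow X"
    using cyl_subset by auto
  moreover have "S \<in> sigma_sets X (insert {} (cyl ` nodes))"
    using assms sigma_sets_mono'[of "cyl ` nodes" "insert {} (cyl ` nodes)" X]
    by (auto simp: sets_mu_cyl)
  ultimately show ?thesis
  proof (induction rule: sigma_sets_induct_disjoint)
    case (basic S)
    then consider "S = {}" | w where "S = cyl w" by blast
    then show ?case
      using approximable_cyl_fun[OF cyl_fun_zero] approximable_cyl_fun[OF cyl_fun_indicator[OF order_refl]]
      by cases simp_all
  next
    case empty
    then show ?case
      using approximable_cyl_fun[OF cyl_fun_zero] by simp
  next
    case (compl S)
    have "approximable (indicator (cyl []))"
      by (rule approximable_cyl_fun[OF cyl_fun_indicator[OF order_refl]])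
    then have *: "approximable (\<lambda>\<omega>. indicator X \<omega> + (-1) * indicator S \<omega>)"
      unfolding cyl_Nil by (rule approximable_add[OF _ approximable_scale[OF compl(2)]])
    have "S \<subseteq> X"
      using compl(1) sigma_sets_into_sp[of "insert {} (cyl ` nodes)" X S] cyl_subset by auto
    then have "(\<lambda>\<omega>. indicator X \<omega> + (-1) * indicator S \<omega>) = (indicator (X - S) :: _ \<Rightarrow> complex)"
      by (auto simp: fun_eq_iff indicator_def)
    then show ?case
      using * by simp
  next
    case (union S)
    have sets: "S i \<in> sets \<mu>" for i
    proof -
      have "insert {} (cyl ` nodes) \<subseteq> sets \<mu>"
        using cyl_sets by blast
      from sets.sigma_sets_subset[OF this] show ?thesis
        using union(2) by (auto simp del: cyl_Nil)
    qed
    show ?case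
    proof (rule approximable_lim[where w = "\<lambda>_. 1"])
      have sum: "(\<lambda>\<omega>. \<Sum>j<i. indicator (S j) \<omega>) = (indicator (\<Union>j<i. S j) :: _ \<Rightarrow> complex)" for i
        using disjoint_family_on_mono[OF subset_UNIV union(1)]
        by (intro ext) (subst indicator_UN_disjoint, auto)
      have "approximable (\<lambda>\<omega>. \<Sum>j<i. indicator (S j) \<omega>)" for i
        by (induction i)
          (simp_all only: sum.lessThan_Suc lessThan_0 sum.empty approximable_add union(3)
            approximable_cyl_fun[OF cyl_fun_zero])
      then show "approximable (indicator (\<Union>j<i. S j))" for i
        by (simp only: sum)
      show "(\<lambda>i. indicator (\<Union>j<i. S j) \<omega>) \<longlonglongrightarrow> (indicator (\<Union>j. S j) \<omega> :: complex)" for \<omega>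
        using LIMSEQ_indicator_UN[of S \<omega>] by simp
      show "integrable \<mu> (indicator (\<Union>j. S j) :: _ \<Rightarrow> complex)"
        using sets by (intro L2_integrable L2_indicator) auto
    qed (auto simp: indicator_def)
  qed
qed

lemma approximable_integrable:
  assumes "integrable \<mu> f"
  shows "approximable f"
  using assms
proof (induction rule: integrable_induct)
  case (base S c)
  have eq: "(\<lambda>x. indicator S x *\<^sub>R c) = (\<lambda>x. c * indicator S x)"
    by (auto simp: fun_eq_iff indicator_def)
  show ?case
    unfolding eq by (rule approximable_scale[OF approximable_indicator[OF base(1)]])
next
  case (lim f s)
  show ?case
  proof (rule approximable_lim[where s = s and w = "\<lambda>\<omega>. 2 * cmod (f \<omega>)"])
    show "integrable \<mu> (\<lambda>\<omega>. 2 * cmod (f \<omega>))"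
      by (intro integrable_mult_right integrable_norm \<open>integrable \<mu> f\<close>)
  qed (use lim in \<open>simp_all only: space_mu\<close>)
qed (rule approximable_add)

section \<open>Convergence of the conditional expectations\<close>

lemma E_cyl_fun:
  assumes "cyl_fun n g"
  shows "E n g = g"
proof
  fix \<omega>
  show "E n g \<omega> = g \<omega>"
  proof (cases "\<omega> \<in> X")
    case True
    have "av (prefix_of n \<omega>) g = g \<omega>"
      using cyl_fun_value[OF assms, of _ "prefix_of n \<omega>"] in_cyl_prefix_of[OF True, of n]
      by (intro av_const prefix_of_nodes[OF True]) auto
    then show ?thesis
      using True by (simp add: E_def)
  next
    case False
    then show ?thesis
      using assms by (simp add: E_def cyl_fun_def)
  qed
qed

lemma E_diff: "integrable \<mu> f \<Longrightarrow> integrable \<mu> g \<Longrightarrow> E n (\<lambda>\<omega>. f \<omega> - g \<omega>) \<omega> = E n f \<omega> - E n g \<omega>"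
  by (simp add: E_def av_diff right_diff_distrib)

lemma cmod_cyl_int_le_integral:
  assumes "integrable \<mu> f"
  shows "cmod (cyl_int w f) \<le> (\<integral>\<omega>. indicator (cyl w) \<omega> * cmod (f \<omega>) \<partial>\<mu>)"
proof -
  have "cmod (cyl_int w f) \<le> (\<integral>\<omega>. cmod (indicator (cyl w) \<omega> * f \<omega>) \<partial>\<mu>)"
    unfolding cyl_int_def by simp
  also have "\<dots> = (\<integral>\<omega>. indicator (cyl w) \<omega> * cmod (f \<omega>) \<partial>\<mu>)"
    by (intro Bochner_Integration.integral_cong) (auto simp: indicator_def)
  finally show ?thesis .
qed

lemma E_L1_contraction:
  assumes "integrable \<mu> f"
  shows "(\<integral>\<omega>. cmod (E n f \<omega>) \<partial>\<mu>) \<le> (\<integral>\<omega>. cmod (f \<omega>) \<partial>\<mu>)"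
proof -
  have int: "integrable \<mu> (\<lambda>\<omega>. indicator (cyl w) \<omega> * cmod (f \<omega>))" for w
    using integrable_mult_indicator[OF cyl_sets integrable_norm[OF assms], of w] by simp
  have "(\<integral>\<omega>. cmod (E n f \<omega>) \<partial>\<mu>)
      = (\<integral>\<omega>. (\<Sum>w\<in>level n. cmod (av w f) * indicator (cyl w) \<omega>) \<partial>\<mu>)"
    by (intro Bochner_Integration.integral_cong refl, subst sum_level) (auto simp: E_def)
  also have "\<dots> = (\<Sum>w\<in>level n. \<integral>\<omega>. cmod (av w f) * indicator (cyl w) \<omega> \<partial>\<mu>)"
    by (intro Bochner_Integration.integral_sum integrable_mult_right integrable_real_indicator)
      (auto simp: emeasure_eq_measure)
  also have "\<dots> = (\<Sum>w\<in>level n. cmod (av w f) * mass w)"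
    by (intro sum.cong refl) (simp add: Int_absorb2 cyl_subset)
  also have "\<dots> = (\<Sum>w\<in>level n. cmod (cyl_int w f))"
    by (intro sum.cong refl, subst cyl_int_av[OF level_node]) (simp_all add: norm_mult)
  also have "\<dots> \<le> (\<Sum>w\<in>level n. \<integral>\<omega>. indicator (cyl w) \<omega> * cmod (f \<omega>) \<partial>\<mu>)"
    by (intro sum_mono cmod_cyl_int_le_integral assms)
  also have "\<dots> = (\<integral>\<omega>. (\<Sum>w\<in>level n. indicator (cyl w) \<omega> * cmod (f \<omega>)) \<partial>\<mu>)"
    by (intro Bochner_Integration.integral_sum[symmetric] int)
  also have "\<dots> = (\<integral>\<omega>. cmod (f \<omega>) \<partial>\<mu>)"
  proof (intro Bochner_Integration.integral_cong refl)
    fix \<omega> assume "\<omega> \<in> space \<mu>"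
    then show "(\<Sum>w\<in>level n. indicator (cyl w) \<omega> * cmod (f \<omega>)) = cmod (f \<omega>)"
      using sum_level[of \<omega> "\<lambda>_. cmod (f \<omega>)" n] by (simp only: mult.commute space_mu)
  qed
  finally show ?thesis .
qed

text \<open>\<open>E n\<close> fixes an approximating function of \<open>m\<close> letters as soon
  as \<open>m \<le> n\<close> and does not increase the distance to it, since it is a contraction in
  the mean.\<close>

lemma E_tendsto_L1:
  assumes "integrable \<mu> f"
  shows "(\<lambda>n. \<integral>\<omega>. cmod (f \<omega> - E n f \<omega>) \<partial>\<mu>) \<longlonglongrightarrow> 0"
proof (rule LIMSEQ_I)
  fix e :: real assume "e > 0"
  then obtain m g where g: "cyl_fun m g" "(\<integral>\<omega>. cmod (f \<omega> - g \<omega>) \<partial>\<mu>) < e / 2"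
    using approximable_integrable[OF assms] by (auto simp: approximable_def dest: spec[of _ "e / 2"])
  have int: "integrable \<mu> g"
    by (rule cyl_fun_integrable[OF g(1)])
  have "(\<integral>\<omega>. cmod (f \<omega> - E n f \<omega>) \<partial>\<mu>) < e" if "m \<le> n" for n
  proof -
    have "(\<integral>\<omega>. cmod (g \<omega> - E n f \<omega>) \<partial>\<mu>) = (\<integral>\<omega>. cmod (E n (\<lambda>\<omega>. g \<omega> - f \<omega>) \<omega>) \<partial>\<mu>)"
      by (simp add: E_diff int assms E_cyl_fun[OF cyl_fun_mono[OF g(1) that]])
    also have "\<dots> \<le> (\<integral>\<omega>. cmod (g \<omega> - f \<omega>) \<partial>\<mu>)"
      by (intro E_L1_contraction Bochner_Integration.integrable_diff int assms)
    also have "\<dots> < e / 2"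
      using g(2) by (simp add: norm_minus_commute)
    finally show ?thesis
      using L1_triangle[OF assms int E_integrable, of n f] g(2) by linarith
  qed
  then show "\<exists>no. \<forall>n\<ge>no. norm ((\<integral>\<omega>. cmod (f \<omega> - E n f \<omega>) \<partial>\<mu>) - 0) < e"
    by (intro exI[of _ m]) auto
qed

text \<open>This turns identities between averages into identities almost everywhere, and thereby
  makes the description of operators by averages faithful.\<close>

lemma av_zero_AE:
  assumes "integrable \<mu> f" "\<And>w. w \<in> nodes \<Longrightarrow> av w f = 0"
  shows "AE \<omega> in \<mu>. f \<omega> = 0"
proof -
  have "E n f \<omega> = 0" for n \<omega>
    using assms(2) prefix_of_nodes by (auto simp: E_def indicator_def)
  then have "(\<lambda>n :: nat. \<integral>\<omega>. cmod (f \<omega>) \<partial>\<mu>) \<longlonglongrightarrow> 0"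
    using E_tendsto_L1[OF assms(1)] by simp
  then have "(\<integral>\<omega>. cmod (f \<omega>) \<partial>\<mu>) = 0"
    by (simp add: LIMSEQ_const_iff)
  then show ?thesis
    using integral_nonneg_eq_0_iff_AE[OF integrable_norm[OF assms(1)]] by simp
qed

lemma av_eq_AE:
  assumes "integrable \<mu> f" "integrable \<mu> g" "\<And>w. w \<in> nodes \<Longrightarrow> av w f = av w g"
  shows "AE \<omega> in \<mu>. f \<omega> = g \<omega>"
  using av_zero_AE[of "\<lambda>\<omega>. f \<omega> - g \<omega>"] assms by (simp add: av_diff)

lemma av_cong_AE:
  assumes "f \<in> borel_measurable \<mu>" "g \<in> borel_measurable \<mu>" "AE \<omega> in \<mu>. f \<omega> = g \<omega>"
  shows "av w f = av w g"
  unfolding av_def cyl_int_def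
  by (intro arg_cong2[where f = "(/)"] integral_cong_AE refl)
    (use assms in \<open>auto intro!: borel_measurable_times\<close>)

lemma integral_cyl_fun_zero:
  assumes "integrable \<mu> f" "cyl_fun n g" "\<And>w. w \<in> level n \<Longrightarrow> av w f = 0"
  shows "(\<integral>\<omega>. g \<omega> * f \<omega> \<partial>\<mu>) = 0"
  unfolding integral_cyl_fun[OF assms(2,1)]
  by (intro sum.neutral ballI, subst cyl_int_av[OF level_node]) (simp_all add: assms(3))

lemma L2_inner_cyl_fun_zero:
  assumes "f \<in> L2 \<mu>" "cyl_fun n g" "\<And>w. w \<in> level n \<Longrightarrow> av w f = 0"
  shows "L2_inner \<mu> f g = 0"
  using integral_cyl_fun_zero[OF L2_integrable[OF assms(1)] cyl_fun_cnj[OF assms(2)] assms(3)]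
  by (simp add: L2_inner_def mult.commute)

lemma cmod_av_le_bound:
  assumes "integrable \<mu> g" "\<And>\<omega>. \<omega> \<in> X \<Longrightarrow> cmod (g \<omega>) \<le> M" "w \<in> nodes"
  shows "cmod (av w g) \<le> M"
proof -
  have "cmod (cyl_int w g) \<le> (\<integral>\<omega>. indicator (cyl w) \<omega> * cmod (g \<omega>) \<partial>\<mu>)"
    by (rule cmod_cyl_int_le_integral[OF assms(1)])
  also have "\<dots> \<le> (\<integral>\<omega>. indicator (cyl w) \<omega> * M \<partial>\<mu>)"
  proof (rule integral_mono)
    show "integrable \<mu> (\<lambda>\<omega>. indicator (cyl w) \<omega> * cmod (g \<omega>))"
      using integrable_mult_indicator[OF cyl_sets integrable_norm[OF assms(1)], of w] by simp
    show "integrable \<mu> (\<lambda>\<omega>. indicator (cyl w) \<omega> * M)"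
      by (intro integrable_mult_left integrable_real_indicator) (auto simp: emeasure_eq_measure)
  qed (use assms(2) in \<open>auto simp: indicator_def\<close>)
  also have "\<dots> = mass w * M"
    by (simp add: Int_absorb2 cyl_subset)
  finally show ?thesis
    using mass_pos[OF assms(3)] by (simp add: av_def norm_divide field_simps)
qed

text \<open>Prepares the passage from convergence in the mean to convergence in mean square, which
  is immediate for bounded functions only.\<close>

lemma truncation_L2:
  assumes "f \<in> L2 \<mu>" "e > 0"
  obtains M :: nat and g where "g \<in> L2 \<mu>" "L2_norm \<mu> (\<lambda>\<omega>. f \<omega> - g \<omega>) < e"
    "\<And>\<omega>. cmod (g \<omega>) \<le> M"
proof -
  define g where "g M \<omega> = (if cmod (f \<omega>) \<le> real M then f \<omega> else 0)" for M \<omega>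
  have [measurable]: "f \<in> borel_measurable \<mu>" "g M \<in> borel_measurable \<mu>" for M
    using assms(1) unfolding g_def by measurable
  have "(\<lambda>M. \<integral>\<omega>. (cmod (f \<omega> - g M \<omega>))\<^sup>2 \<partial>\<mu>) \<longlonglongrightarrow> (\<integral>\<omega>. 0 \<partial>\<mu>)"
  proof (rule integral_dominated_convergence[where w = "\<lambda>\<omega>. (cmod (f \<omega>))\<^sup>2"])
    have "(\<lambda>M. (cmod (f \<omega> - g M \<omega>))\<^sup>2) \<longlonglongrightarrow> 0" for \<omega>
    proof (rule tendsto_eventually)
      obtain M0 :: nat where "cmod (f \<omega>) \<le> M0"
        using real_arch_simple by blast
      then show "\<forall>\<^sub>F M in sequentially. (cmod (f \<omega> - g M \<omega>))\<^sup>2 = 0"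
        unfolding eventually_sequentially g_def by (intro exI[of _ M0]) auto
    qed
    then show "AE \<omega> in \<mu>. (\<lambda>M. (cmod (f \<omega> - g M \<omega>))\<^sup>2) \<longlonglongrightarrow> 0"
      by simp
  qed (use assms in \<open>auto simp: L2_square_integrable g_def\<close>)
  then have "(\<lambda>M. \<integral>\<omega>. (cmod (f \<omega> - g M \<omega>))\<^sup>2 \<partial>\<mu>) \<longlonglongrightarrow> 0"
    by simp
  from order_tendstoD(2)[OF this, of "e\<^sup>2"] assms(2)
  obtain M where M: "(L2_norm \<mu> (\<lambda>\<omega>. f \<omega> - g M \<omega>))\<^sup>2 < e\<^sup>2"
    by (auto simp: eventually_sequentially L2_norm_square)
  show ?thesis
  proof (rule that[of "g M" M])
    show bd: "cmod (g M \<omega>) \<le> real M" for \<omega>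
      by (simp add: g_def)
    then show "g M \<in> L2 \<mu>"
      by (intro L2_bounded(1)[of _ "real M"]) auto
    show "L2_norm \<mu> (\<lambda>\<omega>. f \<omega> - g M \<omega>) < e"
      using M assms(2) by (simp add: power_less_imp_less_base)
  qed
qed

text \<open>Both functions are bounded by \<open>M\<close>, so the square of their difference is at
  most \<open>2 * M\<close> times its modulus.\<close>

lemma E_tendsto_L2_bounded:
  assumes "g \<in> L2 \<mu>" "\<And>\<omega>. cmod (g \<omega>) \<le> M"
  shows "(\<lambda>n. L2_norm \<mu> (\<lambda>\<omega>. g \<omega> - E n g \<omega>)) \<longlonglongrightarrow> 0"
proof -
  have int: "integrable \<mu> g"
    by (rule L2_integrable[OF assms(1)])
  have bd: "cmod (E n g \<omega>) \<le> M" for n \<omega>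
    using cmod_av_le_bound[OF int assms(2) prefix_of_nodes, of \<omega> n] order_trans[OF norm_ge_zero assms(2)]
    by (auto simp: E_def indicator_def)
  have sq: "(L2_norm \<mu> (\<lambda>\<omega>. g \<omega> - E n g \<omega>))\<^sup>2 \<le> 2 * M * (\<integral>\<omega>. cmod (g \<omega> - E n g \<omega>) \<partial>\<mu>)" for n
  proof -
    have "(cmod (g \<omega> - E n g \<omega>))\<^sup>2 \<le> 2 * M * cmod (g \<omega> - E n g \<omega>)" for \<omega>
    proof -
      have "cmod (g \<omega> - E n g \<omega>) \<le> 2 * M"
        using norm_triangle_ineq4[of "g \<omega>" "E n g \<omega>"] assms(2)[of \<omega>] bd[of n \<omega>] by linarith
      then show ?thesis
        unfolding power2_eq_square by (rule mult_right_mono) simp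
    qed
    then have "(L2_norm \<mu> (\<lambda>\<omega>. g \<omega> - E n g \<omega>))\<^sup>2 \<le> (\<integral>\<omega>. 2 * M * cmod (g \<omega> - E n g \<omega>) \<partial>\<mu>)"
      unfolding L2_norm_square
      by (intro integral_mono L2_square_integrable L2_diff assms(1) E_L2 integrable_mult_right
          integrable_norm Bochner_Integration.integrable_diff int E_integrable)
    then show ?thesis
      by simp
  qed
  have "(\<lambda>n. 2 * M * (\<integral>\<omega>. cmod (g \<omega> - E n g \<omega>) \<partial>\<mu>)) \<longlonglongrightarrow> 0"
    using tendsto_mult_left[OF E_tendsto_L1[OF int], of "2 * M"] by simp
  then have "(\<lambda>n. (L2_norm \<mu> (\<lambda>\<omega>. g \<omega> - E n g \<omega>))\<^sup>2) \<longlonglongrightarrow> 0"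
    by (rule tendsto_sandwich[OF _ _ tendsto_const, rotated 2]) (use sq in auto)
  then have "(\<lambda>n. sqrt ((L2_norm \<mu> (\<lambda>\<omega>. g \<omega> - E n g \<omega>))\<^sup>2)) \<longlonglongrightarrow> sqrt 0"
    by (rule tendsto_real_sqrt)
  then show ?thesis
    by simp
qed

text \<open>The residual \<open>f - E n f\<close> has average 0 over every cylinder of length
  \<open>n\<close>, hence is orthogonal to all functions of \<open>n\<close> letters.\<close>

lemma E_best_approximation:
  assumes "f \<in> L2 \<mu>" "cyl_fun n g"
  shows "L2_norm \<mu> (\<lambda>\<omega>. f \<omega> - E n f \<omega>) \<le> L2_norm \<mu> (\<lambda>\<omega>. f \<omega> - g \<omega>)"
proof -
  have "cyl_fun n (\<lambda>\<omega>. E n f \<omega> - g \<omega>)"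
    by (intro cyl_fun_diff cyl_fun_E assms)
  moreover have "av w (\<lambda>\<omega>. f \<omega> - E n f \<omega>) = 0" if "w \<in> level n" for w
    using L2_integrable[OF assms(1)] av_E_above[OF L2_integrable[OF assms(1)] level_node[OF that], of n]
    by (simp add: av_diff E_integrable level_length[OF that])
  ultimately have "L2_inner \<mu> (\<lambda>\<omega>. f \<omega> - E n f \<omega>) (\<lambda>\<omega>. E n f \<omega> - g \<omega>) = 0"
    by (intro L2_inner_cyl_fun_zero L2_diff assms E_L2)
  then show ?thesis
    using L2_norm_le_orthogonal[OF L2_diff[OF assms(1) E_L2] L2_diff[OF E_L2 cyl_fun_L2[OF assms(2)]],
        of n f n f] by simp
qed

text \<open>The function \<open>E n g\<close> of a truncation \<open>g\<close> is close to
  \<open>f\<close> for large \<open>n\<close>, and \<open>E n f\<close> is at least as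
  close.\<close>

lemma E_tendsto_L2:
  assumes "f \<in> L2 \<mu>"
  shows "(\<lambda>n. L2_norm \<mu> (\<lambda>\<omega>. f \<omega> - E n f \<omega>)) \<longlonglongrightarrow> 0"
proof (rule LIMSEQ_I)
  fix e :: real assume "e > 0"
  obtain M :: nat and g where g: "g \<in> L2 \<mu>" "L2_norm \<mu> (\<lambda>\<omega>. f \<omega> - g \<omega>) < e / 2"
    "\<And>\<omega>. cmod (g \<omega>) \<le> M"
    using truncation_L2[OF assms half_gt_zero[OF \<open>e > 0\<close>]] by metis
  obtain N where N: "\<And>n. n \<ge> N \<Longrightarrow> L2_norm \<mu> (\<lambda>\<omega>. g \<omega> - E n g \<omega>) < e / 2"
    using LIMSEQ_D[OF E_tendsto_L2_bounded[OF g(1,3)], of "e / 2"] \<open>e > 0\<close> by auto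
  have "L2_norm \<mu> (\<lambda>\<omega>. f \<omega> - E n f \<omega>) < e" if "n \<ge> N" for n
    using E_best_approximation[OF assms cyl_fun_E, of n g] N[OF that] g(2)
      L2_norm_diff_triangle[OF assms g(1) E_L2, of n g] by linarith
  then show "\<exists>no. \<forall>n\<ge>no. norm (L2_norm \<mu> (\<lambda>\<omega>. f \<omega> - E n f \<omega>) - 0) < e"
    by (intro exI[of _ N]) auto
qed

section \<open>The Dirac operator through averages over cylinders\<close>

lemma below_nodes: "below n \<subseteq> nodes"
  by (auto simp: below_def)

text \<open>The first two terms of the Dirac operator add up to \<open>P []\<close>, hence the eigenvalue 1 at the root.\<close>

definition eig :: "nat list \<Rightarrow> real" where
  "eig w = (if w = [] then 1 else (real (n_succ l A w) - 1) / mass w)"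

text \<open>The root is present for every \<open>F\<close>, as are the first two terms in
  \<open>dirac_partial_sum\<close>; \<open>F\<close> itself ranges over sets of nonempty
  words.\<close>

definition partial_sum :: "nat list set \<Rightarrow> ((nat \<Rightarrow> nat) \<Rightarrow> complex) \<Rightarrow> (nat \<Rightarrow> nat) \<Rightarrow> complex" where
  "partial_sum F h \<omega> = (\<Sum>y\<in>insert [] F. of_real (eig y) * P y h \<omega>)"

definition dirac_graph :: "(nat \<Rightarrow> nat) op_graph" where
  "dirac_graph = {(h, f). h \<in> L2 \<mu> \<and> f \<in> L2 \<mu> \<and> av [] f = 0 \<and>
     (\<forall>w i. w @ [i] \<in> adm \<longrightarrow>
        av (w @ [i]) f - av w f = of_real (eig w) * (av (w @ [i]) h - av w h))}"

lemma partial_sum_L2: "partial_sum F h \<in> L2 \<mu>"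
  unfolding partial_sum_def by (intro L2_sum L2_scale P_L2)

text \<open>Averages are continuous functionals. Again the filter is general, since both sequences
  and nets of finite sets occur.\<close>

lemma tendsto_av:
  assumes "((\<lambda>i. L2_norm \<mu> (\<lambda>\<omega>. g i \<omega> - f \<omega>)) \<longlongrightarrow> 0) net"
    and "\<And>i. g i \<in> L2 \<mu>" "f \<in> L2 \<mu>" "w \<in> nodes"
  shows "((\<lambda>i. av w (g i)) \<longlongrightarrow> av w f) net"
proof (rule Lim_transform2[OF tendsto_const])
  have "((\<lambda>i. L2_norm \<mu> (\<lambda>\<omega>. g i \<omega> - f \<omega>) / sqrt (mass w)) \<longlongrightarrow> 0) net"
    using tendsto_divide[OF assms(1) tendsto_const[of "sqrt (mass w)"]] mass_pos[OF assms(4)] by simp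
  then have "((\<lambda>i. av w (\<lambda>\<omega>. g i \<omega> - f \<omega>)) \<longlongrightarrow> 0) net"
    by (rule Lim_null_comparison[rotated])
      (auto intro!: always_eventually cmod_av_le L2_diff assms)
  from tendsto_minus[OF this] show "((\<lambda>i. av w f - av w (g i)) \<longlongrightarrow> 0) net"
    using assms(2,3) by (simp add: av_diff L2_integrable)
qed

lemma diff_sum_P:
  assumes "integrable \<mu> h" "w @ [i] \<in> adm" "finite F" "F \<subseteq> nodes"
  shows "av (w @ [i]) (\<lambda>\<omega>. \<Sum>y\<in>F. c y * P y h \<omega>) - av w (\<lambda>\<omega>. \<Sum>y\<in>F. c y * P y h \<omega>)
    = (if w \<in> F then c w * (av (w @ [i]) h - av w h) else 0)"
proof -
  have "av (w @ [i]) (\<lambda>\<omega>. \<Sum>y\<in>F. c y * P y h \<omega>) - av w (\<lambda>\<omega>. \<Sum>y\<in>F. c y * P y h \<omega>)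
      = (\<Sum>y\<in>F. c y * (av (w @ [i]) (P y h) - av w (P y h)))"
    by (simp add: av_sum P_integrable av_scale right_diff_distrib sum_subtractf)
  also have "\<dots> = (\<Sum>y\<in>F. if y = w then c w * (av (w @ [i]) h - av w h) else 0)"
    using assms by (intro sum.cong refl) (auto simp: diff_P subset_iff)
  finally show ?thesis
    using assms(3) by simp
qed

lemma av_Nil_sum_P:
  assumes "integrable \<mu> h" "F \<subseteq> nodes"
  shows "av [] (\<lambda>\<omega>. \<Sum>y\<in>F. c y * P y h \<omega>) = 0"
proof -
  have "av [] (P y h) = 0" if "y \<in> F" for y
    using that assms(2) by (intro av_Nil_P assms(1)) auto
  then show ?thesis
    by (simp add: av_sum P_integrable av_scale)
qed

lemma P_eq_of_diff:
  assumes "y \<in> nodes"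
    "\<And>i. y @ [i] \<in> adm \<Longrightarrow> av (y @ [i]) f - av y f = c * (av (y @ [i]) h - av y h)"
  shows "P y f \<omega> = c * P y h \<omega>"
proof (cases "\<omega> \<in> cyl y")
  case True
  then have "prefix_of (Suc (length y)) \<omega> = y @ [\<omega> (length y)]" "y @ [\<omega> (length y)] \<in> adm"
    using children_prefix_of[of \<omega> "length y"] by (auto simp: in_cyl_iff prefix_of_Suc children_def)
  then show ?thesis
    using assms(2)[of "\<omega> (length y)"] True by (simp add: P_def)
qed (simp add: P_def)

text \<open>If the series converges, averages pass to the limit, and each increment of the partial
  sums is eventually constant. Conversely, the increments identify the terms of the series with the
  projections of \<open>f\<close>, so it is the orthogonal expansion of \<open>f\<close>.\<close>

lemma dirac_graph_eq:
  "dirac_graph = {(h, f). h \<in> L2 \<mu> \<and> f \<in> L2 \<mu> \<and>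
     ((\<lambda>F. L2_norm \<mu> (\<lambda>\<omega>. partial_sum F h \<omega> - f \<omega>)) \<longlongrightarrow> 0) (finite_subsets_at_top adm)}"
  (is "_ = ?G")
proof (rule Set.set_eqI)
  fix p :: "((nat \<Rightarrow> nat) \<Rightarrow> complex) \<times> ((nat \<Rightarrow> nat) \<Rightarrow> complex)"
  obtain h f where p: "p = (h, f)"
    by (cases p)
  let ?net = "finite_subsets_at_top adm"
  let ?conv = "((\<lambda>F. L2_norm \<mu> (\<lambda>\<omega>. partial_sum F h \<omega> - f \<omega>)) \<longlongrightarrow> 0) ?net"
  have "(h, f) \<in> dirac_graph \<longleftrightarrow> ?conv" if L2: "h \<in> L2 \<mu>" "f \<in> L2 \<mu>"
  proof
    assume conv: ?conv
    have int: "integrable \<mu> h"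
      using L2 by (simp add: L2_integrable)
    have lim: "((\<lambda>F. av w (partial_sum F h)) \<longlongrightarrow> av w f) ?net" if "w \<in> nodes" for w
      by (rule tendsto_av[OF conv partial_sum_L2 L2(2) that])
    \<comment> \<open>The root does not belong to \<open>adm\<close> and must be exempted from
      membership in \<open>F\<close>.\<close>
    have ev: "\<forall>\<^sub>F F in ?net. finite F \<and> F \<subseteq> adm \<and> (w = [] \<or> w \<in> F)" if "w \<in> nodes" for w
      unfolding eventually_finite_subsets_at_top
      by (intro exI[of _ "{w} - {[]}"]) (use that in auto)
    have "((\<lambda>F. av [] (partial_sum F h)) \<longlongrightarrow> 0) ?net"
    proof (rule tendsto_eventually, rule eventually_mono[OF ev[of "[]"]])
      fix F assume "finite F \<and> F \<subseteq> adm \<and> ([] = [] \<or> [] \<in> F)"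
      then show "av [] (partial_sum F h) = 0"
        unfolding partial_sum_def by (intro av_Nil_sum_P[OF int]) auto
    qed simp
    then have "av [] f = 0"
      using lim[of "[]"] by (intro tendsto_unique[of ?net]) auto
    moreover have "av (w @ [i]) f - av w f = of_real (eig w) * (av (w @ [i]) h - av w h)"
      if wi: "w @ [i] \<in> adm" for w i
    proof -
      have w: "w \<in> nodes"
        by (rule butlast_node[OF wi])
      have "((\<lambda>F. av (w @ [i]) (partial_sum F h) - av w (partial_sum F h))
          \<longlongrightarrow> of_real (eig w) * (av (w @ [i]) h - av w h)) ?net"
      proof (rule tendsto_eventually, rule eventually_mono[OF ev[OF w]])
        fix F assume F: "finite F \<and> F \<subseteq> adm \<and> (w = [] \<or> w \<in> F)"
        show "av (w @ [i]) (partial_sum F h) - av w (partial_sum F h)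
            = of_real (eig w) * (av (w @ [i]) h - av w h)"
          unfolding partial_sum_def by (subst diff_sum_P[OF int wi]) (use F in auto)
      qed
      moreover have "((\<lambda>F. av (w @ [i]) (partial_sum F h) - av w (partial_sum F h))
          \<longlongrightarrow> av (w @ [i]) f - av w f) ?net"
        using w wi by (intro tendsto_diff lim) auto
      ultimately show ?thesis
        by (intro tendsto_unique[of ?net]) auto
    qed
    ultimately show "(h, f) \<in> dirac_graph"
      using L2 by (simp add: dirac_graph_def)
  next
    assume "(h, f) \<in> dirac_graph"
    then have f0: "av [] f = 0" and
      diff: "\<And>w i. w @ [i] \<in> adm \<Longrightarrow> av (w @ [i]) f - av w f = of_real (eig w) * (av (w @ [i]) h - av w h)"
      by (auto simp: dirac_graph_def)
    have int: "integrable \<mu> f"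
      using L2 by (simp add: L2_integrable)
    \<comment> \<open>From here on \<open>h\<close> can be forgotten: the partial sums are those of
      the expansion of \<open>f\<close>.\<close>
    have PP: "of_real (eig y) * P y h \<omega> = P y f \<omega>" if "y \<in> nodes" for y \<omega>
      using P_eq_of_diff[OF that diff] by simp
    show ?conv
    proof (rule tendstoI)
      fix e :: real assume "e > 0"
      then obtain n where n: "L2_norm \<mu> (\<lambda>\<omega>. f \<omega> - E n f \<omega>) < e"
        using order_tendstoD(2)[OF E_tendsto_L2[OF L2(2)]] by (auto simp: eventually_sequentially)
      have "\<forall>\<^sub>F F in ?net. finite F \<and> F \<subseteq> adm \<and> below n \<subseteq> insert [] F"
        unfolding eventually_finite_subsets_at_top
        using finite_below[of n] by (intro exI[of _ "below n - {[]}"]) (auto dest: below_nodes[THEN subsetD])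
      then show "\<forall>\<^sub>F F in ?net. dist (L2_norm \<mu> (\<lambda>\<omega>. partial_sum F h \<omega> - f \<omega>)) 0 < e"
      proof (rule eventually_mono)
        fix F assume "finite F \<and> F \<subseteq> adm \<and> below n \<subseteq> insert [] F"
        then have F: "finite (insert [] F)" "insert [] F \<subseteq> nodes" "below n \<subseteq> insert [] F"
          by auto
        \<comment> \<open>\<open>u\<close> is the remainder and \<open>v\<close> collects the terms
          of \<open>F\<close> beyond length \<open>n\<close>. They are orthogonal and add up to
          \<open>f - E n f\<close>, so the remainder is no larger than this difference.\<close>
        define u where "u \<omega> = f \<omega> - partial_sum F h \<omega>" for \<omega>
        define v where "v \<omega> = (\<Sum>y\<in>insert [] F - below n. P y f \<omega>)" for \<omega>
        have S: "partial_sum F h \<omega> = (\<Sum>y\<in>insert [] F. P y f \<omega>)" for \<omega>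
          unfolding partial_sum_def by (intro sum.cong refl PP) (use F(2) in auto)
        have u: "u \<in> L2 \<mu>"
          unfolding u_def by (intro L2_diff L2 partial_sum_L2)
        have v: "v \<in> L2 \<mu>"
          unfolding v_def by (intro L2_sum P_L2)
        have "L2_inner \<mu> u (P y f) = 0" if y: "y \<in> insert [] F" for y
        proof -
          have "P y u \<omega> = 0 * P y f \<omega>" for \<omega>
          proof (rule P_eq_of_diff)
            fix i assume i: "y @ [i] \<in> adm"
            have "av (y @ [i]) (partial_sum F h) - av y (partial_sum F h) = av (y @ [i]) f - av y f"
              using diff_sum_P[OF int i F(1,2), of "\<lambda>_. 1"] y by (simp add: S[abs_def])
            then show "av (y @ [i]) u - av y u = 0 * (av (y @ [i]) f - av y f)"
              unfolding u_def by (simp add: av_diff int L2_integrable partial_sum_L2 algebra_simps)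
          qed (use y F(2) in auto)
          then show ?thesis
            using P_inner[OF u L2(2), of y] y F(2) by (auto simp: L2_inner_def)
        qed
        then have "L2_inner \<mu> u v = 0"
          unfolding v_def by (subst L2_inner_sum_right[OF u P_L2]) auto
        moreover have "u \<omega> + v \<omega> = f \<omega> - E n f \<omega>" for \<omega>
        proof -
          have "E 0 f \<omega> = 0"
            using f0 by (simp add: E_def)
          then have "(\<Sum>y\<in>below n. P y f \<omega>) = E n f \<omega>"
            by (simp add: sum_P_below)
          then show ?thesis
            unfolding u_def v_def S using sum.subset_diff[OF F(3,1), of "\<lambda>y. P y f \<omega>"]
            by (simp add: algebra_simps)
        qed
        ultimately have "L2_norm \<mu> u < e"
          using L2_norm_le_orthogonal[OF u v] n by simp
        then show "dist (L2_norm \<mu> (\<lambda>\<omega>. partial_sum F h \<omega> - f \<omega>)) 0 < e"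
          by (simp add: u_def[abs_def] L2_norm_diff_commute[of \<mu> "partial_sum F h"])
      qed
    qed
  qed
  moreover have "h \<in> L2 \<mu> \<and> f \<in> L2 \<mu>" if "(h, f) \<in> dirac_graph"
    using that by (simp add: dirac_graph_def)
  ultimately show "p \<in> dirac_graph \<longleftrightarrow> p \<in> ?G"
    unfolding p by blast
qed

section \<open>Linearity, closedness and self-adjointness of the Dirac operator\<close>

lemma node_induct[consumes 1, case_names Nil snoc]:
  assumes "w \<in> nodes" "Q []" "\<And>w i. w @ [i] \<in> adm \<Longrightarrow> Q w \<Longrightarrow> Q (w @ [i])"
  shows "Q w"
  using assms(1)
proof (induction w rule: rev_induct)
  case (snoc i w)
  then have "w @ [i] \<in> adm"
    by simp
  then show ?case
    using snoc.IH assms(3) butlast_node by blast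
qed (rule assms(2))

lemma av_eq_of_diff_eq:
  assumes "av [] f = av [] g"
    and "\<And>w i. w @ [i] \<in> adm \<Longrightarrow> av (w @ [i]) f - av w f = av (w @ [i]) g - av w g"
    and "w \<in> nodes"
  shows "av w f = av w g"
  using assms(3)
proof (induction w rule: node_induct)
  case (snoc w i)
  then show ?case
    using assms(2)[OF snoc(1)] by simp
qed (rule assms(1))

lemma dirac_graph_L2: "(h, f) \<in> dirac_graph \<Longrightarrow> h \<in> L2 \<mu> \<and> f \<in> L2 \<mu>"
  by (simp add: dirac_graph_def)

lemma dirac_graph_Nil: "(h, f) \<in> dirac_graph \<Longrightarrow> av [] f = 0"
  by (simp add: dirac_graph_def)

lemma dirac_graph_diff:
  "(h, f) \<in> dirac_graph \<Longrightarrow> w @ [i] \<in> adm \<Longrightarrow>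
    av (w @ [i]) f - av w f = of_real (eig w) * (av (w @ [i]) h - av w h)"
  by (simp add: dirac_graph_def)

lemma dirac_graphI:
  assumes "h \<in> L2 \<mu>" "f \<in> L2 \<mu>" "av [] f = 0"
    "\<And>w i. w @ [i] \<in> adm \<Longrightarrow> av (w @ [i]) f - av w f = of_real (eig w) * (av (w @ [i]) h - av w h)"
  shows "(h, f) \<in> dirac_graph"
  using assms by (simp add: dirac_graph_def)

lemma dirac_graph_add:
  assumes "(h, f) \<in> dirac_graph" "(h', f') \<in> dirac_graph"
  shows "((\<lambda>x. h x + h' x), (\<lambda>x. f x + f' x)) \<in> dirac_graph"
proof -
  have L2: "h \<in> L2 \<mu>" "f \<in> L2 \<mu>" "h' \<in> L2 \<mu>" "f' \<in> L2 \<mu>"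
    using assms dirac_graph_L2 by blast+
  show ?thesis
  proof (rule dirac_graphI)
    fix w i assume "w @ [i] \<in> adm"
    from dirac_graph_diff[OF assms(1) this] dirac_graph_diff[OF assms(2) this]
    show "av (w @ [i]) (\<lambda>x. f x + f' x) - av w (\<lambda>x. f x + f' x)
      = of_real (eig w) * (av (w @ [i]) (\<lambda>x. h x + h' x) - av w (\<lambda>x. h x + h' x))"
      using L2 by (simp add: av_add L2_integrable algebra_simps)
  qed (use L2 assms in \<open>simp_all add: L2_add av_add L2_integrable dirac_graph_Nil\<close>)
qed

lemma dirac_graph_scale:
  assumes "(h, f) \<in> dirac_graph"
  shows "((\<lambda>x. z * h x), (\<lambda>x. z * f x)) \<in> dirac_graph"
proof (rule dirac_graphI)
  fix w i assume "w @ [i] \<in> adm"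
  from dirac_graph_diff[OF assms this]
  show "av (w @ [i]) (\<lambda>x. z * f x) - av w (\<lambda>x. z * f x)
    = of_real (eig w) * (av (w @ [i]) (\<lambda>x. z * h x) - av w (\<lambda>x. z * h x))"
    by (simp add: av_scale mult.left_commute flip: right_diff_distrib)
qed (use assms in \<open>simp_all add: dirac_graph_Nil dirac_graph_L2 L2_scale av_scale\<close>)

lemma dirac_graph_zero: "((\<lambda>x. 0), (\<lambda>x. 0)) \<in> dirac_graph"
  using av_scale[of _ 0] by (intro dirac_graphI) simp_all

lemma dirac_graph_AE_zero:
  assumes "(h, f) \<in> dirac_graph" "AE x in \<mu>. h x = 0"
  shows "AE x in \<mu>. f x = 0"
proof -
  have L2: "h \<in> L2 \<mu>" "f \<in> L2 \<mu>"
    using assms dirac_graph_L2 by blast+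
  have h0: "av w h = 0" for w
    using av_cong_AE[of h "\<lambda>_. 0" w] av_scale[of w 0] L2 assms(2) by (simp add: L2_measurable)
  have "av w f = av w (\<lambda>_. 0)" if "w \<in> nodes" for w
    using av_eq_of_diff_eq[of f "\<lambda>_. 0" w] dirac_graph_Nil[OF assms(1)] dirac_graph_diff[OF assms(1)]
      av_scale[of _ 0] that by (simp add: h0)
  then show ?thesis
    using av_eq_AE[of f "\<lambda>_. 0"] L2 by (simp add: L2_integrable)
qed

lemma linear_dirac_graph: "linear_graph \<mu> dirac_graph"
  unfolding linear_graph_def
proof (intro conjI)
  show "dirac_graph \<subseteq> L2 \<mu> \<times> L2 \<mu>"
    by (auto dest: dirac_graph_L2)
  show "((\<lambda>x. 0), (\<lambda>x. 0)) \<in> dirac_graph"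
    by (rule dirac_graph_zero)
  show "\<forall>(h, f)\<in>dirac_graph. \<forall>(h', f')\<in>dirac_graph. ((\<lambda>x. h x + h' x), (\<lambda>x. f x + f' x)) \<in> dirac_graph"
    by (safe, rule dirac_graph_add)
  show "\<forall>z. \<forall>(h, f)\<in>dirac_graph. ((\<lambda>x. z * h x), (\<lambda>x. z * f x)) \<in> dirac_graph"
    by (safe, rule dirac_graph_scale)
  show "\<forall>(h, f)\<in>dirac_graph. (AE x in \<mu>. h x = 0) \<longrightarrow> (AE x in \<mu>. f x = 0)"
    using dirac_graph_AE_zero by blast
qed

lemma dirac_graph_unique:
  assumes "(h, f) \<in> dirac_graph" "(h, g) \<in> dirac_graph"
  shows "AE x in \<mu>. f x = g x"
proof -
  have "((\<lambda>x. h x + (-1) * h x), (\<lambda>x. f x + (-1) * g x)) \<in> dirac_graph"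
    by (rule dirac_graph_add[OF assms(1) dirac_graph_scale[OF assms(2)]])
  then have "AE x in \<mu>. f x + (-1) * g x = 0"
    by (rule dirac_graph_AE_zero) simp
  then show ?thesis
    by simp
qed

text \<open>A supply of eigenvectors, used as test functions for the adjoint and as witnesses of
  unboundedness.\<close>

lemma dirac_graph_P:
  assumes "u \<in> L2 \<mu>" "y \<in> nodes"
  shows "(P y u, (\<lambda>\<omega>. of_real (eig y) * P y u \<omega>)) \<in> dirac_graph"
proof (rule dirac_graphI)
  have int: "integrable \<mu> u"
    using assms(1) by (rule L2_integrable)
  show "av [] (\<lambda>\<omega>. of_real (eig y) * P y u \<omega>) = 0"
    by (simp add: av_scale av_Nil_P[OF int assms(2)])
  fix w i assume wi: "w @ [i] \<in> adm"
  show "av (w @ [i]) (\<lambda>\<omega>. of_real (eig y) * P y u \<omega>) - av w (\<lambda>\<omega>. of_real (eig y) * P y u \<omega>)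
    = of_real (eig w) * (av (w @ [i]) (P y u) - av w (P y u))"
    using diff_P[OF int wi assms(2)] by (simp add: av_scale flip: right_diff_distrib)
qed (use assms in \<open>simp_all add: P_L2 L2_scale\<close>)

lemma av_indicator_X: "w \<in> nodes \<Longrightarrow> av w (indicator X) = 1"
  by (rule av_const) (use cyl_subset in \<open>auto simp: indicator_def\<close>)

lemma av_zero[simp]: "av w (\<lambda>_. 0) = 0"
  using av_scale[of w 0 "\<lambda>_. 0"] by simp

lemma dirac_graph_one: "(indicator X, (\<lambda>_. 0)) \<in> dirac_graph"
proof (rule dirac_graphI)
  show "(indicator X :: _ \<Rightarrow> complex) \<in> L2 \<mu>"
    using cyl_fun_L2[OF cyl_fun_indicator[of "[]" 0]] by simp
  fix w i assume "w @ [i] \<in> adm"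
  then show "av (w @ [i]) (\<lambda>_. 0) - av w (\<lambda>_. 0)
      = of_real (eig w) * (av (w @ [i]) (indicator X) - av w (indicator X))"
    using av_indicator_X[of "w @ [i]"] av_indicator_X[OF butlast_node] by simp
qed simp_all

lemma diff_E:
  assumes "integrable \<mu> f" "w @ [i] \<in> adm"
  shows "av (w @ [i]) (E n f) - av w (E n f) = (if w \<in> below n then av (w @ [i]) f - av w f else 0)"
proof -
  have w: "w \<in> nodes" "w @ [i] \<in> nodes"
    using assms(2) butlast_node by auto
  show ?thesis
  proof (cases "length w < n")
    case True
    then show ?thesis
      using w av_E_above[OF assms(1) w(1), of n] av_E_above[OF assms(1) w(2), of n]
      by (simp add: below_def)
  next
    case False
    then show ?thesis
      using av_E_below[OF w(1), of n] av_E_below[OF w(2), of n] by (simp add: below_def)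
  qed
qed

lemma dirac_graph_E:
  assumes "f \<in> L2 \<mu>"
  shows "(E n f, (\<lambda>\<omega>. \<Sum>y\<in>below n. of_real (eig y) * P y f \<omega>)) \<in> dirac_graph"
proof (rule dirac_graphI)
  have int: "integrable \<mu> f"
    using assms by (rule L2_integrable)
  show "av [] (\<lambda>\<omega>. \<Sum>y\<in>below n. of_real (eig y) * P y f \<omega>) = 0"
    by (rule av_Nil_sum_P[OF int below_nodes])
  fix w i assume wi: "w @ [i] \<in> adm"
  show "av (w @ [i]) (\<lambda>\<omega>. \<Sum>y\<in>below n. of_real (eig y) * P y f \<omega>)
      - av w (\<lambda>\<omega>. \<Sum>y\<in>below n. of_real (eig y) * P y f \<omega>)
      = of_real (eig w) * (av (w @ [i]) (E n f) - av w (E n f))"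
    unfolding diff_E[OF int wi] diff_sum_P[OF int wi finite_below below_nodes] by simp
qed (use assms in \<open>auto intro!: E_L2 L2_sum L2_scale P_L2\<close>)

lemma densely_defined_dirac_graph: "densely_defined \<mu> dirac_graph"
  unfolding densely_defined_def
proof (intro ballI allI impI)
  fix g and e :: real assume "g \<in> L2 \<mu>" "e > 0"
  then obtain n where "L2_norm \<mu> (\<lambda>x. g x - E n g x) < e"
    using order_tendstoD(2)[OF E_tendsto_L2[OF \<open>g \<in> L2 \<mu>\<close>] \<open>e > 0\<close>]
    by (auto simp: eventually_sequentially)
  then show "\<exists>h\<in>Domain dirac_graph. L2_norm \<mu> (\<lambda>x. g x - h x) < e"
    using dirac_graph_E[OF \<open>g \<in> L2 \<mu>\<close>] by blast
qed

text \<open>The graph is cut out by linear equations between averages, and these are preserved by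
  limits in mean square.\<close>

lemma closure_dirac_graph: "graph_closure \<mu> dirac_graph = dirac_graph"
proof (intro equalityI subsetI)
  fix p assume "p \<in> graph_closure \<mu> dirac_graph"
  moreover obtain g k where p: "p = (g, k)"
    by (cases p)
  ultimately have L2: "g \<in> L2 \<mu>" "k \<in> L2 \<mu>"
    and approx: "\<And>e. e > 0 \<Longrightarrow> \<exists>(h, f)\<in>dirac_graph.
      L2_norm \<mu> (\<lambda>x. g x - h x) < e \<and> L2_norm \<mu> (\<lambda>x. k x - f x) < e"
    by (simp_all add: graph_closure_def)
  have "\<exists>q. q \<in> dirac_graph \<and> L2_norm \<mu> (\<lambda>x. g x - fst q x) < inverse (real (Suc n))
      \<and> L2_norm \<mu> (\<lambda>x. k x - snd q x) < inverse (real (Suc n))" for n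
    using approx[of "inverse (real (Suc n))"] by (simp only: case_prod_unfold Bex_def) simp
  from choice[OF allI[OF this]] obtain q where "\<forall>n. q n \<in> dirac_graph
      \<and> L2_norm \<mu> (\<lambda>x. g x - fst (q n) x) < inverse (real (Suc n))
      \<and> L2_norm \<mu> (\<lambda>x. k x - snd (q n) x) < inverse (real (Suc n))" ..
  then have q: "\<And>n. q n \<in> dirac_graph"
    "\<And>n. L2_norm \<mu> (\<lambda>x. g x - fst (q n) x) < inverse (real (Suc n))"
    "\<And>n. L2_norm \<mu> (\<lambda>x. k x - snd (q n) x) < inverse (real (Suc n))"
    by blast+
  have q': "(fst (q n), snd (q n)) \<in> dirac_graph" for n
    using q(1) by simp
  have "(\<lambda>n. L2_norm \<mu> (\<lambda>x. fst (q n) x - g x)) \<longlonglongrightarrow> 0"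
    by (rule tendsto_sandwich[OF _ _ tendsto_const LIMSEQ_inverse_real_of_nat])
      (use q(2) in \<open>auto intro!: always_eventually less_imp_le simp: L2_norm_diff_commute[of _ _ g]\<close>)
  then have lim_g: "(\<lambda>n. av w (fst (q n))) \<longlonglongrightarrow> av w g" if "w \<in> nodes" for w
    by (rule tendsto_av) (use q' dirac_graph_L2 L2 that in blast)+
  have "(\<lambda>n. L2_norm \<mu> (\<lambda>x. snd (q n) x - k x)) \<longlonglongrightarrow> 0"
    by (rule tendsto_sandwich[OF _ _ tendsto_const LIMSEQ_inverse_real_of_nat])
      (use q(3) in \<open>auto intro!: always_eventually less_imp_le simp: L2_norm_diff_commute[of _ _ k]\<close>)
  then have lim_k: "(\<lambda>n. av w (snd (q n))) \<longlonglongrightarrow> av w k" if "w \<in> nodes" for w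
    by (rule tendsto_av) (use q' dirac_graph_L2 L2 that in blast)+
  show "p \<in> dirac_graph"
    unfolding p
  proof (rule dirac_graphI[OF L2])
    show "av [] k = 0"
      using lim_k[of "[]"] dirac_graph_Nil[OF q'] by (simp add: LIMSEQ_const_iff)
    fix w i assume wi: "w @ [i] \<in> adm"
    then have nodes: "w \<in> nodes" "w @ [i] \<in> nodes"
      using butlast_node by auto
    have "(\<lambda>n. av (w @ [i]) (snd (q n)) - av w (snd (q n))) \<longlonglongrightarrow> av (w @ [i]) k - av w k"
      by (intro tendsto_diff lim_k nodes)
    moreover have "(\<lambda>n. of_real (eig w) * (av (w @ [i]) (fst (q n)) - av w (fst (q n))))
      \<longlonglongrightarrow> of_real (eig w) * (av (w @ [i]) g - av w g)"
      by (intro tendsto_mult tendsto_const tendsto_diff lim_g nodes)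
    ultimately show "av (w @ [i]) k - av w k = of_real (eig w) * (av (w @ [i]) g - av w g)"
      using dirac_graph_diff[OF q' wi] by (simp add: LIMSEQ_unique)
  qed
next
  fix p assume "p \<in> dirac_graph"
  then show "p \<in> graph_closure \<mu> dirac_graph"
    using dirac_graph_L2 by (cases p) (auto simp: graph_closure_def intro!: bexI[of _ p])
qed

lemma L2_inner_indicator: "L2_inner \<mu> (indicator (cyl w)) k = cnj (cyl_int w k)"
proof -
  have "L2_inner \<mu> (indicator (cyl w)) k = (\<integral>\<omega>. cnj (indicator (cyl w) \<omega> * k \<omega>) \<partial>\<mu>)"
    unfolding L2_inner_def by (intro Bochner_Integration.integral_cong) (auto simp: indicator_def)
  also have "\<dots> = cnj (cyl_int w k)"
    unfolding cyl_int_def by (rule Bochner_Integration.integral_cnj)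
  finally show ?thesis .
qed

lemma partial_sum_symmetric:
  assumes "h \<in> L2 \<mu>" "g \<in> L2 \<mu>" "finite F" "F \<subseteq> adm"
  shows "L2_inner \<mu> (partial_sum F h) g = L2_inner \<mu> h (partial_sum F g)"
proof -
  have "L2_inner \<mu> (partial_sum F h) g
      = (\<Sum>y\<in>insert [] F. of_real (eig y) * L2_inner \<mu> (P y h) g)"
    unfolding partial_sum_def
    by (subst L2_inner_sum_left) (auto intro!: assms L2_scale P_L2 simp: L2_inner_scale_left)
  also have "\<dots> = (\<Sum>y\<in>insert [] F. of_real (eig y) * L2_inner \<mu> h (P y g))"
    using assms by (intro sum.cong refl arg_cong2[where f = "(*)"] P_inner) auto
  also have "\<dots> = L2_inner \<mu> h (partial_sum F g)"
    unfolding partial_sum_def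
    by (subst L2_inner_sum_right) (auto intro!: assms L2_scale P_L2 simp: L2_inner_scale_right)
  finally show ?thesis .
qed

text \<open>Testing an element of the adjoint with eigenvectors recovers the equations for its
  increments, and testing with the constant function gives mean 0. The other inclusion is the
  symmetry of the partial sums in the limit.\<close>

lemma adjoint_dirac_graph: "graph_adjoint \<mu> dirac_graph = dirac_graph"
proof (intro equalityI subsetI)
  fix p assume "p \<in> graph_adjoint \<mu> dirac_graph"
  moreover obtain g k where p: "p = (g, k)"
    by (cases p)
  ultimately have L2: "g \<in> L2 \<mu>" "k \<in> L2 \<mu>"
    and adj: "\<And>h f. (h, f) \<in> dirac_graph \<Longrightarrow> L2_inner \<mu> f g = L2_inner \<mu> h k"
    by (auto simp: graph_adjoint_def)
  show "p \<in> dirac_graph"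
    unfolding p
  proof (rule dirac_graphI[OF L2])
    have "cnj (cyl_int [] k) = 0"
      using adj[OF dirac_graph_one] L2_inner_indicator[of "[]" k] by (simp add: L2_inner_def)
    then show "av [] k = 0"
      by (simp add: av_def)
    fix w i assume wi: "w @ [i] \<in> adm"
    then have nodes: "w \<in> nodes" "w @ [i] \<in> nodes"
      using butlast_node by auto
    \<comment> \<open>Pairing with the projection of this indicator isolates the increment across
      the single edge from \<open>w\<close> to \<open>w @ [i]\<close>.\<close>
    define u :: "(nat \<Rightarrow> nat) \<Rightarrow> complex" where "u = indicator (cyl (w @ [i]))"
    have u: "u \<in> L2 \<mu>"
      unfolding u_def by (rule L2_indicator) simp
    have pair: "L2_inner \<mu> (P w u) k' = of_real (mass (w @ [i])) * cnj (av (w @ [i]) k' - av w k')"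
      if "k' \<in> L2 \<mu>" for k'
    proof -
      have "L2_inner \<mu> (P w u) k' = cnj (cyl_int (w @ [i]) (P w k'))"
        unfolding P_inner[OF u that nodes(1)] unfolding u_def by (rule L2_inner_indicator)
      also have "\<dots> = of_real (mass (w @ [i])) * cnj (av (w @ [i]) (P w k'))"
        by (simp add: cyl_int_av[OF nodes(2)])
      also have "av (w @ [i]) (P w k') = av (w @ [i]) k' - av w k'"
        by (subst av_P[OF L2_integrable[OF that] nodes(2,1)]) simp
      finally show ?thesis .
    qed
    have "of_real (eig w) * L2_inner \<mu> (P w u) g = L2_inner \<mu> (P w u) k"
      using adj[OF dirac_graph_P[OF u nodes(1)]] by (simp add: L2_inner_scale_left)
    then have "cnj (of_real (eig w) * (av (w @ [i]) g - av w g)) = cnj (av (w @ [i]) k - av w k)"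
      using mass_pos[OF nodes(2)] by (simp add: pair L2)
    then show "av (w @ [i]) k - av w k = of_real (eig w) * (av (w @ [i]) g - av w g)"
      by (metis complex_cnj_cancel_iff)
  qed
next
  fix p assume "p \<in> dirac_graph"
  then obtain g k where p: "p = (g, k)" "(g, k) \<in> dirac_graph"
    by (cases p) auto
  have "L2_inner \<mu> f g = L2_inner \<mu> h k" if hf: "(h, f) \<in> dirac_graph" for h f
  proof -
    let ?net = "finite_subsets_at_top adm"
    have L2: "h \<in> L2 \<mu>" "f \<in> L2 \<mu>" "g \<in> L2 \<mu>" "k \<in> L2 \<mu>"
      using hf p(2) dirac_graph_L2 by blast+
    have conv: "((\<lambda>F. L2_norm \<mu> (\<lambda>\<omega>. partial_sum F h \<omega> - f \<omega>)) \<longlongrightarrow> 0) ?net"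
      "((\<lambda>F. L2_norm \<mu> (\<lambda>\<omega>. partial_sum F g \<omega> - k \<omega>)) \<longlongrightarrow> 0) ?net"
      using hf p(2) unfolding dirac_graph_eq by auto
    have 1: "((\<lambda>F. L2_inner \<mu> (partial_sum F h) g) \<longlongrightarrow> L2_inner \<mu> f g) ?net"
      by (rule tendsto_L2_inner[OF conv(1) partial_sum_L2 L2(2,3)])
    have "((\<lambda>F. cnj (L2_inner \<mu> (partial_sum F g) h)) \<longlongrightarrow> cnj (L2_inner \<mu> k h)) ?net"
      by (intro tendsto_cnj tendsto_L2_inner[OF conv(2) partial_sum_L2 L2(4,1)])
    then have "((\<lambda>F. L2_inner \<mu> h (partial_sum F g)) \<longlongrightarrow> L2_inner \<mu> h k) ?net"
      by (simp flip: L2_inner_commute)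
    then have 2: "((\<lambda>F. L2_inner \<mu> (partial_sum F h) g) \<longlongrightarrow> L2_inner \<mu> h k) ?net"
    proof (rule Lim_transform_eventually)
      have "\<forall>\<^sub>F F in ?net. finite F \<and> F \<subseteq> adm"
        unfolding eventually_finite_subsets_at_top by auto
      then show "\<forall>\<^sub>F F in ?net. L2_inner \<mu> h (partial_sum F g) = L2_inner \<mu> (partial_sum F h) g"
        by (rule eventually_mono) (use L2 in \<open>simp add: partial_sum_symmetric\<close>)
    qed
    show ?thesis
      by (rule tendsto_unique[OF _ 1 2]) simp
  qed
  then show "p \<in> graph_adjoint \<mu> dirac_graph"
    using p dirac_graph_L2 by (auto simp: graph_adjoint_def)
qed

lemma essentially_self_adjoint_dirac_graph: "essentially_self_adjoint \<mu> dirac_graph"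
  by (simp add: essentially_self_adjoint_def densely_defined_dirac_graph closure_dirac_graph
      adjoint_dirac_graph)

section \<open>Commutators with locally constant functions\<close>

lemma P_add: "integrable \<mu> f \<Longrightarrow> integrable \<mu> g \<Longrightarrow> P y (\<lambda>\<omega>. f \<omega> + g \<omega>) \<omega> = P y f \<omega> + P y g \<omega>"
  by (simp add: P_def av_add algebra_simps)

lemma P_scale: "P y (\<lambda>\<omega>. z * f \<omega>) \<omega> = z * P y f \<omega>"
  by (simp add: P_def av_scale algebra_simps)

text \<open>The constant \<open>\<kappa>\<close> lets the mass of the parent bound the average over
  the child as well.\<close>

lemma cmod_diff_le:
  assumes "h \<in> L2 \<mu>" "w @ [i] \<in> adm"
  shows "cmod (av (w @ [i]) h - av w h) \<le> 2 * L2_norm \<mu> h / sqrt (\<kappa> * mass w)"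
proof -
  have nodes: "w \<in> nodes" "w @ [i] \<in> nodes"
    using assms(2) butlast_node by auto
  have le: "\<kappa> * mass w \<le> mass (w @ [i])"
    using kappa_mass[OF assms(2)] .
  have pos: "0 < \<kappa> * mass w"
    using kappa_pos mass_pos[OF nodes(1)] by simp
  have "cmod (av (w @ [i]) h - av w h) \<le> cmod (av (w @ [i]) h) + cmod (av w h)"
    by (rule norm_triangle_ineq4)
  also have "\<dots> \<le> L2_norm \<mu> h / sqrt (mass (w @ [i])) + L2_norm \<mu> h / sqrt (mass w)"
    by (intro add_mono cmod_av_le assms nodes)
  also have "\<dots> \<le> L2_norm \<mu> h / sqrt (\<kappa> * mass w) + L2_norm \<mu> h / sqrt (\<kappa> * mass w)"
    using le pos mass_child_le[of w i] order_trans[OF le mass_child_le]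
    by (intro add_mono divide_left_mono real_sqrt_le_mono mult_pos_pos) auto
  finally show ?thesis
    by simp
qed

lemma cmod_P_le:
  assumes "h \<in> L2 \<mu>"
  shows "cmod (P y h \<omega>) \<le> 2 * L2_norm \<mu> h / sqrt (\<kappa> * mass y)"
proof (cases "\<omega> \<in> cyl y")
  case True
  then have "prefix_of (Suc (length y)) \<omega> = y @ [\<omega> (length y)]" "y @ [\<omega> (length y)] \<in> adm"
    using children_prefix_of[of \<omega> "length y"] by (auto simp: in_cyl_iff prefix_of_Suc children_def)
  then show ?thesis
    using cmod_diff_le[OF assms, of y "\<omega> (length y)"] True by (simp add: P_def)
next
  case False
  then show ?thesis
    using kappa_pos by (simp add: P_def)
qed

text \<open>
  For \<open>b\<close> depending on the first \<open>n\<close> letters only, \<open>P y\<close> commutes with \<open>b\<close> unless \<open>y\<close> is shorter than \<open>n\<close>, so that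
  \<open>comm n b\<close> is the bounded extension of the commutator.
\<close>

definition comm :: "nat \<Rightarrow> ((nat \<Rightarrow> nat) \<Rightarrow> complex) \<Rightarrow> ((nat \<Rightarrow> nat) \<Rightarrow> complex) \<Rightarrow> (nat \<Rightarrow> nat) \<Rightarrow> complex" where
  "comm n b h \<omega> = (\<Sum>y\<in>below n. of_real (eig y) * (P y (\<lambda>\<omega>. b \<omega> * h \<omega>) \<omega> - b \<omega> * P y h \<omega>))"

lemma cyl_fun_mult_L2:
  assumes "cyl_fun n b" "h \<in> L2 \<mu>"
  shows "(\<lambda>\<omega>. b \<omega> * h \<omega>) \<in> L2 \<mu>"
proof -
  obtain B where B: "0 \<le> B" "\<And>\<omega>. cmod (b \<omega>) \<le> B"
    using cyl_fun_bounded[OF assms(1)] by metis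
  show ?thesis
    using B assms(2) cyl_fun_measurable[OF assms(1)]
    by (intro L2_dominated(1)[OF assms(2), where C = B])
      (auto intro!: borel_measurable_times mult_right_mono simp: norm_mult L2_measurable)
qed

lemma comm_L2:
  assumes "cyl_fun n b" "h \<in> L2 \<mu>"
  shows "comm n b h \<in> L2 \<mu>"
  unfolding comm_def
  by (intro L2_sum L2_scale L2_diff P_L2 cyl_fun_mult_L2[OF assms(1)])

text \<open>The second component splits into \<open>r\<close>, whose averages vanish up to length
  \<open>n\<close>, and \<open>S\<close>, whose increments stop at length \<open>n\<close>. The
  equations for short words thus concern \<open>S\<close>, those for long words concern
  \<open>r\<close>, where \<open>b\<close> is a constant factor.\<close>

lemma dirac_graph_mult:
  assumes "cyl_fun n b" "(h, f) \<in> dirac_graph"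
  shows "((\<lambda>\<omega>. b \<omega> * h \<omega>), (\<lambda>\<omega>. b \<omega> * f \<omega> + comm n b h \<omega>)) \<in> dirac_graph"
proof -
  have L2: "h \<in> L2 \<mu>" "f \<in> L2 \<mu>"
    using assms dirac_graph_L2 by blast+
  have int: "integrable \<mu> f"
    by (rule L2_integrable[OF L2(2)])
  define bh where "bh = (\<lambda>\<omega>. b \<omega> * h \<omega>)"
  have bh: "bh \<in> L2 \<mu>" "integrable \<mu> bh"
    unfolding bh_def by (auto intro!: cyl_fun_mult_L2[OF assms(1)] L2 L2_integrable)
  define r where "r = (\<lambda>\<omega>. b \<omega> * (f \<omega> - E n f \<omega>))"
  have r: "integrable \<mu> r"
    unfolding r_def by (intro L2_integrable cyl_fun_mult_L2[OF assms(1)] L2_diff L2 E_L2)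
  define S where "S = (\<lambda>\<omega>. \<Sum>y\<in>below n. of_real (eig y) * P y bh \<omega>)"
  have S: "integrable \<mu> S"
    unfolding S_def by (intro Bochner_Integration.integrable_sum integrable_mult_right P_integrable)
  \<comment> \<open>As \<open>f\<close> has mean 0, truncating the Dirac operator at length
    \<open>n\<close> gives \<open>E n f\<close>. Hence the second half of \<open>comm\<close>
    removes \<open>b * E n f\<close> from \<open>b * f\<close> and leaves \<open>r\<close>.\<close>
  have "(\<Sum>y\<in>below n. of_real (eig y) * P y h \<omega>) = E n f \<omega>" for \<omega>
  proof -
    have "(\<Sum>y\<in>below n. of_real (eig y) * P y h \<omega>) = (\<Sum>y\<in>below n. P y f \<omega>)"
      using below_nodes dirac_graph_diff[OF assms(2)]
      by (intro sum.cong refl P_eq_of_diff[symmetric]) auto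
    then show ?thesis
      using dirac_graph_Nil[OF assms(2)] by (simp add: sum_P_below E_def)
  qed
  then have eq: "(\<lambda>\<omega>. b \<omega> * f \<omega> + comm n b h \<omega>) = (\<lambda>\<omega>. r \<omega> + S \<omega>)"
    by (simp add: comm_def r_def S_def bh_def fun_eq_iff right_diff_distrib sum_subtractf
        mult.left_commute[of _ "b _"] flip: sum_distrib_left)
  have r_low: "av w r = 0" if "w \<in> nodes" "length w \<le> n" for w
  proof -
    have "cyl_fun n (\<lambda>\<omega>. indicator (cyl w) \<omega> * b \<omega>)"
      by (intro cyl_fun_mult cyl_fun_indicator assms that)
    moreover have "av v (\<lambda>\<omega>. f \<omega> - E n f \<omega>) = 0" if "v \<in> level n" for v
      using av_E_above[OF int level_node[OF that], of n]
      by (simp add: av_diff int E_integrable level_length[OF that])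
    ultimately have "(\<integral>\<omega>. (indicator (cyl w) \<omega> * b \<omega>) * (f \<omega> - E n f \<omega>) \<partial>\<mu>) = 0"
      by (intro integral_cyl_fun_zero Bochner_Integration.integrable_diff int E_integrable)
    then have "cyl_int w r = 0"
      by (simp only: cyl_int_def r_def mult.assoc)
    then show ?thesis
      by (simp add: av_def)
  qed
  have "(bh, (\<lambda>\<omega>. r \<omega> + S \<omega>)) \<in> dirac_graph"
  proof (rule dirac_graphI[OF bh(1)])
    show "(\<lambda>\<omega>. r \<omega> + S \<omega>) \<in> L2 \<mu>"
      unfolding eq[symmetric]
      by (intro L2_add cyl_fun_mult_L2[OF assms(1)] comm_L2[OF assms(1)] L2)
    have "av [] S = 0"
      unfolding S_def by (rule av_Nil_sum_P[OF bh(2) below_nodes])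
    then show "av [] (\<lambda>\<omega>. r \<omega> + S \<omega>) = 0"
      using r_low[of "[]"] by (simp add: av_add r S)
    fix w i assume wi: "w @ [i] \<in> adm"
    have nodes: "w \<in> nodes" "w @ [i] \<in> nodes"
      using wi butlast_node by auto
    have S_diff: "av (w @ [i]) S - av w S
        = (if w \<in> below n then of_real (eig w) * (av (w @ [i]) bh - av w bh) else 0)"
      unfolding S_def by (rule diff_sum_P[OF bh(2) wi finite_below below_nodes])
    have "av (w @ [i]) r - av w r
        = (if w \<in> below n then 0 else of_real (eig w) * (av (w @ [i]) bh - av w bh))"
    proof (cases "length w < n")
      case True
      then show ?thesis
        using r_low[OF nodes(1)] r_low[OF nodes(2)] nodes(1) by (simp add: below_def)
    next
      case False
      \<comment> \<open>From length \<open>n\<close> on, \<open>b\<close> is constant on the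
        cylinder and can be pulled out of the averages.\<close>
      define \<beta> where "\<beta> = value_on w b"
      have b: "b \<omega> = \<beta>" if "\<omega> \<in> cyl w" for \<omega>
        unfolding \<beta>_def using cyl_fun_value[OF assms(1) that] False by simp
      have b': "b \<omega> = \<beta>" if "\<omega> \<in> cyl (w @ [i])" for \<omega>
        using that cyl_children[of w] wi by (intro b) (auto simp: children_def)
      have av_b: "av w (\<lambda>\<omega>. b \<omega> * k \<omega>) = \<beta> * av w k"
        "av (w @ [i]) (\<lambda>\<omega>. b \<omega> * k \<omega>) = \<beta> * av (w @ [i]) k" for k
        by (rule av_mult_const, rule b, assumption) (rule av_mult_const, rule b', assumption)
      have "av (w @ [i]) r - av w r
          = \<beta> * ((av (w @ [i]) f - av w f) - (av (w @ [i]) (E n f) - av w (E n f)))"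
        unfolding r_def av_b by (simp add: av_diff int E_integrable algebra_simps)
      also have "\<dots> = of_real (eig w) * (\<beta> * (av (w @ [i]) h - av w h))"
        using False unfolding diff_E[OF int wi] dirac_graph_diff[OF assms(2) wi]
        by (simp add: below_def)
      also have "\<beta> * (av (w @ [i]) h - av w h) = av (w @ [i]) bh - av w bh"
        unfolding bh_def av_b by (simp add: right_diff_distrib)
      finally show ?thesis
        using False by (simp add: below_def)
    qed
    then show "av (w @ [i]) (\<lambda>\<omega>. r \<omega> + S \<omega>) - av w (\<lambda>\<omega>. r \<omega> + S \<omega>)
        = of_real (eig w) * (av (w @ [i]) bh - av w bh)"
      using S_diff by (simp add: av_add r S add_diff_add split: if_splits)
  qed
  then show ?thesis
    unfolding eq by (simp add: bh_def)
qed

lemma eig_nonneg: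
  assumes "w \<in> nodes"
  shows "0 \<le> eig w"
proof (cases "w = []")
  case False
  then have "n_succ l A w = card (children w)" "card (children w) \<ge> 1"
    using assms children_nonempty[OF assms] by (auto simp: n_succ_adm Suc_le_eq card_gt_0_iff)
  then show ?thesis
    by (simp add: eig_def)
qed (simp add: eig_def)

text \<open>A finite sum of operators, each bounded pointwise in terms of the norm; on a probability
  space a uniform bound is a bound in mean square.\<close>

lemma bounded_operator_comm:
  assumes "cyl_fun n b"
  obtains c where "c > 0" "bounded_operator \<mu> c (comm n b)"
proof -
  obtain B where B: "0 \<le> B" "\<And>\<omega>. cmod (b \<omega>) \<le> B"
    using cyl_fun_bounded[OF assms] by metis
  \<comment> \<open>The factor \<open>2\<close> of \<open>cmod_P_le\<close> and the bound
    \<open>B\<close> for \<open>b\<close> enter for both terms of the difference. The summand 1 in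
    \<open>c\<close> makes \<open>c\<close> positive, so that one can divide by it.\<close>
  define d where "d y = eig y * (4 * B / sqrt (\<kappa> * mass y))" for y
  define c where "c = (\<Sum>y\<in>below n. d y) + 1"
  have d: "0 \<le> d y" if "y \<in> below n" for y
    unfolding d_def using that eig_nonneg[of y] B(1) kappa_pos below_nodes[of n] by auto
  then have c: "c > 0"
    unfolding c_def by (simp add: sum_nonneg add_nonneg_pos)
  have bound: "cmod (comm n b h \<omega>) \<le> c * L2_norm \<mu> h" if h: "h \<in> L2 \<mu>" for h \<omega>
  proof -
    have bh: "L2_norm \<mu> (\<lambda>\<omega>. b \<omega> * h \<omega>) \<le> B * L2_norm \<mu> h"
      using B L2_measurable[OF cyl_fun_mult_L2[OF assms h]]
      by (intro L2_dominated(2)[OF h]) (auto simp: norm_mult intro!: mult_right_mono)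
    have summand: "cmod (of_real (eig y) * (P y (\<lambda>\<omega>. b \<omega> * h \<omega>) \<omega> - b \<omega> * P y h \<omega>)) \<le> d y * L2_norm \<mu> h"
      if "y \<in> below n" for y
    proof -
      let ?s = "sqrt (\<kappa> * mass y)"
      have "0 \<le> ?s"
        using kappa_pos by simp
      have "cmod (P y (\<lambda>\<omega>. b \<omega> * h \<omega>) \<omega> - b \<omega> * P y h \<omega>)
          \<le> cmod (P y (\<lambda>\<omega>. b \<omega> * h \<omega>) \<omega>) + cmod (b \<omega>) * cmod (P y h \<omega>)"
        by (metis norm_mult norm_triangle_ineq4)
      also have "\<dots> \<le> 2 * (B * L2_norm \<mu> h) / ?s + B * (2 * L2_norm \<mu> h / ?s)"
      proof (rule add_mono)
        show "cmod (P y (\<lambda>\<omega>. b \<omega> * h \<omega>) \<omega>) \<le> 2 * (B * L2_norm \<mu> h) / ?s"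
          using order_trans[OF cmod_P_le[OF cyl_fun_mult_L2[OF assms h]]
              divide_right_mono[OF mult_left_mono[OF bh]]] \<open>0 \<le> ?s\<close> by force
        show "cmod (b \<omega>) * cmod (P y h \<omega>) \<le> B * (2 * L2_norm \<mu> h / ?s)"
          by (intro mult_mono B cmod_P_le h) auto
      qed
      also have "\<dots> = 4 * B / ?s * L2_norm \<mu> h"
        by simp
      finally have le: "cmod (P y (\<lambda>\<omega>. b \<omega> * h \<omega>) \<omega> - b \<omega> * P y h \<omega>) \<le> 4 * B / ?s * L2_norm \<mu> h" .
      have "0 \<le> eig y"
        using eig_nonneg that below_nodes by blast
      from mult_left_mono[OF le this] this show ?thesis
        by (simp add: norm_mult d_def mult.assoc)
    qed
    have "cmod (comm n b h \<omega>) \<le> (\<Sum>y\<in>below n. d y * L2_norm \<mu> h)"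
      unfolding comm_def by (rule sum_norm_le) (rule summand)
    also have "\<dots> \<le> c * L2_norm \<mu> h"
      by (simp add: c_def distrib_right flip: sum_distrib_right)
    finally show ?thesis .
  qed
  have "bounded_operator \<mu> c (comm n b)"
    unfolding bounded_operator_def
  proof (intro conjI ballI allI AE_I2)
    fix f assume f: "f \<in> L2 \<mu>"
    show "comm n b f \<in> L2 \<mu>"
      by (rule comm_L2[OF assms f])
    show "L2_norm \<mu> (comm n b f) \<le> c * L2_norm \<mu> f"
      using c by (intro L2_bounded(2) bound f L2_measurable comm_L2[OF assms f]) simp
    show "comm n b (\<lambda>y. z * f y) x = z * comm n b f x" for z x
      unfolding comm_def sum_distrib_left
      by (intro sum.cong refl) (simp add: P_scale mult.left_commute[of _ z] algebra_simps)
    fix g x assume g: "g \<in> L2 \<mu>"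
    show "comm n b (\<lambda>y. f y + g y) x = comm n b f x + comm n b g x"
      unfolding comm_def sum.distrib[symmetric] distrib_left
      using f g
      by (intro sum.cong refl) (simp add: P_add L2_integrable cyl_fun_mult_L2[OF assms] algebra_simps)
  qed
  then show ?thesis
    using that c by blast
qed

lemma Domain_commutator_cyl_fun:
  assumes "cyl_fun n b"
  shows "Domain (commutator dirac_graph mult_rep b) = Domain dirac_graph"
proof -
  have "h \<in> Domain (commutator dirac_graph mult_rep b)" if "(h, f) \<in> dirac_graph" for h f
    using that dirac_graph_mult[OF assms that] unfolding commutator_def mult_rep_def by blast
  then show ?thesis
    unfolding commutator_def by blast
qed

lemma densely_defined_commutator:
  assumes "cyl_fun n b"
  shows "densely_defined \<mu> (commutator dirac_graph mult_rep b)"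
  using densely_defined_dirac_graph
  by (simp add: densely_defined_def Domain_commutator_cyl_fun[OF assms])

lemma extends_boundedly_commutator:
  assumes "cyl_fun n b" "bounded_operator \<mu> c (comm n b)"
  shows "extends_boundedly \<mu> c (commutator dirac_graph mult_rep b)"
  unfolding extends_boundedly_def
proof (intro exI conjI)
  have "AE x in \<mu>. comm n b h x = g' x - b x * g x"
    if "(h, g) \<in> dirac_graph" "((\<lambda>x. b x * h x), g') \<in> dirac_graph" for h g g'
    using dirac_graph_unique[OF dirac_graph_mult[OF assms(1) that(1)] that(2)]
    by (rule AE_mp) (auto intro!: AE_I2 simp: algebra_simps)
  then show "\<forall>(h, f)\<in>commutator dirac_graph mult_rep b. AE x in \<mu>. comm n b h x = f x"
    by (auto simp: commutator_def mult_rep_def)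
qed (rule assms(2))

lemma comm_scale: "comm n (\<lambda>x. z * b x) h \<omega> = z * comm n b h \<omega>"
  unfolding comm_def sum_distrib_left
  by (intro sum.cong refl) (simp add: P_scale mult.assoc algebra_simps)

lemma scaled_cyl_fun_unit_ball:
  assumes "cyl_fun n b"
  obtains c :: real where "c > 0"
    "densely_defined \<mu> (commutator dirac_graph mult_rep (\<lambda>x. of_real c * b x))"
    "extends_boundedly \<mu> 1 (commutator dirac_graph mult_rep (\<lambda>x. of_real c * b x))"
proof -
  obtain c where c: "c > 0" "bounded_operator \<mu> c (comm n b)"
    using bounded_operator_comm[OF assms] by metis
  let ?b = "\<lambda>x. of_real (1 / c) * b x"
  have b: "cyl_fun n ?b"
    by (rule cyl_fun_scale[OF assms])
  have eq: "comm n ?b h = (\<lambda>x. of_real (1 / c) * comm n b h x)" for h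
    by (rule ext) (rule comm_scale)
  have "bounded_operator \<mu> 1 (comm n ?b)"
    unfolding bounded_operator_def
  proof (intro conjI ballI allI)
    fix f assume f: "f \<in> L2 \<mu>"
    have cf: "comm n b f \<in> L2 \<mu>" "L2_norm \<mu> (comm n b f) \<le> c * L2_norm \<mu> f"
      using c(2) f by (auto simp: bounded_operator_def)
    show "comm n ?b f \<in> L2 \<mu>"
      unfolding eq by (rule L2_scale(1)[OF cf(1)])
    show "L2_norm \<mu> (comm n ?b f) \<le> 1 * L2_norm \<mu> f"
      unfolding eq L2_scale(2)[OF cf(1)] using cf(2) c(1) by (simp add: norm_divide field_simps)
    show "AE x in \<mu>. comm n ?b (\<lambda>y. z * f y) x = z * comm n ?b f x" for z
    proof -
      have "AE x in \<mu>. comm n b (\<lambda>y. z * f y) x = z * comm n b f x"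
        using c(2) f by (simp add: bounded_operator_def)
      then show ?thesis
        unfolding eq by (rule AE_mp) (auto intro!: AE_I2)
    qed
    fix g assume g: "g \<in> L2 \<mu>"
    have "AE x in \<mu>. comm n b (\<lambda>y. f y + g y) x = comm n b f x + comm n b g x"
      using c(2) f g by (simp add: bounded_operator_def)
    then show "AE x in \<mu>. comm n ?b (\<lambda>y. f y + g y) x = comm n ?b f x + comm n ?b g x"
      unfolding eq by (rule AE_mp) (auto intro!: AE_I2 simp: add_divide_distrib)
  qed
  then show ?thesis
    using that[of "1 / c"] c(1) densely_defined_commutator[OF b] extends_boundedly_commutator[OF b]
    by simp
qed

section \<open>Decay of the masses of cylinders\<close>

text \<open>The root has at least two children, each of mass at least \<open>\<kappa>\<close>, and
  their masses add up to 1.\<close>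

lemma kappa_le_half: "2 * \<kappa> \<le> 1"
proof -
  have "real l * \<kappa> = (\<Sum>i\<in>children []. \<kappa>)"
    by (simp add: children_Nil)
  also have "\<dots> \<le> (\<Sum>i\<in>children []. mass ([] @ [i]))"
    by (intro sum_mono) (use kappa_mass_child[of _ "[]"] in simp)
  also have "\<dots> = 1"
    by (simp only: mass_children mass_Nil)
  finally have "real l * \<kappa> \<le> 1" .
  moreover have "2 * \<kappa> \<le> real l * \<kappa>"
    using two_letters kappa_pos by (intro mult_right_mono) auto
  ultimately show ?thesis
    by linarith
qed

lemma letter_in_alphabet: "\<omega> \<in> X \<Longrightarrow> \<omega> k \<in> {1..l}"
  by (simp add: shift_space_def)

lemma children_prefix_of_Suc:
  assumes "\<omega> \<in> X"
  shows "children (prefix_of (Suc k) \<omega>) = {j \<in> {1..l}. A (\<omega> k) j = 1}"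
  using children_adm[OF prefix_of_adm[OF assms, of "Suc k"]]
  by (simp add: successors_def prefix_of_Suc)

text \<open>
  A window of \<open>l + 1\<close> letters without branching closes up to a cycle from which no other letter can be
  reached, so that irreducibility makes \<open>A\<close> a cyclic permutation, which aperiodicity excludes.
\<close>

lemma branching_within:
  assumes "\<omega> \<in> X"
  obtains k where "n \<le> k" "k \<le> n + l" "card (children (prefix_of (Suc k) \<omega>)) \<ge> 2"
proof (rule ccontr)
  assume no: "\<not> thesis"
  note found = that
  have small: "card (children (prefix_of (Suc k) \<omega>)) \<le> 1" if k: "n \<le> k" "k \<le> n + l" for k
  proof (rule ccontr)
    assume "\<not> ?thesis"
    then have "card (children (prefix_of (Suc k) \<omega>)) \<ge> 2"
      by simp
    from found[OF k this] no show False
      by blast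
  qed
  have unique: "j = \<omega> (Suc k)" if k: "n \<le> k" "k \<le> n + l" and j: "j \<in> {1..l}" "A (\<omega> k) j = 1" for j k
  proof -
    have "j \<in> children (prefix_of (Suc k) \<omega>)" "\<omega> (Suc k) \<in> children (prefix_of (Suc k) \<omega>)"
      using j children_prefix_of[OF assms, of "Suc k"] children_prefix_of_Suc[OF assms, of k] by auto
    then show ?thesis
      using small[OF k] card_le_Suc0_iff_eq[OF finite_children] by auto
  qed
  \<comment> \<open>Pigeonhole: \<open>l + 1\<close> positions, but \<open>l\<close>
    letters.\<close>
  have "card (\<omega> ` {n..n + l}) \<le> card {1..l}"
    using letter_in_alphabet[OF assms] by (intro card_mono) auto
  then have "\<not> inj_on \<omega> {n..n + l}"
    by (intro notI) (simp add: card_image)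
  then obtain a b where ab: "n \<le> a" "a < b" "b \<le> n + l" "\<omega> a = \<omega> b"
    unfolding inj_on_def by (metis atLeastAtMost_iff linorder_neqE_nat)
  define p where "p = (LEAST p. p \<ge> 1 \<and> \<omega> (a + p) = \<omega> a)"
  have ex: "b - a \<ge> 1 \<and> \<omega> (a + (b - a)) = \<omega> a"
    using ab by simp
  have p: "p \<ge> 1" "\<omega> (a + p) = \<omega> a"
    using LeastI[of "\<lambda>p. p \<ge> 1 \<and> \<omega> (a + p) = \<omega> a", OF ex] by (auto simp: p_def)
  have p_min: "\<omega> (a + q) \<noteq> \<omega> a" if "q \<ge> 1" "q < p" for q
    using not_less_Least[of q "\<lambda>p. p \<ge> 1 \<and> \<omega> (a + p) = \<omega> a"] that by (auto simp: p_def)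
  have p_le: "a + p \<le> n + l"
    using Least_le[of "\<lambda>p. p \<ge> 1 \<and> \<omega> (a + p) = \<omega> a", OF ex] ab by (simp add: p_def)
  \<comment> \<open>Without branching a path from \<open>\<omega> a\<close> is forced to run around
    the cycle of length \<open>p\<close>, so its end is determined by its length modulo
    \<open>p\<close>.\<close>
  have reach: "j = \<omega> (a + m mod p)" if "letter_mat_pow l A m (\<omega> a) j > 0" "j \<in> {1..l}" for m j
    using that
  proof (induction m arbitrary: j)
    case 0
    then show ?case by (auto split: if_splits)
  next
    case (Suc m)
    have "(\<Sum>k=1..l. letter_mat_pow l A m (\<omega> a) k * A k j) \<noteq> 0"
      using Suc.prems(1) by (simp only: letter_mat_pow.simps)
    then obtain k where k: "k \<in> {1..l}" "letter_mat_pow l A m (\<omega> a) k * A k j > 0"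
      by (metis (no_types, lifting) gr0I sum.neutral)
    then have "k = \<omega> (a + m mod p)" "A k j = 1"
      using Suc.IH[of k] A01[OF k(1) Suc.prems(2)] by auto
    moreover have "m mod p < p"
      using p(1) by simp
    ultimately have "j = \<omega> (Suc (a + m mod p))"
      using Suc.prems(2) p_le ab(1) by (intro unique) auto
    then show ?case
      using p by (cases "Suc (m mod p) = p") (auto simp: mod_Suc simp flip: add_Suc_right)
  qed
  have i0: "\<omega> a \<in> {1..l}"
    by (rule letter_in_alphabet[OF assms])
  have "p dvd m" if "letter_mat_pow l A m (\<omega> a) (\<omega> a) > 0" for m
    using reach[OF that i0] p_min[of "m mod p"] p(1) by (cases "m mod p = 0") (auto simp: mod_eq_0_iff_dvd)
  then have "p dvd Gcd {m. m \<ge> 1 \<and> letter_mat_pow l A m (\<omega> a) (\<omega> a) > 0}"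
    by (intro Gcd_greatest) auto
  then have "p = 1"
    using aperiodic i0 unfolding aperiodic_mat_def by simp
  then have "j = \<omega> a" if "j \<in> {1..l}" for j
    using reach[of _ j] that i0 irreducible unfolding irreducible_mat_def by fastforce
  from this[of 1] this[of 2] show False
    using two_letters by simp
qed

text \<open>A sibling takes at least the fraction \<open>\<kappa>\<close> of the mass.\<close>

lemma mass_branching_child:
  assumes "card (children w) \<ge> 2" "i \<in> children w"
  shows "mass (w @ [i]) \<le> (1 - \<kappa>) * mass w"
proof -
  have "\<not> children w \<subseteq> {i}"
    using card_mono[of "{i}" "children w"] assms(1) by auto
  then obtain j where j: "j \<in> children w" "j \<noteq> i"
    by blast
  have "mass (w @ [i]) + mass (w @ [j]) = (\<Sum>k\<in>{i, j}. mass (w @ [k]))"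
    using j by simp
  also have "\<dots> \<le> (\<Sum>k\<in>children w. mass (w @ [k]))"
    by (intro sum_mono2) (use j assms in auto)
  finally show ?thesis
    using kappa_mass_child[OF j(1)] by (simp add: mass_children left_diff_distrib)
qed

lemma mass_prefix_antimono: "m \<le> n \<Longrightarrow> mass (prefix_of n \<omega>) \<le> mass (prefix_of m \<omega>)"
  by (metis append_take_drop_id mass_antimono min.absorb1 take_prefix_of)

text \<open>The branching word has length \<open>k + 1\<close> with \<open>k \<le> n + l\<close>.
  The loss of mass shows at its child, of length at most \<open>n + l + 2\<close>.\<close>

lemma mass_window:
  assumes "\<omega> \<in> X"
  shows "mass (prefix_of (n + (l + 2)) \<omega>) \<le> (1 - \<kappa>) * mass (prefix_of n \<omega>)"
proof -
  obtain k where k: "n \<le> k" "k \<le> n + l" "card (children (prefix_of (Suc k) \<omega>)) \<ge> 2"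
    using branching_within[OF assms] by blast
  have "mass (prefix_of (n + (l + 2)) \<omega>) \<le> mass (prefix_of (Suc (Suc k)) \<omega>)"
    using k by (intro mass_prefix_antimono) auto
  also have "\<dots> \<le> (1 - \<kappa>) * mass (prefix_of (Suc k) \<omega>)"
    unfolding prefix_of_Suc[of "Suc k"]
    by (intro mass_branching_child k(3) children_prefix_of assms)
  also have "\<dots> \<le> (1 - \<kappa>) * mass (prefix_of n \<omega>)"
    using k(1) kappa_le_half kappa_pos by (intro mult_left_mono mass_prefix_antimono) auto
  finally show ?thesis .
qed

text \<open>Square roots of masses are estimated because they are what Cauchy-Schwarz produces in
  the resolvent series.\<close>

lemma sqrt_mass_decay:
  obtains C \<rho> where "0 < C" "0 < \<rho>" "\<rho> < 1"
    "\<And>\<omega> n. \<omega> \<in> X \<Longrightarrow> sqrt (mass (prefix_of n \<omega>)) \<le> C * \<rho> ^ n"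
proof -
  define L where "L = l + 2"
  define r where "r = sqrt (1 - \<kappa>)"
  define \<rho> where "\<rho> = root L r"
  have r: "0 < r" "r < 1"
    using kappa_le_half kappa_pos by (auto simp: r_def)
  have L: "0 < L"
    by (simp add: L_def)
  have \<rho>: "0 < \<rho>" "\<rho> < 1" "\<rho> ^ L = r"
    using r L by (auto simp: \<rho>_def)
  have bound: "sqrt (mass (prefix_of n \<omega>)) \<le> (1 / r) * \<rho> ^ n" if "\<omega> \<in> X" for \<omega> n
  proof -
    have step: "sqrt (mass (prefix_of (L * j) \<omega>)) \<le> r ^ j" for j
    proof (induction j)
      case (Suc j)
      have "sqrt (mass (prefix_of (L * Suc j) \<omega>)) \<le> sqrt ((1 - \<kappa>) * mass (prefix_of (L * j) \<omega>))"
        using mass_window[OF that, of "L * j"] by (intro real_sqrt_le_mono) (simp add: L_def add.commute)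
      also have "\<dots> \<le> r * r ^ j"
        unfolding real_sqrt_mult r_def[symmetric] using Suc r by (intro mult_left_mono) auto
      finally show ?case by simp
    qed simp
    have "sqrt (mass (prefix_of n \<omega>)) \<le> sqrt (mass (prefix_of (L * (n div L)) \<omega>))"
      by (intro real_sqrt_le_mono mass_prefix_antimono) simp
    also have "\<dots> \<le> r ^ (n div L)"
      by (rule step)
    \<comment> \<open>The last, incomplete window contributes no decay; the factor
      \<open>1 / r\<close> pays for it.\<close>
    also have "\<dots> = (1 / r) * \<rho> ^ (L + L * (n div L))"
      using r(1) by (simp add: power_add power_mult \<rho>(3))
    also have "\<dots> \<le> (1 / r) * \<rho> ^ n"
    proof (intro mult_left_mono power_decreasing)
      have "n mod L < L" "L * (n div L) + n mod L = n"
        using L by auto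
      then show "n \<le> L + L * (n div L)"
        by linarith
    qed (use \<rho> r in auto)
    finally show ?thesis .
  qed
  show ?thesis
    using r by (intro that[OF _ \<rho>(1,2) bound]) auto
qed

section \<open>Lower bounds for the eigenvalues, and unboundedness\<close>

lemma eig_ge:
  assumes "w \<in> nodes" "w = [] \<or> card (children w) \<ge> 2"
  shows "1 / mass w \<le> eig w"
  using assms n_succ_adm[of w] by (auto simp: eig_def intro!: divide_right_mono)

text \<open>A word with a single child has the same cylinder as that child. The zero eigenvalue at
  such a word is therefore never felt.\<close>

lemma nonbranching_av:
  assumes "w \<in> nodes" "\<not> card (children w) \<ge> 2" "i \<in> children w"
  shows "av (w @ [i]) h = av w h"
proof -
  have "children w = {i}"
    using assms(2,3) card_le_Suc0_iff_eq[of "children w"] by auto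
  then have "cyl w = cyl (w @ [i])"
    using cyl_children[of w] by simp
  then show ?thesis
    by (simp add: av_def cyl_int_def)
qed

lemma unbounded_dirac_graph: "unbounded_graph \<mu> dirac_graph"
  unfolding unbounded_graph_def
proof
  assume "\<exists>c. \<forall>(h, f)\<in>dirac_graph. L2_norm \<mu> f \<le> c * L2_norm \<mu> h"
  then obtain c where c: "\<And>h f. (h, f) \<in> dirac_graph \<Longrightarrow> L2_norm \<mu> f \<le> c * L2_norm \<mu> h"
    by blast
  obtain \<omega> where \<omega>: "\<omega> \<in> X"
    using node_extends[of "[]"] by auto
  obtain C \<rho> where C: "0 < C" "0 < \<rho>" "\<rho> < 1"
    "\<And>\<omega> n. \<omega> \<in> X \<Longrightarrow> sqrt (mass (prefix_of n \<omega>)) \<le> C * \<rho> ^ n"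
    by (rule sqrt_mass_decay) (rule that, assumption+)
  have lim: "(\<lambda>n. C * \<rho> ^ n) \<longlonglongrightarrow> 0"
    using C by (intro tendsto_mult_right_zero LIMSEQ_realpow_zero) auto
  \<comment> \<open>If the square root of a mass is below this threshold, the reciprocal of the
    mass, hence the eigenvalue at a branching word, exceeds \<open>c\<close>.\<close>
  have "0 < 1 / sqrt (\<bar>c\<bar> + 1)"
    by (simp add: add_nonneg_pos)
  from order_tendstoD(2)[OF lim this] obtain n where n: "C * \<rho> ^ n < 1 / sqrt (\<bar>c\<bar> + 1)"
    unfolding eventually_sequentially by blast
  obtain k where k: "n \<le> k" "card (children (prefix_of (Suc k) \<omega>)) \<ge> 2"
    using branching_within[OF \<omega>, of n] by metis
  define w where "w = prefix_of (Suc k) \<omega>"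
  have w: "w \<in> nodes" "card (children w) \<ge> 2"
    using prefix_of_nodes[OF \<omega>] k(2) by (auto simp: w_def)
  have "sqrt (mass w) < 1 / sqrt (\<bar>c\<bar> + 1)"
  proof -
    have "sqrt (mass w) \<le> sqrt (mass (prefix_of n \<omega>))"
      unfolding w_def using k(1) by (intro real_sqrt_le_mono mass_prefix_antimono) auto
    then show ?thesis
      using C(4)[OF \<omega>, of n] n by linarith
  qed
  then have "sqrt (mass w) < sqrt (1 / (\<bar>c\<bar> + 1))"
    by (simp add: real_sqrt_divide)
  then have "\<bar>c\<bar> + 1 < 1 / mass w"
    using mass_pos[OF w(1)] by (simp add: field_simps)
  then have eig: "c < eig w"
    using eig_ge[OF w(1)] w(2) by linarith
  obtain i where i: "i \<in> children w"
    using children_nonempty[OF w(1)] by blast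
  define u :: "(nat \<Rightarrow> nat) \<Rightarrow> complex" where "u = indicator (cyl (w @ [i]))"
  have wi: "w @ [i] \<in> nodes" "w @ [i] \<in> adm"
    using i by (auto simp: children_def)
  have u: "u \<in> L2 \<mu>" "integrable \<mu> u"
    unfolding u_def by (auto intro!: L2_indicator L2_integrable)
  \<comment> \<open>The average of \<open>u\<close> is 1 over the child and less than 1 over
    \<open>w\<close>, since branching makes the child strictly lighter.\<close>
  have "L2_norm \<mu> (P w u) \<noteq> 0"
  proof
    assume "L2_norm \<mu> (P w u) = 0"
    then have "AE x in \<mu>. P w u x = 0"
      using L2_norm_eq_0_iff[OF P_L2] by blast
    then have "av (w @ [i]) (P w u) = av (w @ [i]) (\<lambda>_. 0)"
      by (intro av_cong_AE) (auto intro: L2_measurable[OF P_L2])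
    moreover have "av (w @ [i]) (P w u) = av (w @ [i]) u - av w u"
      by (subst av_P[OF u(2) wi(1) w(1)]) simp
    moreover have "av (w @ [i]) u = 1"
      by (rule av_const[OF wi(1)]) (simp add: u_def)
    moreover have "av w u = of_real (mass (w @ [i]) / mass w)"
    proof -
      have "cyl_int w u = cyl_int (w @ [i]) (\<lambda>_. 1)"
        unfolding cyl_int_def u_def
        by (intro Bochner_Integration.integral_cong)
          (use cyl_children[of w] i in \<open>auto simp: indicator_def\<close>)
      then show ?thesis
        by (simp add: av_def cyl_int_const)
    qed
    ultimately have "complex_of_real (mass (w @ [i]) / mass w) = of_real 1"
      by simp
    then have "mass (w @ [i]) / mass w = 1"
      unfolding of_real_eq_iff .
    moreover have "mass (w @ [i]) < mass w"
      using mass_branching_child[OF w(2) i] mult_pos_pos[OF kappa_pos mass_pos[OF w(1)]]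
      by (simp add: left_diff_distrib)
    ultimately show False
      by simp
  qed
  then have pos: "L2_norm \<mu> (P w u) > 0"
    by (simp add: order_le_neq_trans)
  have "\<bar>eig w\<bar> * L2_norm \<mu> (P w u) \<le> c * L2_norm \<mu> (P w u)"
    using c[OF dirac_graph_P[OF u(1) w(1)]] L2_scale(2)[OF P_L2, of "of_real (eig w)"] by simp
  then show False
    using pos eig by simp
qed

section \<open>The resolvent\<close>

text \<open>
  \<open>res\<close> inverts \<open>1 + D\<close>. The series converges uniformly because the terms decay like the square roots
  of the masses of the cylinders along a path.
\<close>

definition weight :: "nat list \<Rightarrow> complex" where
  "weight w = of_real (1 / (1 + eig w))"

definition res :: "((nat \<Rightarrow> nat) \<Rightarrow> complex) \<Rightarrow> (nat \<Rightarrow> nat) \<Rightarrow> complex" where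
  "res g \<omega> = indicator X \<omega> * (av [] g + (\<Sum>n. weight (prefix_of n \<omega>) *
     (av (prefix_of (Suc n) \<omega>) g - av (prefix_of n \<omega>) g)))"

definition res_sum :: "nat \<Rightarrow> ((nat \<Rightarrow> nat) \<Rightarrow> complex) \<Rightarrow> (nat \<Rightarrow> nat) \<Rightarrow> complex" where
  "res_sum n g \<omega> = av [] g * indicator X \<omega> + (\<Sum>y\<in>below n. weight y * P y g \<omega>)"

text \<open>At a branching word and at the root the weight is at most \<open>mass w\<close>, which
  outweighs the factor \<open>1 / sqrt (mass w)\<close> in the bound for increments. At the other
  words the weight is 1, but the increment vanishes.\<close>

lemma weight_bound:
  assumes "g \<in> L2 \<mu>" "w @ [i] \<in> adm"
  shows "cmod (weight w * (av (w @ [i]) g - av w g)) \<le> 2 / sqrt \<kappa> * sqrt (mass w) * L2_norm \<mu> g"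
proof (cases "w = [] \<or> card (children w) \<ge> 2")
  case True
  have w: "w \<in> nodes"
    using assms(2) butlast_node by auto
  have m: "0 < mass w"
    by (rule mass_pos[OF w])
  have "1 / mass w \<le> 1 + eig w"
    using eig_ge[OF w True] by simp
  then have "1 / (1 + eig w) \<le> mass w"
    using m eig_nonneg[OF w] by (simp add: field_simps)
  then have "cmod (weight w) \<le> mass w"
    using eig_nonneg[OF w] by (simp add: weight_def del: of_real_divide)
  then have "cmod (weight w * (av (w @ [i]) g - av w g)) \<le> mass w * (2 * L2_norm \<mu> g / sqrt (\<kappa> * mass w))"
    unfolding norm_mult by (intro mult_mono cmod_diff_le assms) (use m in auto)
  also have "\<dots> = 2 / sqrt \<kappa> * (mass w / sqrt (mass w)) * L2_norm \<mu> g"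
    by (simp add: real_sqrt_mult)
  also have "mass w / sqrt (mass w) = sqrt (mass w)"
    using m by (simp add: real_div_sqrt)
  finally show ?thesis .
next
  case False
  then show ?thesis
    using assms(2) butlast_node[OF assms(2)] nonbranching_av[of w i g] kappa_pos
    by (auto simp: children_def)
qed

lemma weight_bound_prefix:
  assumes "g \<in> L2 \<mu>" "\<omega> \<in> X"
  shows "cmod (weight (prefix_of n \<omega>) * (av (prefix_of (Suc n) \<omega>) g - av (prefix_of n \<omega>) g))
    \<le> 2 / sqrt \<kappa> * sqrt (mass (prefix_of n \<omega>)) * L2_norm \<mu> g"
  using weight_bound[OF assms(1), of "prefix_of n \<omega>" "\<omega> n"] children_prefix_of[OF assms(2), of n]
  by (simp add: prefix_of_Suc children_def)

lemma res_sum_eq: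
  assumes "\<omega> \<in> X"
  shows "res_sum n g \<omega> = av [] g + (\<Sum>m<n. weight (prefix_of m \<omega>) *
     (av (prefix_of (Suc m) \<omega>) g - av (prefix_of m \<omega>) g))"
  using assms by (simp add: res_sum_def sum_below_P)

lemma res_sum_outside: "\<omega> \<notin> X \<Longrightarrow> res_sum n g \<omega> = 0"
  by (simp add: res_sum_def P_outside)

lemma cyl_fun_res_sum: "cyl_fun n (res_sum n g)"
  unfolding res_sum_def
  by (intro cyl_fun_add cyl_fun_sum cyl_fun_scale cyl_fun_P cyl_fun_indicator[of "[]", simplified])
    (auto simp: below_def)

lemma res_terms_geometric:
  obtains D \<rho> :: real where "0 \<le> D" "0 < \<rho>" "\<rho> < 1"
    "\<And>g \<omega> n. g \<in> L2 \<mu> \<Longrightarrow> \<omega> \<in> X \<Longrightarrow> cmod (weight (prefix_of n \<omega>) *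
      (av (prefix_of (Suc n) \<omega>) g - av (prefix_of n \<omega>) g)) \<le> D * L2_norm \<mu> g * \<rho> ^ n"
proof -
  obtain C0 \<rho> where C0: "0 < C0" "0 < \<rho>" "\<rho> < 1"
    "\<And>\<omega> n. \<omega> \<in> X \<Longrightarrow> sqrt (mass (prefix_of n \<omega>)) \<le> C0 * \<rho> ^ n"
    by (rule sqrt_mass_decay) (rule that, assumption+)
  define D where "D = 2 / sqrt \<kappa> * C0"
  have D: "0 \<le> D"
    using C0 kappa_pos by (simp add: D_def)
  have t: "cmod (weight (prefix_of n \<omega>) * (av (prefix_of (Suc n) \<omega>) g - av (prefix_of n \<omega>) g))
      \<le> D * L2_norm \<mu> g * \<rho> ^ n" (is "?lhs \<le> _") if "g \<in> L2 \<mu>" "\<omega> \<in> X" for g \<omega> n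
  proof -
    have "?lhs \<le> 2 / sqrt \<kappa> * sqrt (mass (prefix_of n \<omega>)) * L2_norm \<mu> g"
      by (rule weight_bound_prefix[OF that])
    also have "\<dots> \<le> 2 / sqrt \<kappa> * (C0 * \<rho> ^ n) * L2_norm \<mu> g"
      using kappa_pos by (intro mult_right_mono mult_left_mono C0(4) that) auto
    finally show ?thesis
      by (simp add: D_def mult_ac)
  qed
  show ?thesis
    by (rule that[OF D C0(2,3) t])
qed

lemma res_summable:
  assumes "g \<in> L2 \<mu>" "\<omega> \<in> X"
  shows "summable (\<lambda>n. weight (prefix_of n \<omega>) *
    (av (prefix_of (Suc n) \<omega>) g - av (prefix_of n \<omega>) g))"
proof (rule res_terms_geometric)
  fix D \<rho> :: real
  assume D: "0 \<le> D" "0 < \<rho>" "\<rho> < 1"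
    and t: "\<And>g \<omega> n. g \<in> L2 \<mu> \<Longrightarrow> \<omega> \<in> X \<Longrightarrow> cmod (weight (prefix_of n \<omega>) *
      (av (prefix_of (Suc n) \<omega>) g - av (prefix_of n \<omega>) g)) \<le> D * L2_norm \<mu> g * \<rho> ^ n"
  have "summable (\<lambda>n. D * L2_norm \<mu> g * \<rho> ^ n)"
    using D by (intro summable_mult summable_geometric) auto
  then show ?thesis
    by (rule summable_comparison_test'[where N = 0]) (rule t[OF assms])
qed

text \<open>Both bounds hold at every point and are linear in the norm of \<open>g\<close>, with
  constants independent of \<open>g\<close>. They serve measurability, boundedness, the computation
  of averages and compactness alike.\<close>

lemma res_uniform:
  obtains e :: "nat \<Rightarrow> real" and C where "e \<longlonglongrightarrow> 0" "\<And>n. 0 \<le> e n" "0 \<le> C"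
    "\<And>g n \<omega>. g \<in> L2 \<mu> \<Longrightarrow> cmod (res g \<omega> - res_sum n g \<omega>) \<le> e n * L2_norm \<mu> g"
    "\<And>g \<omega>. g \<in> L2 \<mu> \<Longrightarrow> cmod (res g \<omega>) \<le> C * L2_norm \<mu> g"
proof -
  obtain D \<rho> :: real where C0: "0 \<le> D" "0 < \<rho>" "\<rho> < 1"
    and t': "\<And>g \<omega> n. g \<in> L2 \<mu> \<Longrightarrow> \<omega> \<in> X \<Longrightarrow> cmod (weight (prefix_of n \<omega>) *
      (av (prefix_of (Suc n) \<omega>) g - av (prefix_of n \<omega>) g)) \<le> D * L2_norm \<mu> g * \<rho> ^ n"
    by (rule res_terms_geometric) (rule that, assumption+)
  note D = C0(1)
  define t where "t g \<omega> n = weight (prefix_of n \<omega>) *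
     (av (prefix_of (Suc n) \<omega>) g - av (prefix_of n \<omega>) g)" for g \<omega> n
  have t: "cmod (t g \<omega> n) \<le> D * L2_norm \<mu> g * \<rho> ^ n" if "g \<in> L2 \<mu>" "\<omega> \<in> X" for g \<omega> n
    unfolding t_def by (rule t'[OF that])
  have geo: "summable (\<lambda>n. D * L2_norm \<mu> g * \<rho> ^ n)" for g
    using C0 by (intro summable_mult summable_geometric) auto
  have sum: "summable (t g \<omega>)" if "g \<in> L2 \<mu>" "\<omega> \<in> X" for g \<omega>
    unfolding t_def by (rule res_summable[OF that])
  have tail: "cmod (\<Sum>n. t g \<omega> (n + m)) \<le> D * \<rho> ^ m / (1 - \<rho>) * L2_norm \<mu> g"
    if "g \<in> L2 \<mu>" "\<omega> \<in> X" for g \<omega> m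
  proof -
    have s: "summable (\<lambda>n. D * L2_norm \<mu> g * \<rho> ^ (n + m))"
      by (subst summable_iff_shift) (rule geo)
    have "cmod (\<Sum>n. t g \<omega> (n + m)) \<le> (\<Sum>n. D * L2_norm \<mu> g * \<rho> ^ (n + m))"
      by (rule norm_suminf_le[OF t[OF that] s])
    also have "\<dots> = (\<Sum>n. (D * L2_norm \<mu> g * \<rho> ^ m) * \<rho> ^ n)"
      by (simp add: power_add mult_ac)
    also have "\<dots> = (D * L2_norm \<mu> g * \<rho> ^ m) * (1 / (1 - \<rho>))"
      using C0 by (subst suminf_mult) (auto intro: summable_geometric simp: suminf_geometric)
    finally show ?thesis
      by (simp add: mult_ac)
  qed
  show ?thesis
  proof (rule that[of "\<lambda>n. D * \<rho> ^ n / (1 - \<rho>)" "1 + D / (1 - \<rho>)"])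
    have "(\<lambda>n. D * \<rho> ^ n / (1 - \<rho>)) \<longlonglongrightarrow> D * 0 / (1 - \<rho>)"
      using C0 by (intro tendsto_intros LIMSEQ_realpow_zero) auto
    then show "(\<lambda>n. D * \<rho> ^ n / (1 - \<rho>)) \<longlonglongrightarrow> 0"
      by simp
    show "0 \<le> D * \<rho> ^ n / (1 - \<rho>)" for n
      using D C0 by simp
    show "0 \<le> 1 + D / (1 - \<rho>)"
      using D C0 by simp
    fix g :: "(nat \<Rightarrow> nat) \<Rightarrow> complex" and \<omega> :: "nat \<Rightarrow> nat" assume g: "g \<in> L2 \<mu>"
    show "cmod (res g \<omega> - res_sum n g \<omega>) \<le> D * \<rho> ^ n / (1 - \<rho>) * L2_norm \<mu> g" for n
    proof (cases "\<omega> \<in> X")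
      case True
      have "res g \<omega> = av [] g + suminf (t g \<omega>)" "res_sum n g \<omega> = av [] g + sum (t g \<omega>) {..<n}"
        using True by (simp_all add: res_def res_sum_eq t_def[abs_def])
      then have "res g \<omega> - res_sum n g \<omega> = (\<Sum>m. t g \<omega> (m + n))"
        using suminf_split_initial_segment[OF sum[OF g True], of n] by simp
      then show ?thesis
        using tail[OF g True] by simp
    next
      case False
      then show ?thesis
        using D C0 by (simp add: res_def res_sum_outside)
    qed
    show "cmod (res g \<omega>) \<le> (1 + D / (1 - \<rho>)) * L2_norm \<mu> g"
    proof (cases "\<omega> \<in> X")
      case True
      have "cmod (res g \<omega>) \<le> cmod (av [] g) + cmod (\<Sum>m. t g \<omega> (m + 0))"
        using True norm_triangle_ineq[of "av [] g" "\<Sum>m. t g \<omega> m"] by (simp add: res_def t_def)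
      also have "\<dots> \<le> L2_norm \<mu> g + D / (1 - \<rho>) * L2_norm \<mu> g"
        using cmod_av_le[OF g, of "[]"] tail[OF g True, of 0] by (intro add_mono) simp_all
      finally show ?thesis
        by (simp add: distrib_right)
    next
      case False
      then show ?thesis
        using D C0 by (simp add: res_def)
    qed
  qed
qed

lemma res_L2:
  assumes "g \<in> L2 \<mu>"
  shows "res g \<in> L2 \<mu>"
proof -
  obtain e :: "nat \<Rightarrow> real" and C where e: "e \<longlonglongrightarrow> 0" "\<And>n. 0 \<le> e n" "0 \<le> C"
    "\<And>g n \<omega>. g \<in> L2 \<mu> \<Longrightarrow> cmod (res g \<omega> - res_sum n g \<omega>) \<le> e n * L2_norm \<mu> g"
    "\<And>g \<omega>. g \<in> L2 \<mu> \<Longrightarrow> cmod (res g \<omega>) \<le> C * L2_norm \<mu> g"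
    by (rule res_uniform) (rule that, assumption+)
  have "(\<lambda>n. e n * L2_norm \<mu> g) \<longlonglongrightarrow> 0"
    using tendsto_mult[OF e(1) tendsto_const[of "L2_norm \<mu> g"]] by simp
  then have lim: "(\<lambda>n. res_sum n g \<omega>) \<longlonglongrightarrow> res g \<omega>" for \<omega>
    using Lim_null_comparison[of "\<lambda>n. res_sum n g \<omega> - res g \<omega>" "\<lambda>n. e n * L2_norm \<mu> g" sequentially]
      e(4)[OF assms, of \<omega>] LIM_zero_cancel by (auto simp: norm_minus_commute)
  have "res g \<in> borel_measurable \<mu>"
    by (rule borel_measurable_LIMSEQ_metric[OF cyl_fun_measurable[OF cyl_fun_res_sum] lim])
  then show ?thesis
    by (rule L2_bounded(1)[where C = "C * L2_norm \<mu> g"]) (use e assms in auto)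
qed

lemma av_res:
  assumes "g \<in> L2 \<mu>" "w \<in> nodes"
  shows "(\<lambda>n. av w (res_sum n g)) \<longlonglongrightarrow> av w (res g)"
proof -
  obtain e :: "nat \<Rightarrow> real" and C where e: "e \<longlonglongrightarrow> 0" "\<And>n. 0 \<le> e n" "0 \<le> C"
    "\<And>g n \<omega>. g \<in> L2 \<mu> \<Longrightarrow> cmod (res g \<omega> - res_sum n g \<omega>) \<le> e n * L2_norm \<mu> g"
    "\<And>g \<omega>. g \<in> L2 \<mu> \<Longrightarrow> cmod (res g \<omega>) \<le> C * L2_norm \<mu> g"
    by (rule res_uniform) (rule that, assumption+)
  have lim: "(\<lambda>n. e n * L2_norm \<mu> g) \<longlonglongrightarrow> 0"
    using tendsto_mult[OF e(1) tendsto_const[of "L2_norm \<mu> g"]] by simp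
  have "(\<lambda>n. L2_norm \<mu> (\<lambda>\<omega>. res_sum n g \<omega> - res g \<omega>)) \<longlonglongrightarrow> 0"
  proof (rule tendsto_sandwich[OF _ _ tendsto_const lim])
    have "L2_norm \<mu> (\<lambda>\<omega>. res_sum n g \<omega> - res g \<omega>) \<le> e n * L2_norm \<mu> g" for n
    proof (rule L2_bounded(2))
      show "(\<lambda>\<omega>. res_sum n g \<omega> - res g \<omega>) \<in> borel_measurable \<mu>"
        by (intro L2_measurable L2_diff cyl_fun_L2[OF cyl_fun_res_sum] res_L2 assms)
    qed (use e assms(1) in \<open>auto simp: norm_minus_commute\<close>)
    then show "\<forall>\<^sub>F n in sequentially. L2_norm \<mu> (\<lambda>\<omega>. res_sum n g \<omega> - res g \<omega>) \<le> e n * L2_norm \<mu> g"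
      by simp
  qed simp
  then show ?thesis
    by (rule tendsto_av[OF _ cyl_fun_L2[OF cyl_fun_res_sum] res_L2[OF assms(1)] assms(2)])
qed

text \<open>The increments of the partial sums become stationary once \<open>w\<close> is shorter
  than the truncation length.\<close>

lemma diff_res:
  assumes "g \<in> L2 \<mu>" "w @ [i] \<in> adm"
  shows "av (w @ [i]) (res g) - av w (res g) = weight w * (av (w @ [i]) g - av w g)"
proof -
  have nodes: "w \<in> nodes" "w @ [i] \<in> nodes"
    using assms(2) butlast_node by auto
  have int: "integrable \<mu> g"
    by (rule L2_integrable[OF assms(1)])
  have intX: "integrable \<mu> (\<lambda>\<omega>. av [] g * indicator X \<omega>)"
    by (intro L2_integrable L2_scale L2_indicator) (simp flip: cyl_Nil)
  have intS: "integrable \<mu> (\<lambda>\<omega>. \<Sum>y\<in>below n. weight y * P y g \<omega>)" for n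
    by (intro Bochner_Integration.integrable_sum integrable_mult_right P_integrable)
  have "av (w @ [i]) (res_sum n g) - av w (res_sum n g)
      = (if w \<in> below n then weight w * (av (w @ [i]) g - av w g) else 0)" for n
  proof -
    have "av v (res_sum n g) = av [] g + av v (\<lambda>\<omega>. \<Sum>y\<in>below n. weight y * P y g \<omega>)"
      if "v \<in> nodes" for v
      unfolding res_sum_def using av_indicator_X[OF that]
      by (simp add: av_add[OF intX intS] av_scale)
    then show ?thesis
      using diff_sum_P[OF int assms(2) finite_below[of n] below_nodes[of n], of weight] nodes by simp
  qed
  then have "\<forall>\<^sub>F n in sequentially. av (w @ [i]) (res_sum n g) - av w (res_sum n g)
      = weight w * (av (w @ [i]) g - av w g)"
    unfolding eventually_sequentially using nodes
    by (intro exI[of _ "Suc (length w)"]) (auto simp: below_def)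
  then have "(\<lambda>n. av (w @ [i]) (res_sum n g) - av w (res_sum n g))
      \<longlonglongrightarrow> weight w * (av (w @ [i]) g - av w g)"
    by (rule tendsto_eventually)
  moreover have "(\<lambda>n. av (w @ [i]) (res_sum n g) - av w (res_sum n g))
      \<longlonglongrightarrow> av (w @ [i]) (res g) - av w (res g)"
    by (intro tendsto_diff av_res assms(1) nodes)
  ultimately show ?thesis
    using LIMSEQ_unique by blast
qed

lemma av_Nil_res:
  assumes "g \<in> L2 \<mu>"
  shows "av [] (res g) = av [] g"
proof -
  have int: "integrable \<mu> g"
    by (rule L2_integrable[OF assms(1)])
  have intX: "integrable \<mu> (\<lambda>\<omega>. av [] g * indicator X \<omega>)"
    by (intro L2_integrable L2_scale L2_indicator) (simp flip: cyl_Nil)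
  have intS: "integrable \<mu> (\<lambda>\<omega>. \<Sum>y\<in>below n. weight y * P y g \<omega>)" for n
    by (intro Bochner_Integration.integrable_sum integrable_mult_right P_integrable)
  have "av [] (res_sum n g) = av [] g" for n
    unfolding res_sum_def using av_indicator_X[of "[]"] av_Nil_sum_P[OF int below_nodes[of n], of weight]
    by (simp add: av_add[OF intX intS] av_scale)
  then show ?thesis
    using av_res[OF assms, of "[]"] by (simp add: LIMSEQ_const_iff)
qed

lemma eig_weight: "w \<in> nodes \<Longrightarrow> of_real (eig w) * weight w = 1 - weight w"
proof -
  assume "w \<in> nodes"
  then have "1 + eig w \<noteq> 0"
    using eig_nonneg[of w] by linarith
  then have "eig w * (1 / (1 + eig w)) = 1 - 1 / (1 + eig w)"
    by (simp add: field_simps)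
  then show ?thesis
    unfolding weight_def by (metis of_real_1 of_real_diff of_real_mult)
qed

lemma res_add:
  assumes "f \<in> L2 \<mu>" "g \<in> L2 \<mu>"
  shows "res (\<lambda>x. f x + g x) \<omega> = res f \<omega> + res g \<omega>"
proof (cases "\<omega> \<in> X")
  case True
  have sum: "summable (\<lambda>n. weight (prefix_of n \<omega>) * (av (prefix_of (Suc n) \<omega>) k - av (prefix_of n \<omega>) k))"
    if "k \<in> L2 \<mu>" for k
    by (rule res_summable[OF that True])
  have "(\<Sum>n. weight (prefix_of n \<omega>) * (av (prefix_of (Suc n) \<omega>) (\<lambda>x. f x + g x) - av (prefix_of n \<omega>) (\<lambda>x. f x + g x)))
    = (\<Sum>n. weight (prefix_of n \<omega>) * (av (prefix_of (Suc n) \<omega>) f - av (prefix_of n \<omega>) f)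
      + weight (prefix_of n \<omega>) * (av (prefix_of (Suc n) \<omega>) g - av (prefix_of n \<omega>) g))"
    using assms by (intro arg_cong[where f = suminf] ext) (simp add: av_add L2_integrable algebra_simps)
  also have "\<dots> = (\<Sum>n. weight (prefix_of n \<omega>) * (av (prefix_of (Suc n) \<omega>) f - av (prefix_of n \<omega>) f))
      + (\<Sum>n. weight (prefix_of n \<omega>) * (av (prefix_of (Suc n) \<omega>) g - av (prefix_of n \<omega>) g))"
    by (intro suminf_add[symmetric] sum assms)
  finally show ?thesis
    using True assms by (simp add: res_def av_add L2_integrable)
qed (simp add: res_def)

lemma res_scale:
  assumes "f \<in> L2 \<mu>"
  shows "res (\<lambda>x. z * f x) \<omega> = z * res f \<omega>"
proof (cases "\<omega> \<in> X")
  case True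
  have sum: "summable (\<lambda>n. weight (prefix_of n \<omega>) * (av (prefix_of (Suc n) \<omega>) f - av (prefix_of n \<omega>) f))"
    by (rule res_summable[OF assms True])
  have "(\<Sum>n. weight (prefix_of n \<omega>) * (av (prefix_of (Suc n) \<omega>) (\<lambda>x. z * f x) - av (prefix_of n \<omega>) (\<lambda>x. z * f x)))
    = (\<Sum>n. z * (weight (prefix_of n \<omega>) * (av (prefix_of (Suc n) \<omega>) f - av (prefix_of n \<omega>) f)))"
    by (intro arg_cong[where f = suminf] ext) (simp add: av_scale algebra_simps)
  also have "\<dots> = z * (\<Sum>n. weight (prefix_of n \<omega>) * (av (prefix_of (Suc n) \<omega>) f - av (prefix_of n \<omega>) f))"
    by (rule suminf_mult[OF sum])
  finally show ?thesis
    using True by (simp add: res_def av_scale distrib_left)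
qed (simp add: res_def)

lemma bounded_operator_res: "\<exists>c. bounded_operator \<mu> c res"
proof -
  obtain e :: "nat \<Rightarrow> real" and C where e: "e \<longlonglongrightarrow> 0" "\<And>n. 0 \<le> e n" "0 \<le> C"
    "\<And>g n \<omega>. g \<in> L2 \<mu> \<Longrightarrow> cmod (res g \<omega> - res_sum n g \<omega>) \<le> e n * L2_norm \<mu> g"
    "\<And>g \<omega>. g \<in> L2 \<mu> \<Longrightarrow> cmod (res g \<omega>) \<le> C * L2_norm \<mu> g"
    by (rule res_uniform) (rule that, assumption+)
  have "L2_norm \<mu> (res f) \<le> C * L2_norm \<mu> f" if "f \<in> L2 \<mu>" for f
    using e that by (intro L2_bounded(2) L2_measurable res_L2) auto
  then show ?thesis
    unfolding bounded_operator_def by (intro exI[of _ C]) (auto simp: res_L2 res_add res_scale)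
qed

text \<open>The eigenvalues are non-negative, so \<open>1 + D\<close> is inverted by dividing each
  increment by 1 plus the eigenvalue. The mean is left alone because \<open>D\<close> annihilates
  constants. Averages determine functions almost everywhere.\<close>

lemma resolvent_dirac_graph: "resolvent_at \<mu> dirac_graph (-1) res"
  unfolding resolvent_at_def
proof (intro conjI ballI bounded_operator_res)
  fix g assume g: "g \<in> L2 \<mu>"
  have int: "integrable \<mu> g" "integrable \<mu> (res g)"
    using g res_L2[OF g] by (auto intro: L2_integrable)
  have "(res g, (\<lambda>x. g x - res g x)) \<in> dirac_graph"
  proof (rule dirac_graphI)
    fix w i assume wi: "w @ [i] \<in> adm"
    have "av (w @ [i]) (\<lambda>x. g x - res g x) - av w (\<lambda>x. g x - res g x)
        = (av (w @ [i]) g - av w g) - (av (w @ [i]) (res g) - av w (res g))"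
      by (simp add: av_diff int)
    also have "\<dots> = (1 - weight w) * (av (w @ [i]) g - av w g)"
      unfolding diff_res[OF g wi] by (simp add: left_diff_distrib)
    also have "\<dots> = of_real (eig w) * (av (w @ [i]) (res g) - av w (res g))"
      unfolding diff_res[OF g wi] using eig_weight[OF butlast_node[OF wi]]
      by (simp flip: mult.assoc)
    finally show "av (w @ [i]) (\<lambda>x. g x - res g x) - av w (\<lambda>x. g x - res g x)
        = of_real (eig w) * (av (w @ [i]) (res g) - av w (res g))" .
  qed (use g int in \<open>simp_all add: res_L2 L2_diff av_diff av_Nil_res\<close>)
  then show "(res g, (\<lambda>x. g x + - 1 * res g x)) \<in> dirac_graph"
    by simp
next
  have "AE x in \<mu>. res (\<lambda>y. f y + h y) x = h x" if hf: "(h, f) \<in> dirac_graph" for h f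
  proof -
    have L2: "h \<in> L2 \<mu>" "f \<in> L2 \<mu>"
      using dirac_graph_L2[OF hf] by auto
    have fh: "(\<lambda>y. f y + h y) \<in> L2 \<mu>"
      by (intro L2_add L2)
    have "av w (res (\<lambda>y. f y + h y)) = av w h" if "w \<in> nodes" for w
    proof (rule av_eq_of_diff_eq[OF _ _ that])
      show "av [] (res (\<lambda>y. f y + h y)) = av [] h"
        using dirac_graph_Nil[OF hf] L2 by (simp add: av_Nil_res[OF fh] av_add L2_integrable)
      fix w i assume wi: "w @ [i] \<in> adm"
      have "av (w @ [i]) (res (\<lambda>y. f y + h y)) - av w (res (\<lambda>y. f y + h y))
          = weight w * ((av (w @ [i]) f - av w f) + (av (w @ [i]) h - av w h))"
        unfolding diff_res[OF fh wi] using L2 by (simp add: av_add L2_integrable)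
      also have "\<dots> = (weight w + of_real (eig w) * weight w) * (av (w @ [i]) h - av w h)"
        unfolding dirac_graph_diff[OF hf wi] by (simp add: algebra_simps)
      finally show "av (w @ [i]) (res (\<lambda>y. f y + h y)) - av w (res (\<lambda>y. f y + h y))
          = av (w @ [i]) h - av w h"
        by (simp add: eig_weight[OF butlast_node[OF wi]])
    qed
    then show ?thesis
      using L2 fh by (intro av_eq_AE L2_integrable res_L2)
  qed
  then show "case p of (h, f) \<Rightarrow> AE x in \<mu>. res (\<lambda>y. f y - - 1 * h y) x = h x"
    if "p \<in> dirac_graph" for p
    using that by (cases p) simp
qed

text \<open>A diagonal subsequence makes all averages converge, hence all partial sums
  \<open>res_sum m\<close> at every point. The uniform tail bound transfers this to
  \<open>res\<close>, and dominated convergence gives mean square.\<close>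

lemma compact_res: "compact_operator \<mu> res"
  unfolding compact_operator_def
proof (intro conjI allI impI bounded_operator_res)
  fix h :: "nat \<Rightarrow> (nat \<Rightarrow> nat) \<Rightarrow> complex"
  assume "\<forall>n. h n \<in> L2 \<mu> \<and> L2_norm \<mu> (h n) \<le> 1"
  then have h: "\<And>n. h n \<in> L2 \<mu>" "\<And>n. L2_norm \<mu> (h n) \<le> 1"
    by auto
  obtain e :: "nat \<Rightarrow> real" and C where e: "e \<longlonglongrightarrow> 0" "\<And>n. 0 \<le> e n" "0 \<le> C"
    "\<And>g n \<omega>. g \<in> L2 \<mu> \<Longrightarrow> cmod (res g \<omega> - res_sum n g \<omega>) \<le> e n * L2_norm \<mu> g"
    "\<And>g \<omega>. g \<in> L2 \<mu> \<Longrightarrow> cmod (res g \<omega>) \<le> C * L2_norm \<mu> g"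
    by (rule res_uniform) (rule that, assumption+)
  have countable: "countable nodes"
    by simp
  \<comment> \<open>The factor \<open>sqrt (mass w)\<close> provides one bound for all words, as the
    extraction of the subsequence requires; it is divided out again below.\<close>
  have bounded: "norm (of_real (sqrt (mass w)) * av w (h n)) \<le> 1" if "w \<in> nodes" for n w
  proof -
    have "sqrt (mass w) * cmod (av w (h n)) \<le> sqrt (mass w) * (L2_norm \<mu> (h n) / sqrt (mass w))"
      by (intro mult_left_mono cmod_av_le h that) auto
    then show ?thesis
      using mass_pos[OF that] h(2)[of n] by (simp add: norm_mult)
  qed
  obtain r :: "nat \<Rightarrow> nat" where r: "strict_mono r"
    "\<And>w. w \<in> nodes \<Longrightarrow> \<exists>x. (\<lambda>n. complex_of_real (sqrt (mass w)) * av w (h (r n))) \<longlonglongrightarrow> x"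
    by (rule function_convergent_subsequence[OF countable bounded]) (assumption, rule that, assumption+)
  have "\<exists>x. (\<lambda>n. av w (h (r n))) \<longlonglongrightarrow> x" if w: "w \<in> nodes" for w
  proof -
    obtain x where "(\<lambda>n. complex_of_real (sqrt (mass w)) * av w (h (r n))) \<longlonglongrightarrow> x"
      using r(2)[OF w] by blast
    from tendsto_mult[OF tendsto_const[of "complex_of_real (1 / sqrt (mass w))"] this]
    show ?thesis
      using mass_pos[OF w] by (auto simp flip: mult.assoc of_real_mult)
  qed
  then obtain c where c: "\<And>w. w \<in> nodes \<Longrightarrow> (\<lambda>n. av w (h (r n))) \<longlonglongrightarrow> c w"
    by metis
  define f where "f \<omega> = lim (\<lambda>n. res (h (r n)) \<omega>)" for \<omega>
  have res_sum_conv: "\<exists>x. (\<lambda>n. res_sum m (h (r n)) \<omega>) \<longlonglongrightarrow> x" for m \<omega>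
  proof (cases "\<omega> \<in> X")
    case True
    have "(\<lambda>n. res_sum m (h (r n)) \<omega>) \<longlonglongrightarrow> c [] +
        (\<Sum>k<m. weight (prefix_of k \<omega>) * (c (prefix_of (Suc k) \<omega>) - c (prefix_of k \<omega>)))"
      unfolding res_sum_eq[OF True] by (intro tendsto_intros c prefix_of_nodes True) simp
    then show ?thesis by blast
  qed (auto simp: res_sum_outside)
  have lim: "(\<lambda>n. res (h (r n)) \<omega>) \<longlonglongrightarrow> f \<omega>" for \<omega>
  proof -
    have "Cauchy (\<lambda>n. res (h (r n)) \<omega>)"
    proof (rule CauchyI)
      fix \<epsilon> :: real assume "\<epsilon> > 0"
      then obtain m where m: "e m < \<epsilon> / 3"
        using order_tendstoD(2)[OF e(1), of "\<epsilon> / 3"] by (auto simp: eventually_sequentially)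
      have "Cauchy (\<lambda>n. res_sum m (h (r n)) \<omega>)"
        using res_sum_conv convergent_def convergent_Cauchy by blast
      then obtain M where M: "\<And>i j. M \<le> i \<Longrightarrow> M \<le> j \<Longrightarrow>
          cmod (res_sum m (h (r i)) \<omega> - res_sum m (h (r j)) \<omega>) < \<epsilon> / 3"
        using CauchyD[of _ "\<epsilon> / 3"] \<open>\<epsilon> > 0\<close> by (metis divide_pos_pos zero_less_numeral)
      have close: "cmod (res (h (r i)) \<omega> - res_sum m (h (r i)) \<omega>) < \<epsilon> / 3" for i
        using e(4)[OF h(1), of "r i" \<omega> m] mult_left_mono[OF h(2)[of "r i"] e(2)[of m]] m by linarith
      have "cmod (res (h (r i)) \<omega> - res (h (r j)) \<omega>) < \<epsilon>" if "M \<le> i" "M \<le> j" for i j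
      proof -
        have "res (h (r i)) \<omega> - res (h (r j)) \<omega> = (res (h (r i)) \<omega> - res_sum m (h (r i)) \<omega>)
            + (res_sum m (h (r i)) \<omega> - res_sum m (h (r j)) \<omega>)
            - (res (h (r j)) \<omega> - res_sum m (h (r j)) \<omega>)"
          by simp
        then have "cmod (res (h (r i)) \<omega> - res (h (r j)) \<omega>) \<le> cmod (res (h (r i)) \<omega> - res_sum m (h (r i)) \<omega>)
            + cmod (res_sum m (h (r i)) \<omega> - res_sum m (h (r j)) \<omega>)
            + cmod (res (h (r j)) \<omega> - res_sum m (h (r j)) \<omega>)"
          by (simp only:) (intro order_trans[OF norm_triangle_ineq4] add_mono order_refl norm_triangle_ineq)
        then show ?thesis
          using close[of i] close[of j] M[OF that] by linarith
      qed
      then show "\<exists>M. \<forall>i\<ge>M. \<forall>j\<ge>M. norm (res (h (r i)) \<omega> - res (h (r j)) \<omega>) < \<epsilon>"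
        by blast
    qed
    then show ?thesis
      unfolding f_def using Cauchy_convergent convergent_LIMSEQ_iff by blast
  qed
  have bd: "cmod (res (h n) \<omega>) \<le> C" for n \<omega>
    using e(5)[OF h(1), of n \<omega>] mult_left_mono[OF h(2)[of n] e(3)] by linarith
  have bdf: "cmod (f \<omega>) \<le> C" for \<omega>
    by (rule LIMSEQ_le_const2[OF tendsto_norm[OF lim]]) (use bd in auto)
  have meas: "f \<in> borel_measurable \<mu>"
    by (rule borel_measurable_LIMSEQ_metric[OF _ lim]) (intro L2_measurable res_L2 h)
  have f: "f \<in> L2 \<mu>"
    by (rule L2_bounded(1)[OF meas bdf e(3)])
  have "(\<lambda>n. \<integral>\<omega>. (cmod (res (h (r n)) \<omega> - f \<omega>))\<^sup>2 \<partial>\<mu>) \<longlonglongrightarrow> (\<integral>\<omega>. 0 \<partial>\<mu>)"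
  proof (rule integral_dominated_convergence[where w = "\<lambda>_. (2 * C)\<^sup>2"])
    show "(\<lambda>\<omega>. (cmod (res (h (r n)) \<omega> - f \<omega>))\<^sup>2) \<in> borel_measurable \<mu>" for n
      using meas L2_measurable[OF res_L2[OF h(1)]] by measurable
    have "(\<lambda>n. (cmod (res (h (r n)) \<omega> - f \<omega>))\<^sup>2) \<longlonglongrightarrow> 0" for \<omega>
      using tendsto_power[OF tendsto_norm_zero[OF LIM_zero[OF lim[of \<omega>]]], of 2] by simp
    then show "AE \<omega> in \<mu>. (\<lambda>n. (cmod (res (h (r n)) \<omega> - f \<omega>))\<^sup>2) \<longlonglongrightarrow> 0"
      by simp
    have "cmod (res (h (r n)) \<omega> - f \<omega>) \<le> 2 * C" for n \<omega>
      using norm_triangle_ineq4[of "res (h (r n)) \<omega>" "f \<omega>"] bd[of "r n" \<omega>] bdf[of \<omega>] by linarith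
    then have "(cmod (res (h (r n)) \<omega> - f \<omega>))\<^sup>2 \<le> (2 * C)\<^sup>2" for n \<omega>
      by (intro power_mono) auto
    then show "AE \<omega> in \<mu>. norm ((cmod (res (h (r n)) \<omega> - f \<omega>))\<^sup>2) \<le> (2 * C)\<^sup>2" for n
      by simp
  qed auto
  then have "(\<lambda>n. sqrt (\<integral>\<omega>. (cmod (res (h (r n)) \<omega> - f \<omega>))\<^sup>2 \<partial>\<mu>)) \<longlonglongrightarrow> sqrt 0"
    by (intro tendsto_real_sqrt) simp
  then have "(\<lambda>n. L2_norm \<mu> (\<lambda>x. res (h (r n)) x - f x)) \<longlonglongrightarrow> 0"
    by (simp add: L2_norm_def)
  then show "\<exists>r f. strict_mono r \<and> f \<in> L2 \<mu> \<and> (\<lambda>n. L2_norm \<mu> (\<lambda>x. res (h (r n)) x - f x)) \<longlonglongrightarrow> 0"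
    using r(1) f by blast
qed

lemma compact_resolvent_dirac_graph: "has_compact_resolvent \<mu> dirac_graph"
  unfolding has_compact_resolvent_def closure_dirac_graph
  using resolvent_dirac_graph compact_res by blast

section \<open>Continuous functions\<close>

text \<open>Compactness of the shift space in the form of Koenig's lemma for the tree of
  words.\<close>

lemma compactness:
  assumes ex: "\<And>\<omega>. \<omega> \<in> X \<Longrightarrow> \<exists>n. Q (prefix_of n \<omega>)"
    and step: "\<And>w i. w @ [i] \<in> adm \<Longrightarrow> Q w \<Longrightarrow> Q (w @ [i])"
  shows "\<exists>N. \<forall>w\<in>nodes. N \<le> length w \<longrightarrow> Q w"
proof (rule ccontr)
  assume no: "\<not> ?thesis"
  \<comment> \<open>A word is bad if \<open>Q\<close> fails at arbitrarily long words below
    it.\<close>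
  define bad where "bad w \<longleftrightarrow> (\<forall>N. \<exists>v\<in>nodes. N \<le> length v \<and> take (length w) v = w \<and> \<not> Q v)" for w
  have bad_Nil: "bad []"
    using no by (auto simp: bad_def)
  have bad_step: "\<exists>i. bad (w @ [i])" if "bad w" for w
  proof (rule ccontr)
    assume "\<not> ?thesis"
    then have "\<forall>i. \<exists>N. \<forall>v\<in>nodes. N \<le> length v \<longrightarrow> take (length (w @ [i])) v = w @ [i] \<longrightarrow> Q v"
      unfolding bad_def by blast
    from choice[OF this] obtain N where
      N: "\<forall>i. \<forall>v\<in>nodes. N i \<le> length v \<longrightarrow> take (length (w @ [i])) v = w @ [i] \<longrightarrow> Q v" ..
    \<comment> \<open>The sum exceeds every single \<open>N i\<close>, and the additional summand
      guarantees a letter after \<open>w\<close>.\<close>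
    from that[unfolded bad_def, THEN spec, of "(\<Sum>i\<in>{1..l}. N i) + Suc (length w)"]
    obtain v where v: "v \<in> nodes" "(\<Sum>i\<in>{1..l}. N i) + Suc (length w) \<le> length v"
      "take (length w) v = w" "\<not> Q v"
      by blast
    define i where "i = v ! length w"
    have i: "take (length (w @ [i])) v = w @ [i]"
      using v by (simp add: i_def take_Suc_conv_app_nth)
    have "v ! length w \<in> set v"
      using v(2) by simp
    moreover have "set v \<subseteq> {1..l}"
      using v(1) by (cases "v = []") (simp_all add: adm_words_def)
    ultimately have "i \<in> {1..l}"
      unfolding i_def by blast
    then have "N i \<le> (\<Sum>i\<in>{1..l}. N i)"
      by (intro member_le_sum) auto
    then have "N i \<le> length v"
      using v(2) by linarith
    then show False
      using N v(1,4) i by blast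
  qed
  obtain nxt where nxt: "\<And>w. bad w \<Longrightarrow> bad (w @ [nxt w])"
    using bad_step by metis
  define f where "f = rec_nat [] (\<lambda>_ w. w @ [nxt w])"
  have f: "f 0 = []" "f (Suc n) = f n @ [nxt (f n)]" for n
    by (simp_all add: f_def)
  have bad_f: "bad (f n)" for n
    by (induction n) (simp_all add: f bad_Nil nxt)
  define \<omega> where "\<omega> n = nxt (f n)" for n
  have pre: "prefix_of n \<omega> = f n" for n
    by (induction n) (simp_all add: f prefix_of_Suc \<omega>_def)
  have node: "prefix_of n \<omega> \<in> nodes" for n
  proof -
    obtain v where "v \<in> nodes" "take (length (f n)) v = f n"
      using bad_f[of n] unfolding bad_def by blast
    then show ?thesis
      using nodes_take[of v "length (f n)"] by (simp only: pre)
  qed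
  have adm: "prefix_of (Suc n) \<omega> \<in> adm" for n
    using node[of "Suc n"] by simp
  have "\<omega> k \<in> {1..l}" "A (\<omega> k) (\<omega> (Suc k)) = 1" for k
  proof -
    have "prefix_of (Suc (Suc k)) \<omega> ! k \<in> set (prefix_of (Suc (Suc k)) \<omega>)"
      by (rule nth_mem) simp
    then show "\<omega> k \<in> {1..l}"
      using adm[of "Suc k"] by (auto simp: adm_words_def)
    have "Suc k < length (prefix_of (Suc (Suc k)) \<omega>)"
      by simp
    then have "A (prefix_of (Suc (Suc k)) \<omega> ! k) (prefix_of (Suc (Suc k)) \<omega> ! Suc k) = 1"
      using adm[of "Suc k"] unfolding adm_words_def by blast
    then show "A (\<omega> k) (\<omega> (Suc k)) = 1"
      by simp
  qed
  then have "\<omega> \<in> X"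
    by (simp add: shift_space_def)
  then obtain n where n: "Q (f n)"
    using ex pre by metis
  \<comment> \<open>\<open>Q\<close> holds at a prefix of the bad path and is inherited by all
    longer words, which contradicts badness of that prefix.\<close>
  have desc: "Q v" if "v \<in> nodes" "n \<le> length v" "take n v = f n" for v
    using that
  proof (induction v rule: node_induct)
    case Nil
    then show ?case
      using n f(1) by simp
  next
    case (snoc w i)
    show ?case
    proof (cases "n \<le> length w")
      case True
      then show ?thesis
        using snoc step by simp
    next
      case False
      then have "take n (w @ [i]) = w @ [i]"
        using snoc.prems(1) by simp
      then show ?thesis
        using n snoc.prems(2) by simp
    qed
  qed
  have len: "length (f n) = n"
    using pre[of n] by (metis length_prefix_of)
  from bad_f[of n, unfolded bad_def, THEN spec, of n]
  obtain v where v: "v \<in> nodes" "n \<le> length v" "take (length (f n)) v = f n" "\<not> Q v"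
    by blast
  show False
    using desc[OF v(1,2) v(3)[unfolded len]] v(4) by contradiction
qed

lemma cont_alg_cyl:
  assumes "a \<in> cont_alg (shift_top l A)" "\<omega> \<in> X" "e > 0"
  obtains n where "\<And>\<upsilon>. \<upsilon> \<in> cyl (prefix_of n \<omega>) \<Longrightarrow> cmod (a \<upsilon> - a \<omega>) < e"
proof -
  have "openin (shift_top l A) {\<upsilon> \<in> topspace (shift_top l A). a \<upsilon> \<in> ball (a \<omega>) e}"
    using assms(1) by (intro openin_continuous_map_preimage[of _ euclidean]) (auto simp: cont_alg_def)
  moreover have "\<omega> \<in> {\<upsilon> \<in> topspace (shift_top l A). a \<upsilon> \<in> ball (a \<omega>) e}"
    using assms by simp
  ultimately obtain n where "cyl (prefix_of n \<omega>) \<subseteq> {\<upsilon> \<in> topspace (shift_top l A). a \<upsilon> \<in> ball (a \<omega>) e}"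
    using open_contains_cyl by blast
  then have "cmod (a \<upsilon> - a \<omega>) < e" if "\<upsilon> \<in> cyl (prefix_of n \<omega>)" for \<upsilon>
    using that by (auto simp: dist_norm norm_minus_commute)
  then show ?thesis
    by (rule that)
qed

text \<open>Uniform continuity: compactness is applied to the words on whose cylinders the
  oscillation is below \<open>e\<close>.\<close>

lemma cont_alg_uniform:
  assumes "a \<in> cont_alg (shift_top l A)" "e > 0"
  obtains n where "\<And>\<omega> \<upsilon>. \<omega> \<in> X \<Longrightarrow> \<upsilon> \<in> X \<Longrightarrow> prefix_of n \<omega> = prefix_of n \<upsilon> \<Longrightarrow> cmod (a \<omega> - a \<upsilon>) < e"
proof -
  define Q where "Q w \<longleftrightarrow> (\<forall>\<omega>\<in>cyl w. \<forall>\<upsilon>\<in>cyl w. cmod (a \<omega> - a \<upsilon>) < e)" for w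
  have "\<exists>N. \<forall>w\<in>nodes. N \<le> length w \<longrightarrow> Q w"
  proof (rule compactness)
    fix \<omega> assume "\<omega> \<in> X"
    then obtain n where n: "\<And>\<upsilon>. \<upsilon> \<in> cyl (prefix_of n \<omega>) \<Longrightarrow> cmod (a \<upsilon> - a \<omega>) < e / 2"
      using cont_alg_cyl[OF assms(1), of \<omega> "e / 2"] assms(2) by (metis half_gt_zero)
    have "cmod (a \<upsilon> - a \<upsilon>') < e" if "\<upsilon> \<in> cyl (prefix_of n \<omega>)" "\<upsilon>' \<in> cyl (prefix_of n \<omega>)" for \<upsilon> \<upsilon>'
      using norm_triangle_ineq4[of "a \<upsilon> - a \<omega>" "a \<upsilon>' - a \<omega>"] n[OF that(1)] n[OF that(2)] by simp
    then show "\<exists>n. Q (prefix_of n \<omega>)"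
      by (auto simp: Q_def)
  next
    fix w i assume "w @ [i] \<in> adm" "Q w"
    then show "Q (w @ [i])"
      using cyl_children[of w] by (auto simp: Q_def children_def)
  qed
  then obtain N where N: "\<And>w. w \<in> nodes \<Longrightarrow> N \<le> length w \<Longrightarrow> Q w"
    by blast
  have "cmod (a \<omega> - a \<upsilon>) < e" if "\<omega> \<in> X" "\<upsilon> \<in> X" "prefix_of N \<omega> = prefix_of N \<upsilon>" for \<omega> \<upsilon>
    using N[OF prefix_of_nodes[OF that(1)], of N] in_cyl_prefix_of[OF that(1), of N]
      in_cyl_prefix_of[OF that(2), of N] that(3) by (auto simp: Q_def)
  then show ?thesis
    by (rule that)
qed

lemma cyl_fun_cont_alg:
  assumes "cyl_fun n f"
  shows "f \<in> cont_alg (shift_top l A)"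
proof -
  have "openin (shift_top l A) {\<omega> \<in> X. f \<omega> \<in> U}" for U
  proof (subst openin_subopen, intro ballI)
    fix \<omega> assume "\<omega> \<in> {\<omega> \<in> X. f \<omega> \<in> U}"
    then have \<omega>: "\<omega> \<in> X" "f \<omega> \<in> U"
      by auto
    have "cyl (prefix_of n \<omega>) \<subseteq> {\<omega> \<in> X. f \<omega> \<in> U}"
    proof
      fix \<upsilon> assume "\<upsilon> \<in> cyl (prefix_of n \<omega>)"
      then have "\<upsilon> \<in> X" "prefix_of n \<upsilon> = prefix_of n \<omega>"
        by (auto simp: in_cyl_iff)
      moreover from this have "f \<upsilon> = f \<omega>"
        using assms \<omega>(1) unfolding cyl_fun_def by blast
      ultimately show "\<upsilon> \<in> {\<omega> \<in> X. f \<omega> \<in> U}"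
        using \<omega>(2) by simp
    qed
    then show "\<exists>T. openin (shift_top l A) T \<and> \<omega> \<in> T \<and> T \<subseteq> {\<omega> \<in> X. f \<omega> \<in> U}"
      using openin_cyl[OF prefix_of_nodes[OF \<omega>(1)]] in_cyl_prefix_of[OF \<omega>(1)] by blast
  qed
  then show ?thesis
    using assms by (auto simp: cont_alg_def cyl_fun_def continuous_map_def)
qed

lemma cont_alg_approx:
  assumes "a \<in> cont_alg (shift_top l A)" "e > 0"
  obtains n f where "cyl_fun n f" "\<And>\<omega>. cmod (a \<omega> - f \<omega>) < e"
proof -
  obtain n where n: "\<And>\<omega> \<upsilon>. \<omega> \<in> X \<Longrightarrow> \<upsilon> \<in> X \<Longrightarrow> prefix_of n \<omega> = prefix_of n \<upsilon> \<Longrightarrow> cmod (a \<omega> - a \<upsilon>) < e"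
    using cont_alg_uniform[OF assms] by blast
  define f where "f \<omega> = indicator X \<omega> * value_on (prefix_of n \<omega>) a" for \<omega>
  have "cmod (a \<omega> - f \<omega>) < e" for \<omega>
  proof (cases "\<omega> \<in> X")
    case True
    define \<upsilon> where "\<upsilon> = (SOME \<upsilon>. \<upsilon> \<in> cyl (prefix_of n \<omega>))"
    have "\<upsilon> \<in> cyl (prefix_of n \<omega>)"
      unfolding \<upsilon>_def using in_cyl_prefix_of[OF True, of n] by (rule someI[of "\<lambda>\<upsilon>. \<upsilon> \<in> cyl (prefix_of n \<omega>)"])
    then have "cmod (a \<omega> - a \<upsilon>) < e"
      by (intro n[OF True]) (auto simp: in_cyl_iff)
    moreover have "f \<omega> = a \<upsilon>"
      using True unfolding f_def value_on_def \<upsilon>_def by simp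
    ultimately show ?thesis
      by simp
  next
    case False
    then show ?thesis
      using assms by (simp add: f_def cont_alg_def)
  qed
  moreover have "cyl_fun n f"
    unfolding f_def by (rule cyl_fun_prefix)
  ultimately show ?thesis
    using that by blast
qed

lemma cont_alg_bounded:
  assumes "a \<in> cont_alg (shift_top l A)"
  obtains B where "0 \<le> B" "\<And>\<omega>. cmod (a \<omega>) \<le> B"
proof -
  obtain n f where f: "cyl_fun n f" "\<And>\<omega>. cmod (a \<omega> - f \<omega>) < 1"
    by (rule cont_alg_approx[OF assms, of 1]) (simp, rule that, assumption+)
  obtain B where B: "0 \<le> B" "\<And>\<omega>. cmod (f \<omega>) \<le> B"
    by (rule cyl_fun_bounded[OF f(1)]) (rule that, assumption+)
  have "cmod (a \<omega>) \<le> B + 1" for \<omega>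
    using norm_triangle_ineq[of "a \<omega> - f \<omega>" "f \<omega>"] f(2)[of \<omega>] B(2)[of \<omega>] by simp
  then show ?thesis
    using that[of "B + 1"] B(1) by auto
qed

lemma cont_alg_measurable:
  assumes "a \<in> cont_alg (shift_top l A)"
  shows "a \<in> borel_measurable \<mu>"
proof (rule borel_measurableI)
  fix S :: "complex set" assume "open S"
  then have "openin (shift_top l A) {\<omega> \<in> topspace (shift_top l A). a \<omega> \<in> S}"
    using assms by (intro openin_continuous_map_preimage[of _ euclidean]) (auto simp: cont_alg_def)
  then have "{\<omega> \<in> X. a \<omega> \<in> S} \<in> sets \<mu>"
    by (simp add: open_sets)
  moreover have "a -` S \<inter> space \<mu> = {\<omega> \<in> X. a \<omega> \<in> S}"
    by auto
  ultimately show "a -` S \<inter> space \<mu> \<in> sets \<mu>"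
    by simp
qed

lemma cont_alg_mult_L2:
  assumes "a \<in> cont_alg (shift_top l A)" "h \<in> L2 \<mu>"
  shows "(\<lambda>\<omega>. a \<omega> * h \<omega>) \<in> L2 \<mu>"
proof -
  obtain B where B: "0 \<le> B" "\<And>\<omega>. cmod (a \<omega>) \<le> B"
    by (rule cont_alg_bounded[OF assms(1)]) (rule that, assumption+)
  show ?thesis
    using B assms(2) cont_alg_measurable[OF assms(1)]
    by (intro L2_dominated(1)[OF assms(2), where C = B])
      (auto intro!: borel_measurable_times mult_right_mono simp: norm_mult L2_measurable)
qed

lemma cont_alg_L2: "a \<in> cont_alg (shift_top l A) \<Longrightarrow> a \<in> L2 \<mu>"
  by (metis L2_bounded(1) cont_alg_bounded cont_alg_measurable)

section \<open>The commutator away from the diagonal\<close>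

text \<open>The unit ball of the seminorm given by the norm of the commutator, over which Connes'
  distance is a supremum.\<close>

definition Lip :: "((nat \<Rightarrow> nat) \<Rightarrow> complex) set" where
  "Lip = {a \<in> cont_alg (shift_top l A).
     densely_defined \<mu> (commutator dirac_graph mult_rep a) \<and>
     extends_boundedly \<mu> 1 (commutator dirac_graph mult_rep a)}"

text \<open>
  Off the diagonal the Dirac operator is an integral operator; its kernel at two points whose longest
  common prefix is \<open>y\<close> is \<open>kern y\<close>.
\<close>

definition kern0 :: "nat list \<Rightarrow> real" where
  "kern0 y = (\<Sum>m<length y. eig (take m y) * (1 / mass (take (Suc m) y) - 1 / mass (take m y)))"

text \<open>At a proper prefix of \<open>y\<close> both points lie in the same child, where the
  projection has kernel \<open>1 / mass child - 1 / mass parent\<close>. At \<open>y\<close> they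
  lie in different children, where the kernel is \<open>- 1 / mass y\<close>. Longer words do not
  contain both points.\<close>

definition kern :: "nat list \<Rightarrow> real" where
  "kern y = kern0 y - eig y / mass y"

text \<open>\<open>y\<close> is the longest common prefix of \<open>z\<close> and \<open>z'\<close>
  and is proper in both, so the two cylinders are disjoint.\<close>

definition branches :: "nat list \<Rightarrow> nat list \<Rightarrow> nat list \<Rightarrow> bool" where
  "branches y z z' \<longleftrightarrow> length y < length z \<and> length y < length z' \<and>
     take (length y) z = y \<and> take (length y) z' = y \<and> z ! length y \<noteq> z' ! length y"

text \<open>The indicator of \<open>z\<close> vanishes at \<open>\<omega>\<close>, so half of
  \<open>comm\<close> disappears. What remains is a sum along the prefixes of
  \<open>\<omega>\<close>: up to \<open>y\<close> they contain all of \<open>cyl z\<close>,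
  afterwards they are disjoint from it.\<close>

lemma comm_indicator_off_diagonal:
  assumes "h \<in> L2 \<mu>" "z \<in> nodes" "branches y z z'" "\<omega> \<in> cyl z'"
  shows "comm (length z) (indicator (cyl z)) h \<omega> = of_real (kern y) * cyl_int z h"
proof -
  let ?n = "length z" and ?k = "length y" and ?b = "indicator (cyl z) :: _ \<Rightarrow> complex"
  define u where "u = (\<lambda>\<omega>. ?b \<omega> * h \<omega>)"
  have br: "?k < ?n" "?k < length z'" "take ?k z = y" "take ?k z' = y" "z ! ?k \<noteq> z' ! ?k"
    using assms(3) by (auto simp: branches_def)
  have \<omega>: "\<omega> \<in> X" "prefix_of (length z') \<omega> = z'"
    using assms(4) by (auto simp: in_cyl_iff)
  have letter: "\<omega> ?k = z' ! ?k"
    using \<omega>(2) br(2) by (metis nth_prefix_of)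
  have prefix: "prefix_of m \<omega> = take m y" if "m \<le> ?k" for m
  proof -
    have "prefix_of m \<omega> = take m (take ?k (prefix_of (length z') \<omega>))"
      using that br(2) by simp
    then show ?thesis
      using \<omega>(2) br(4) by simp
  qed
  have "\<omega> \<notin> cyl z"
  proof
    assume "\<omega> \<in> cyl z"
    then have "prefix_of ?n \<omega> ! ?k = z ! ?k"
      by (simp add: in_cyl_iff)
    then show False
      using br letter by simp
  qed
  then have b0: "?b \<omega> = 0"
    by simp
  have av_low: "av (prefix_of m \<omega>) u = cyl_int z h * of_real (1 / mass (take m y))" if "m \<le> ?k" for m
  proof -
    have sub: "cyl z \<subseteq> cyl (prefix_of m \<omega>)"
    proof
      fix \<upsilon> assume "\<upsilon> \<in> cyl z"
      then have \<upsilon>: "\<upsilon> \<in> X" "prefix_of ?n \<upsilon> = z"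
        by (auto simp: in_cyl_iff)
      have "prefix_of m \<upsilon> = take m (take ?k (prefix_of ?n \<upsilon>))"
        using that br(1) by simp
      also have "\<dots> = prefix_of m \<omega>"
        using \<upsilon>(2) br(3) prefix[OF that] by simp
      finally show "\<upsilon> \<in> cyl (prefix_of m \<omega>)"
        using \<upsilon>(1) by (simp add: in_cyl_iff)
    qed
    have "cyl_int (prefix_of m \<omega>) u = cyl_int z h"
      unfolding cyl_int_def u_def
      by (intro Bochner_Integration.integral_cong) (use sub in \<open>auto simp: indicator_def\<close>)
    then show ?thesis
      using prefix[OF that] by (simp add: av_def)
  qed
  have av_high: "av (prefix_of m \<omega>) u = 0" if "?k < m" for m
  proof (rule av_const[OF prefix_of_nodes[OF \<omega>(1)]])
    fix \<upsilon> assume "\<upsilon> \<in> cyl (prefix_of m \<omega>)"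
    then have "prefix_of m \<upsilon> ! ?k = prefix_of m \<omega> ! ?k"
      by (simp add: in_cyl_iff)
    then have "\<upsilon> ?k = z' ! ?k"
      using that letter by simp
    then have "\<upsilon> \<notin> cyl z"
      using br by (metis in_cyl_iff nth_prefix_of)
    then show "u \<upsilon> = 0"
      by (simp add: u_def)
  qed
  let ?t = "\<lambda>m. of_real (eig (prefix_of m \<omega>)) * (av (prefix_of (Suc m) \<omega>) u - av (prefix_of m \<omega>) u)"
  have "comm ?n ?b h \<omega> = (\<Sum>w\<in>below ?n. of_real (eig w) * P w u \<omega>)"
    by (simp add: comm_def b0 u_def)
  also have "\<dots> = (\<Sum>m<?n. ?t m)"
    by (rule sum_below_P[OF \<omega>(1)])
  also have "\<dots> = (\<Sum>m<Suc ?k. ?t m)"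
    using br(1) by (intro sum.mono_neutral_right) (auto simp: av_high)
  also have "\<dots> = (\<Sum>m<?k. cyl_int z h * of_real (eig (take m y) * (1 / mass (take (Suc m) y) - 1 / mass (take m y))))
      - cyl_int z h * of_real (eig y / mass y)"
  proof -
    have "?t m = cyl_int z h * of_real (eig (take m y) * (1 / mass (take (Suc m) y) - 1 / mass (take m y)))"
      if "m < ?k" for m
    proof -
      have le: "m \<le> ?k" "Suc m \<le> ?k"
        using that by auto
      show ?thesis
        unfolding av_low[OF le(1)] av_low[OF le(2)]
        unfolding prefix[OF le(1)] by (simp add: algebra_simps)
    qed
    moreover have "?t ?k = - cyl_int z h * of_real (eig y / mass y)"
      unfolding av_low[OF order_refl] av_high[OF lessI]
      unfolding prefix[OF order_refl] by simp
    ultimately show ?thesis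
      by simp
  qed
  also have "\<dots> = of_real (kern y) * cyl_int z h"
    by (simp only: kern_def kern0_def of_real_diff of_real_sum sum_distrib_left[symmetric])
      (simp add: algebra_simps)
  finally show ?thesis .
qed

lemma commutator_localize:
  assumes "(h, g) \<in> dirac_graph" "((\<lambda>x. a x * h x), g') \<in> dirac_graph" "cyl_fun n b"
  shows "((\<lambda>x. b x * h x), (\<lambda>x. (b x * g' x + comm n b (\<lambda>x. a x * h x) x)
    - a x * (b x * g x + comm n b h x))) \<in> commutator dirac_graph mult_rep a"
proof -
  have "(\<lambda>x. b x * (a x * h x)) = mult_rep a (\<lambda>x. b x * h x)"
    by (simp add: mult_rep_def mult.left_commute)
  then have "(mult_rep a (\<lambda>x. b x * h x), (\<lambda>x. b x * g' x + comm n b (\<lambda>x. a x * h x) x)) \<in> dirac_graph"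
    using dirac_graph_mult[OF assms(3,2)] by simp
  then show ?thesis
    using dirac_graph_mult[OF assms(3,1)] unfolding commutator_def mem_Collect_eq
    by (intro exI[of _ "\<lambda>x. b x * h x"] exI[of _ "\<lambda>x. b x * g x + comm n b h x"]
        exI[of _ "\<lambda>x. b x * g' x + comm n b (\<lambda>x. a x * h x) x"] conjI)
      (simp_all add: mult_rep_def)
qed

lemma cyl_int_cong_AE:
  assumes "f \<in> borel_measurable \<mu>" "g \<in> borel_measurable \<mu>" "AE \<omega> in \<mu>. f \<omega> = g \<omega>"
  shows "cyl_int w f = cyl_int w g"
  unfolding cyl_int_def
  by (intro integral_cong_AE) (use assms in \<open>auto intro!: borel_measurable_times\<close>)

text \<open>Here \<open>h\<close> is an element of the domain within \<open>e\<close> of the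
  constant function. The error terms on the right replace \<open>h\<close> by 1 in the integrals of
  \<open>a * h\<close> and of \<open>h\<close> over \<open>z\<close>, and in the norm of
  \<open>b * h\<close>.\<close>

lemma Lip_off_diagonal_approx:
  assumes a: "a \<in> Lip" and B: "\<And>\<omega>. cmod (a \<omega>) \<le> B" and z: "z \<in> nodes" "z' \<in> nodes"
    and br: "branches y z z'" and e: "e > 0"
  shows "\<bar>kern y\<bar> * cmod (cyl_int z a * of_real (mass z') - of_real (mass z) * cyl_int z' a)
    \<le> sqrt (mass z') * (sqrt (mass z) + e) + \<bar>kern y\<bar> * (B * e * mass z' + e * cmod (cyl_int z' a))"
proof -
  have cont: "a \<in> cont_alg (shift_top l A)"
    using a by (simp add: Lip_def)
  obtain T where T: "bounded_operator \<mu> 1 T"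
    "\<And>h f. (h, f) \<in> commutator dirac_graph mult_rep a \<Longrightarrow> AE x in \<mu>. T h x = f x"
    using a by (auto simp: Lip_def extends_boundedly_def)
  have one: "(indicator X :: _ \<Rightarrow> complex) \<in> L2 \<mu>"
    using L2_indicator[OF cyl_sets[of "[]"]] by simp
  have "densely_defined \<mu> (commutator dirac_graph mult_rep a)"
    using a by (simp add: Lip_def)
  then obtain h where h: "h \<in> Domain (commutator dirac_graph mult_rep a)"
      "L2_norm \<mu> (\<lambda>x. indicator X x - h x) < e"
    unfolding densely_defined_def using one e by blast
  then obtain g g' where g: "(h, g) \<in> dirac_graph" "((\<lambda>x. a x * h x), g') \<in> dirac_graph"
    by (auto simp: commutator_def mult_rep_def)
  have L2: "h \<in> L2 \<mu>" "g \<in> L2 \<mu>" "(\<lambda>x. a x * h x) \<in> L2 \<mu>" "g' \<in> L2 \<mu>"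
    using g dirac_graph_L2 by blast+
  define b :: "(nat \<Rightarrow> nat) \<Rightarrow> complex" where "b = indicator (cyl z)"
  have b: "cyl_fun (length z) b"
    unfolding b_def by (rule cyl_fun_indicator) simp
  define G where "G x = (b x * g' x + comm (length z) b (\<lambda>x. a x * h x) x)
    - a x * (b x * g x + comm (length z) b h x)" for x
  have bh: "(\<lambda>x. b x * h x) \<in> L2 \<mu>"
    by (rule cyl_fun_mult_L2[OF b L2(1)])
  have TG: "AE x in \<mu>. T (\<lambda>x. b x * h x) x = G x"
    unfolding G_def by (rule T(2)[OF commutator_localize[OF g b]])
  have TL2: "T (\<lambda>x. b x * h x) \<in> L2 \<mu>" "L2_norm \<mu> (T (\<lambda>x. b x * h x)) \<le> L2_norm \<mu> (\<lambda>x. b x * h x)"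
    using T(1) bh by (auto simp: bounded_operator_def)
  have GL2: "G \<in> L2 \<mu>"
    unfolding G_def
    by (intro L2_diff L2_add cyl_fun_mult_L2[OF b] comm_L2[OF b] cont_alg_mult_L2[OF cont] L2)
  define k where "k = complex_of_real (kern y)"
  \<comment> \<open>On \<open>cyl z'\<close> the terms with the factor \<open>b\<close> vanish, in
    particular those with the unknown functions \<open>g\<close> and \<open>g'\<close>. Only the
    off-diagonal values of the Dirac operator survive.\<close>
  have "cyl_int z' (T (\<lambda>x. b x * h x)) = cyl_int z' G"
    by (intro cyl_int_cong_AE TG L2_measurable TL2 GL2)
  also have "\<dots> = cyl_int z' (\<lambda>x. k * cyl_int z (\<lambda>x. a x * h x) - (k * cyl_int z h) * a x)"
  proof (rule cyl_int_cong)
    fix x assume x: "x \<in> cyl z'"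
    have "b x = 0"
    proof (rule ccontr)
      assume "b x \<noteq> 0"
      then have "prefix_of (length z) x = z" "prefix_of (length z') x = z'"
        using x by (auto simp: b_def indicator_def in_cyl_iff split: if_splits)
      then show False
        using br unfolding branches_def by (metis nth_prefix_of)
    qed
    then show "G x = k * cyl_int z (\<lambda>x. a x * h x) - (k * cyl_int z h) * a x"
      using comm_indicator_off_diagonal[OF L2(1) z(1) br x] comm_indicator_off_diagonal[OF L2(3) z(1) br x]
      by (simp add: G_def b_def k_def mult.commute)
  qed
  also have "\<dots> = k * cyl_int z (\<lambda>x. a x * h x) * of_real (mass z') - (k * cyl_int z h) * cyl_int z' a"
    using cont_alg_L2[OF cont]
    by (subst cyl_int_diff) (auto simp: cyl_int_const cyl_int_scale L2_integrable)
  finally have eq: "cyl_int z' (T (\<lambda>x. b x * h x))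
    = k * (cyl_int z (\<lambda>x. a x * h x) * of_real (mass z') - cyl_int z h * cyl_int z' a)"
    by (simp add: algebra_simps)
  define d where "d x = indicator X x - h x" for x
  have d: "d \<in> L2 \<mu>" "integrable \<mu> d" "L2_norm \<mu> d < e"
    using h(2) L2_diff[OF one L2(1)] by (auto simp: d_def[abs_def] intro: L2_integrable)
  have norm_bh: "L2_norm \<mu> (\<lambda>x. b x * h x) \<le> sqrt (mass z) + e"
  proof -
    have bL2: "b \<in> L2 \<mu>"
      by (rule cyl_fun_L2[OF b])
    have "(\<lambda>x. b x * h x) = (\<lambda>x. b x + (-1) * (b x * d x))"
      using cyl_subset[of z] by (auto simp: fun_eq_iff d_def b_def indicator_def)
    then have "L2_norm \<mu> (\<lambda>x. b x * h x) \<le> L2_norm \<mu> b + L2_norm \<mu> (\<lambda>x. (-1) * (b x * d x))"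
      using L2_norm_triangle[OF bL2 L2_scale(1)[OF cyl_fun_mult_L2[OF b d(1)], of "-1"]] by simp
    also have "\<dots> = sqrt (mass z) + L2_norm \<mu> (\<lambda>x. b x * d x)"
      using L2_scale(2)[OF cyl_fun_mult_L2[OF b d(1)], of "-1"] L2_norm_indicator[OF cyl_sets, of z]
      by (simp add: b_def)
    also have "L2_norm \<mu> (\<lambda>x. b x * d x) \<le> 1 * L2_norm \<mu> d"
      by (intro L2_dominated(2)[OF d(1)] L2_measurable cyl_fun_mult_L2[OF b d(1)])
        (auto simp: b_def indicator_def)
    finally show ?thesis
      using d(3) by linarith
  qed
  have "cmod (cyl_int z' (T (\<lambda>x. b x * h x))) \<le> sqrt (mass z') * (sqrt (mass z) + e)"
    by (rule order_trans[OF cmod_cyl_int_le[OF TL2(1)]])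
      (use TL2(2) norm_bh in \<open>auto intro!: mult_left_mono\<close>)
  then have main: "\<bar>kern y\<bar> * cmod (cyl_int z (\<lambda>x. a x * h x) * of_real (mass z') - cyl_int z h * cyl_int z' a)
      \<le> sqrt (mass z') * (sqrt (mass z) + e)"
    unfolding eq by (simp add: norm_mult k_def)
  have B0: "0 \<le> B"
    using B[of undefined] norm_ge_zero order_trans by blast
  have le_e: "cmod (cyl_int z f) \<le> L2_norm \<mu> f" if "f \<in> L2 \<mu>" for f
    by (rule order_trans[OF cmod_cyl_int_le[OF that]]) (simp add: mult_left_le_one_le)
  have ad: "(\<lambda>x. a x * d x) \<in> L2 \<mu>" "L2_norm \<mu> (\<lambda>x. a x * d x) \<le> B * L2_norm \<mu> d"
  proof -
    show ad: "(\<lambda>x. a x * d x) \<in> L2 \<mu>"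
      by (rule cont_alg_mult_L2[OF cont d(1)])
    show "L2_norm \<mu> (\<lambda>x. a x * d x) \<le> B * L2_norm \<mu> d"
      by (intro L2_dominated(2)[OF d(1)] L2_measurable ad B0)
        (simp add: norm_mult B mult_right_mono)
  qed
  have diff1: "cyl_int z a = cyl_int z (\<lambda>x. a x * h x) + cyl_int z (\<lambda>x. a x * d x)"
  proof -
    have "cyl_int z a = cyl_int z (\<lambda>x. a x * h x + a x * d x)"
      using cyl_subset by (intro cyl_int_cong) (auto simp: d_def algebra_simps indicator_def)
    then show ?thesis
      by (simp add: cyl_int_add L2_integrable L2 ad)
  qed
  have diff2: "of_real (mass z) = cyl_int z h + cyl_int z d"
  proof -
    have "cyl_int z (\<lambda>_. 1) = cyl_int z (\<lambda>x. h x + d x)"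
      using cyl_subset by (intro cyl_int_cong) (auto simp: d_def indicator_def)
    then show ?thesis
      by (simp add: cyl_int_add L2_integrable L2 d cyl_int_const)
  qed
  have e1: "cmod (cyl_int z (\<lambda>x. a x * d x)) \<le> B * e"
    using le_e[OF ad(1)] ad(2) mult_left_mono[OF less_imp_le[OF d(3)] B0] by linarith
  have e2: "cmod (cyl_int z d) \<le> e"
    using le_e[OF d(1)] d(3) by linarith
  let ?Q = "cyl_int z (\<lambda>x. a x * h x) * of_real (mass z') - cyl_int z h * cyl_int z' a"
  have "cyl_int z a * of_real (mass z') - of_real (mass z) * cyl_int z' a
      = ?Q + (cyl_int z (\<lambda>x. a x * d x) * of_real (mass z') - cyl_int z d * cyl_int z' a)"
    unfolding diff1 diff2 by (simp add: algebra_simps)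
  then have "cmod (cyl_int z a * of_real (mass z') - of_real (mass z) * cyl_int z' a)
      \<le> cmod ?Q + (cmod (cyl_int z (\<lambda>x. a x * d x) * of_real (mass z')) + cmod (cyl_int z d * cyl_int z' a))"
    by (simp only:) (intro order_trans[OF norm_triangle_ineq] add_mono order_refl norm_triangle_ineq4)
  also have "\<dots> \<le> cmod ?Q + (B * e * mass z' + e * cmod (cyl_int z' a))"
    using e1 e2 by (intro add_mono order_refl) (simp_all add: norm_mult mult_right_mono)
  finally have "\<bar>kern y\<bar> * cmod (cyl_int z a * of_real (mass z') - of_real (mass z) * cyl_int z' a)
      \<le> \<bar>kern y\<bar> * (cmod ?Q + (B * e * mass z' + e * cmod (cyl_int z' a)))"
    by (rule mult_left_mono) simp
  then show ?thesis
    using main by (simp add: distrib_left)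
qed

text \<open>Let \<open>h\<close> tend to 1 and divide by
  \<open>sqrt (mass z * mass z')\<close>.\<close>

lemma Lip_off_diagonal:
  assumes a: "a \<in> Lip" and z: "z \<in> nodes" "z' \<in> nodes" and br: "branches y z z'"
  shows "\<bar>kern y\<bar> * cmod (av z a - av z' a) * sqrt (mass z * mass z') \<le> 1"
proof -
  have cont: "a \<in> cont_alg (shift_top l A)"
    using a by (simp add: Lip_def)
  obtain B where B: "0 \<le> B" "\<And>\<omega>. cmod (a \<omega>) \<le> B"
    by (rule cont_alg_bounded[OF cont]) (rule that, assumption+)
  define L where "L = \<bar>kern y\<bar> * cmod (cyl_int z a * of_real (mass z') - of_real (mass z) * cyl_int z' a)"
  define c where "c = sqrt (mass z') + \<bar>kern y\<bar> * (B * mass z' + cmod (cyl_int z' a))"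
  have c: "0 \<le> c"
    using B(1) by (simp add: c_def)
  have "L \<le> sqrt (mass z') * sqrt (mass z)"
  proof (rule field_le_epsilon)
    fix \<epsilon> :: real assume "\<epsilon> > 0"
    \<comment> \<open>Dividing by \<open>c + 1\<close> covers the case \<open>c = 0\<close>.\<close>
    then have e: "\<epsilon> / (c + 1) > 0" "c * (\<epsilon> / (c + 1)) \<le> \<epsilon>"
      using c by (auto simp: field_simps)
    have "L \<le> sqrt (mass z') * sqrt (mass z) + c * (\<epsilon> / (c + 1))"
      using Lip_off_diagonal_approx[OF a B(2) z br e(1)]
      unfolding L_def c_def by (simp only: distrib_left distrib_right mult_ac add_ac)
    then show "L \<le> sqrt (mass z') * sqrt (mass z) + \<epsilon>"
      using e(2) by linarith
  qed
  moreover have "L = \<bar>kern y\<bar> * cmod (av z a - av z' a) * (mass z * mass z')"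
  proof -
    have "cyl_int z a * of_real (mass z') - of_real (mass z) * cyl_int z' a
        = of_real (mass z * mass z') * (av z a - av z' a)"
      by (simp add: cyl_int_av z[simplified] algebra_simps)
    then show ?thesis
      by (simp add: L_def norm_mult)
  qed
  moreover define s where "s = sqrt (mass z * mass z')"
  ultimately have "(\<bar>kern y\<bar> * cmod (av z a - av z' a)) * (s * s) \<le> s"
    by (simp add: real_sqrt_mult[of "mass z'"] s_def mult.commute[of "mass z'"] flip: real_sqrt_mult)
  then have "(\<bar>kern y\<bar> * cmod (av z a - av z' a) * s) * s \<le> 1 * s"
    by (simp only: mult.assoc mult_1)
  moreover have "0 < s"
    using mass_pos[OF z(1)] mass_pos[OF z(2)] by (simp add: s_def)
  ultimately show ?thesis
    unfolding s_def[symmetric] by (rule mult_right_le_imp_le)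
qed

section \<open>The modulus of continuity of the unit ball\<close>

lemma kern0_Nil[simp]: "kern0 [] = 0"
  by (simp add: kern0_def)

lemma kern0_snoc: "kern0 (w @ [i]) = kern0 w + eig w * (1 / mass (w @ [i]) - 1 / mass w)"
  by (simp add: kern0_def)

text \<open>Made scale-free: away from the root this is the number of children minus 1.\<close>

definition rel_eig :: "nat list \<Rightarrow> real" where
  "rel_eig w = eig w * mass w"

text \<open>The sum \<open>kern0\<close> grows at most like the inverse square of the mass, so this
  normalisation keeps it bounded.\<close>

definition rel_kern :: "nat list \<Rightarrow> real" where
  "rel_kern w = kern0 w * (mass w)\<^sup>2"

text \<open>
  The kernel \<open>kern y\<close> has two competing terms and may vanish; the lower bound on it holds for good
  words only. Along a run of branching words that are not good, \<open>rel_kern\<close> drops by a fixed amount at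
  every step, so such a run is short and every word has a good prefix of comparable mass.
\<close>

definition good :: "nat list \<Rightarrow> bool" where
  "good y \<longleftrightarrow> y \<in> nodes \<and> card (children y) \<ge> 2 \<and> \<kappa> / 4 \<le> \<bar>rel_kern y - rel_eig y\<bar>"

lemma kern_eq:
  assumes "y \<in> nodes"
  shows "\<bar>kern y\<bar> * (mass y)\<^sup>2 = \<bar>rel_kern y - rel_eig y\<bar>"
proof -
  have "kern y * (mass y)\<^sup>2 = rel_kern y - rel_eig y"
    using mass_pos[OF assms] by (simp add: kern_def rel_kern_def rel_eig_def power2_eq_square field_simps)
  then show ?thesis
    by (metis abs_mult abs_power2)
qed

lemma rel_eig_branching:
  assumes "w \<in> nodes" "w = [] \<or> card (children w) \<ge> 2"
  shows "1 \<le> rel_eig w"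
  using eig_ge[OF assms] mass_pos[OF assms(1)] by (simp add: rel_eig_def field_simps)

lemma rel_eig_nonneg: "w \<in> nodes \<Longrightarrow> 0 \<le> rel_eig w"
  using eig_nonneg[of w] by (simp add: rel_eig_def)

lemma rel_eig_le:
  assumes "w \<in> nodes"
  shows "rel_eig w \<le> real l"
proof (cases "w = []")
  case True
  then show ?thesis
    using two_letters by (simp add: rel_eig_def eig_def)
next
  case False
  have "card (children w) \<le> l"
    using card_mono[OF _ children_subset[of w]] by simp
  then show ?thesis
    using False assms mass_pos[OF assms] by (auto simp: rel_eig_def eig_def n_succ_adm)
qed

lemma rel_eig_nonbranching:
  assumes "w \<in> nodes" "w \<noteq> []" "\<not> card (children w) \<ge> 2"
  shows "rel_eig w = 0"
proof -
  have "card (children w) = 1"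
    using assms(3) children_nonempty[OF assms(1)] card_gt_0_iff[of "children w"] by simp
  then show ?thesis
    using assms by (simp add: rel_eig_def eig_def n_succ_adm)
qed

text \<open>The scale-free recursion involves the masses through their ratio \<open>t\<close> alone.
  Its weights are non-negative with sum \<open>t \<le> 1\<close>, so a common bound for both
  quantities is inherited.\<close>

lemma rel_kern_snoc:
  assumes "w @ [i] \<in> adm"
  defines "t \<equiv> mass (w @ [i]) / mass w"
  shows "rel_kern (w @ [i]) = rel_kern w * t\<^sup>2 + rel_eig w * (t - t\<^sup>2)"
proof -
  have "0 < mass w" "0 < mass (w @ [i])"
    using mass_pos[OF butlast_node[OF assms(1)]] mass_pos[of "w @ [i]"] assms(1) by auto
  then show ?thesis
    unfolding rel_kern_def rel_eig_def kern0_snoc t_def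
    by (simp add: field_simps power2_eq_square)
qed

lemma ratio_bounds:
  assumes "w @ [i] \<in> adm"
  shows "0 < mass (w @ [i]) / mass w" "mass (w @ [i]) / mass w \<le> 1"
  using mass_pos[OF butlast_node[OF assms]] mass_pos[of "w @ [i]"] assms mass_child_le[of w i]
  by auto

lemma rel_kern_bounds:
  assumes "w \<in> nodes"
  shows "0 \<le> rel_kern w \<and> rel_kern w \<le> real l"
  using assms
proof (induction w rule: node_induct)
  case Nil
  then show ?case
    by (simp add: rel_kern_def)
next
  case (snoc w i)
  define t where "t = mass (w @ [i]) / mass w"
  have t: "0 < t" "t \<le> 1"
    using ratio_bounds[OF snoc(1)] by (simp_all add: t_def)
  have t2: "0 \<le> t - t\<^sup>2"
    using t by (simp add: power2_eq_square mult_left_le)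
  have w: "w \<in> nodes"
    by (rule butlast_node[OF snoc(1)])
  have eq: "rel_kern (w @ [i]) = rel_kern w * t\<^sup>2 + rel_eig w * (t - t\<^sup>2)"
    unfolding t_def by (rule rel_kern_snoc[OF snoc(1)])
  have "rel_kern w * t\<^sup>2 + rel_eig w * (t - t\<^sup>2) \<le> real l * t\<^sup>2 + real l * (t - t\<^sup>2)"
    using snoc(2) rel_eig_le[OF w] t2 by (intro add_mono mult_right_mono) auto
  also have "\<dots> = real l * t"
    by (simp add: algebra_simps)
  also have "\<dots> \<le> real l"
    using t by (intro mult_left_le) auto
  finally show ?case
    using eq snoc(2) rel_eig_nonneg[OF w] t2 by simp
qed

lemma good_Nil: "good []"
  using kappa_le_half two_letters
  by (simp add: good_def rel_kern_def rel_eig_def eig_def children_Nil)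

text \<open>\<open>n\<close> counts the branching words passed since the last good prefix
  \<open>y\<close>. Each of them costs a factor \<open>\<kappa>\<close> of mass and lowers
  \<open>rel_kern\<close> by \<open>\<kappa> / 4\<close>, which the second inequality records; words
  with one child change neither quantity. The additional factor \<open>\<kappa>\<close> is the step
  from \<open>y\<close> to its child.\<close>

lemma good_prefix_count:
  assumes "w \<in> nodes" "w \<noteq> []"
  shows "\<exists>y n. good y \<and> length y < length w \<and> take (length y) w = y \<and>
    \<kappa> ^ Suc n * mass y \<le> mass w \<and> real n * (\<kappa> / 4) \<le> real l - rel_kern w"
  using assms
proof (induction w rule: node_induct)
  case (snoc w i)
  have w: "w \<in> nodes" "w @ [i] \<in> nodes"
    using snoc(1) butlast_node by auto
  have m: "\<kappa> * mass w \<le> mass (w @ [i])"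
    by (rule kappa_mass[OF snoc(1)])
  show ?case
  proof (cases "good w")
    case True
    then show ?thesis
      using m rel_kern_bounds[OF w(2)] by (intro exI[of _ w] exI[of _ 0]) simp
  next
    case False
    then have "w \<noteq> []"
      using good_Nil by blast
    then obtain y n where y: "good y" "length y < length w" "take (length y) w = y"
      "\<kappa> ^ Suc n * mass y \<le> mass w" "real n * (\<kappa> / 4) \<le> real l - rel_kern w"
      using snoc.IH by blast
    define t where "t = mass (w @ [i]) / mass w"
    have t: "0 < t" "t \<le> 1"
      using ratio_bounds[OF snoc(1)] by (simp_all add: t_def)
    have eq: "rel_kern (w @ [i]) = rel_kern w * t\<^sup>2 + rel_eig w * (t - t\<^sup>2)"
      unfolding t_def by (rule rel_kern_snoc[OF snoc(1)])
    show ?thesis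
    proof (cases "card (children w) \<ge> 2")
      case True
      have i: "i \<in> children w"
        using snoc(1) by (simp add: children_def)
      have t': "t \<le> 1 - \<kappa>"
        using mass_branching_child[OF True i] mass_pos[OF w(1)] by (simp add: t_def field_simps)
      have bad: "\<bar>rel_kern w - rel_eig w\<bar> < \<kappa> / 4"
        using False True w(1) unfolding good_def by linarith
      have s1: "1 - \<kappa> / 4 \<le> rel_kern w"
        using bad rel_eig_branching[OF w(1)] True by linarith
      have t2: "0 \<le> t - t\<^sup>2"
        using t by (simp add: power2_eq_square mult_left_le)
      have "(2 * t - 1)\<^sup>2 \<ge> 0"
        by simp
      then have t4: "t - t\<^sup>2 \<le> 1 / 4"
        by (simp add: power2_eq_square algebra_simps)
      \<comment> \<open>At a branching word that is not good, \<open>rel_eig\<close> exceeds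
        \<open>rel_kern\<close> by less than \<open>\<kappa> / 4\<close>. Up to this error the
        recursion is multiplication by \<open>t\<close>, and \<open>t \<le> 1 - \<kappa>\<close> by
        branching.\<close>
      have "rel_kern (w @ [i]) \<le> rel_kern w * t\<^sup>2 + (rel_kern w + \<kappa> / 4) * (t - t\<^sup>2)"
        unfolding eq using abs_less_iff[THEN iffD1, OF bad] t2
        by (intro add_left_mono mult_right_mono) linarith+
      also have "\<dots> = rel_kern w * t + \<kappa> / 4 * (t - t\<^sup>2)"
        by (simp add: algebra_simps)
      also have "\<dots> \<le> rel_kern w * (1 - \<kappa>) + \<kappa> / 4 * (1 / 4)"
        using t' t4 kappa_pos rel_kern_bounds[OF w(1)] by (intro add_mono mult_left_mono) auto
      also have "\<dots> \<le> rel_kern w - \<kappa> / 4"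
      proof -
        \<comment> \<open>\<open>5 / 16\<close> is the wanted drop \<open>1 / 4\<close> plus the
          error \<open>1 / 4 * (1 / 4)\<close>. It is available since \<open>rel_kern w\<close> is
          at least \<open>1 - \<kappa> / 4\<close>, that is, at least \<open>7 / 8\<close>.\<close>
        have "5 / 16 * \<kappa> \<le> rel_kern w * \<kappa>"
          using s1 kappa_pos kappa_le_half by (intro mult_right_mono) linarith+
        moreover have "rel_kern w * (1 - \<kappa>) = rel_kern w - rel_kern w * \<kappa>"
          by (simp add: right_diff_distrib)
        ultimately show ?thesis
          by linarith
      qed
      finally have drop: "rel_kern (w @ [i]) \<le> rel_kern w - \<kappa> / 4" .
      have "\<kappa> ^ Suc (Suc n) * mass y \<le> \<kappa> * mass w"
        using mult_left_mono[OF y(4), of \<kappa>] kappa_pos by simp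
      then have mass: "\<kappa> ^ Suc (Suc n) * mass y \<le> mass (w @ [i])"
        using m by (rule order_trans)
      have "real (Suc n) * (\<kappa> / 4) = real n * (\<kappa> / 4) + \<kappa> / 4"
        by (simp only: of_nat_Suc distrib_right mult_1)
      then have "real (Suc n) * (\<kappa> / 4) \<le> real l - rel_kern (w @ [i])"
        using y(5) drop by linarith
      then show ?thesis
        using y(1-3) mass by (intro exI[of _ y] exI[of _ "Suc n"] conjI) simp_all
    next
      case nb: False
      have "i \<in> children w" "card (children w) \<le> Suc 0"
        using nb snoc(1) by (simp_all add: children_def)
      then have "children w = {i}"
        using card_le_Suc0_iff_eq[OF finite_children[of w]] by auto
      then have "mass (w @ [i]) = mass w"
        using cyl_children[of w] by simp
      moreover from this have "t = 1"
        using mass_pos[OF w(1)] by (simp add: t_def)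
      moreover have "rel_eig w = 0"
        by (rule rel_eig_nonbranching[OF w(1) \<open>w \<noteq> []\<close> nb])
      ultimately show ?thesis
        using y eq by (intro exI[of _ y] exI[of _ n]) simp
    qed
  qed
qed simp

text \<open>Since \<open>rel_kern\<close> stays between 0 and \<open>l\<close>, at most
  \<open>4 * l / \<kappa>\<close> drops are possible.\<close>

lemma good_prefix:
  obtains c where "0 < c" "\<And>w. w \<in> nodes \<Longrightarrow> w \<noteq> [] \<Longrightarrow>
    \<exists>y. good y \<and> length y < length w \<and> take (length y) w = y \<and> c * mass y \<le> mass w"
proof -
  define N where "N = nat \<lceil>real l * 4 / \<kappa>\<rceil>"
  show ?thesis
  proof (rule that[of "\<kappa> ^ Suc N"])
    show "0 < \<kappa> ^ Suc N"
      using kappa_pos by simp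
    fix w assume w: "w \<in> nodes" "w \<noteq> []"
    obtain y n where y: "good y" "length y < length w" "take (length y) w = y"
      "\<kappa> ^ Suc n * mass y \<le> mass w" "real n * (\<kappa> / 4) \<le> real l - rel_kern w"
      using good_prefix_count[OF w] by blast
    have "real n * (\<kappa> / 4) \<le> real l"
      using y(5) rel_kern_bounds[OF w(1)] by linarith
    then have "real n \<le> real l * 4 / \<kappa>"
      using kappa_pos by (simp add: field_simps)
    then have "n \<le> N"
      unfolding N_def by linarith
    then have "\<kappa> ^ Suc N \<le> \<kappa> ^ Suc n"
      using kappa_le_half kappa_pos by (intro power_decreasing) auto
    then have "\<kappa> ^ Suc N * mass y \<le> \<kappa> ^ Suc n * mass y"
      by (rule mult_right_mono) simp
    then show "\<exists>y. good y \<and> length y < length w \<and> take (length y) w = y \<and> \<kappa> ^ Suc N * mass y \<le> mass w"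
      using y by (intro exI[of _ y]) simp
  qed
qed

text \<open>Goodness bounds the kernel below by \<open>\<kappa> / 4\<close> over the square of
  \<open>mass y\<close>, and comparability bounds the root of the product of masses below by
  \<open>c * mass y\<close>. The quotient leaves one power of \<open>mass y\<close>.\<close>

lemma Lip_good:
  assumes a: "a \<in> Lip" and y: "good y" and z: "z \<in> nodes" "z' \<in> nodes" and br: "branches y z z'"
    and c: "0 < c" "c * mass y \<le> mass z" "c * mass y \<le> mass z'"
  shows "cmod (av z a - av z' a) \<le> 4 / (\<kappa> * c) * mass y"
proof -
  have m: "0 < mass y"
    using y mass_pos by (simp add: good_def)
  have k: "\<kappa> / 4 \<le> \<bar>kern y\<bar> * (mass y)\<^sup>2"
    using y kern_eq[of y] by (simp add: good_def)
  have "(c * mass y)\<^sup>2 \<le> mass z * mass z'"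
    unfolding power2_eq_square using c m by (intro mult_mono) auto
  then have "c * mass y \<le> sqrt (mass z * mass z')"
    using c m by (intro real_le_rsqrt) auto
  then have "\<bar>kern y\<bar> * cmod (av z a - av z' a) * (c * mass y) \<le> 1"
    using Lip_off_diagonal[OF a z br]
    by (meson abs_ge_zero mult_left_mono mult_nonneg_nonneg norm_ge_zero order_trans)
  then have "\<bar>kern y\<bar> * cmod (av z a - av z' a) * (c * mass y) * mass y \<le> mass y"
    using m by (simp add: mult_left_le_one_le)
  then have "(\<bar>kern y\<bar> * (mass y)\<^sup>2) * (cmod (av z a - av z' a) * c) \<le> mass y"
    by (simp add: power2_eq_square mult_ac)
  moreover have "\<kappa> / 4 * (cmod (av z a - av z' a) * c) \<le> (\<bar>kern y\<bar> * (mass y)\<^sup>2) * (cmod (av z a - av z' a) * c)"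
    using k c by (intro mult_right_mono) auto
  ultimately have "\<kappa> / 4 * (cmod (av z a - av z' a) * c) \<le> mass y"
    by linarith
  then show ?thesis
    using kappa_pos c by (simp add: field_simps)
qed

text \<open>The cylinders of \<open>w\<close> and \<open>w @ [i]\<close> are nested, so the
  off-diagonal estimate does not compare them directly. Both are compared with a third cylinder,
  which branches off from them at a good prefix of comparable mass.\<close>

lemma Lip_av_step:
  obtains D where "0 < D" "\<And>a w i. a \<in> Lip \<Longrightarrow> w \<noteq> [] \<Longrightarrow> w @ [i] \<in> adm \<Longrightarrow>
    cmod (av (w @ [i]) a - av w a) \<le> D * mass w"
proof -
  obtain c where c: "0 < c" "\<And>w. w \<in> nodes \<Longrightarrow> w \<noteq> [] \<Longrightarrow>
    \<exists>y. good y \<and> length y < length w \<and> take (length y) w = y \<and> c * mass y \<le> mass w"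
    by (rule good_prefix) (rule that, assumption+)
  \<comment> \<open>One constant for the three cylinders: \<open>\<kappa>\<close> for the auxiliary
    child of \<open>y\<close>, \<open>c\<close> for \<open>w\<close> and \<open>\<kappa> * c\<close>
    for \<open>w @ [i]\<close>.\<close>
  define c' where "c' = min (\<kappa> * c) \<kappa>"
  have c': "0 < c'" "c' \<le> \<kappa> * c" "c' \<le> \<kappa>" "c' \<le> c"
  proof -
    show "0 < c'"
      using c(1) kappa_pos by (simp add: c'_def)
    show "c' \<le> c"
      using c(1) kappa_le_half kappa_pos mult_left_le_one_le[of c \<kappa>] by (simp add: c'_def min_def)
  qed (simp_all add: c'_def)
  define D where "D = 2 * (4 / (\<kappa> * c')) / c"
  have "cmod (av (w @ [i]) a - av w a) \<le> D * mass w"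
    if a: "a \<in> Lip" and w: "w \<noteq> []" and wi: "w @ [i] \<in> adm" for a w i
  proof -
    have nodes: "w \<in> nodes" "w @ [i] \<in> nodes"
      using wi butlast_node by auto
    obtain y where y: "good y" "length y < length w" "take (length y) w = y" "c * mass y \<le> mass w"
      using c(2)[OF nodes(1) w] by blast
    \<comment> \<open>A good word has at least two children, hence one that \<open>w\<close> does
      not pass through.\<close>
    have "\<not> children y \<subseteq> {w ! length y}"
      using y(1) card_mono[of "{w ! length y}" "children y"] by (auto simp: good_def)
    then obtain j where j: "j \<in> children y" "j \<noteq> w ! length y"
      by blast
    let ?z = "y @ [j]"
    have z: "?z \<in> nodes"
      using j by (simp add: children_def)
    have br: "branches y w ?z" "branches y (w @ [i]) ?z"
      using y j by (auto simp: branches_def nth_append)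
    have my: "0 \<le> mass y"
      by simp
    have mz: "c' * mass y \<le> mass ?z"
      using kappa_mass_child[OF j(1)] mult_right_mono[OF c'(3) my] by linarith
    have mw: "c' * mass y \<le> mass w"
      using y(4) mult_right_mono[OF c'(4) my] by linarith
    have mwi: "c' * mass y \<le> mass (w @ [i])"
    proof -
      have "c' * mass y \<le> \<kappa> * (c * mass y)"
        using mult_right_mono[OF c'(2) my] by simp
      also have "\<dots> \<le> \<kappa> * mass w"
        using y(4) kappa_pos by (intro mult_left_mono) auto
      finally show ?thesis
        using kappa_mass[OF wi] by linarith
    qed
    have "cmod (av (w @ [i]) a - av w a) \<le> cmod (av (w @ [i]) a - av ?z a) + cmod (av w a - av ?z a)"
      using norm_triangle_ineq4[of "av (w @ [i]) a - av ?z a" "av w a - av ?z a"] by simp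
    also have "\<dots> \<le> 4 / (\<kappa> * c') * mass y + 4 / (\<kappa> * c') * mass y"
      by (intro add_mono Lip_good[OF a y(1)] nodes z br c'(1) mz mw mwi)
    also have "\<dots> = 2 * (4 / (\<kappa> * c')) * mass y"
      by simp
    also have "\<dots> \<le> 2 * (4 / (\<kappa> * c')) * (mass w / c)"
      using y(4) c c' kappa_pos by (intro mult_left_mono) (auto simp: field_simps)
    finally show ?thesis
      by (simp add: D_def)
  qed
  then show ?thesis
    using that[of D] c c' kappa_pos by (auto simp: D_def)
qed

text \<open>The root is good, and each letter has mass at least \<open>\<kappa>\<close>.\<close>

lemma Lip_first_letter:
  assumes "a \<in> Lip" "i \<in> {1..l}" "j \<in> {1..l}"
  shows "cmod (av [i] a - av [j] a) \<le> 4 / (\<kappa> * \<kappa>)"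
proof (cases "i = j")
  case False
  have ij: "i \<in> children []" "j \<in> children []"
    using assms by (auto simp: children_Nil)
  have "branches [] [i] [j]"
    using False by (simp add: branches_def)
  moreover have "[i] \<in> nodes" "[j] \<in> nodes"
    using ij by (auto simp: children_def)
  moreover have "\<kappa> * mass [] \<le> mass [i]" "\<kappa> * mass [] \<le> mass [j]"
    using kappa_mass_child[OF ij(1)] kappa_mass_child[OF ij(2)] by simp_all
  ultimately show ?thesis
    using Lip_good[OF assms(1) good_Nil, of "[i]" "[j]" \<kappa>] kappa_pos by simp
qed simp

lemma cmod_av_minus_le:
  assumes "integrable \<mu> g" "w \<in> nodes" "\<And>\<omega>. \<omega> \<in> cyl w \<Longrightarrow> cmod (g \<omega> - c) \<le> e" "0 \<le> e"
  shows "cmod (av w g - c) \<le> e"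
proof -
  define f where "f \<omega> = indicator (cyl w) \<omega> * (g \<omega> - c)" for \<omega>
  have f: "integrable \<mu> f"
    unfolding f_def using assms(1) by (intro integrable_cyl) auto
  have "av w f = av w (\<lambda>\<omega>. g \<omega> - c)"
    by (rule av_cong) (simp add: f_def)
  also have "\<dots> = av w g - av w (\<lambda>_. c)"
    using assms(1) by (intro av_diff) auto
  also have "av w (\<lambda>_. c) = c"
    by (rule av_const[OF assms(2)]) simp
  finally have "av w g - c = av w f" ..
  moreover have "cmod (av w f) \<le> e"
    by (rule cmod_av_le_bound[OF f _ assms(2)]) (use assms(3,4) in \<open>auto simp: f_def indicator_def\<close>)
  ultimately show ?thesis
    by simp
qed

lemma av_prefix_tendsto:
  assumes "a \<in> cont_alg (shift_top l A)" "\<omega> \<in> X"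
  shows "(\<lambda>n. av (prefix_of n \<omega>) a) \<longlonglongrightarrow> a \<omega>"
proof (rule LIMSEQ_I)
  fix e :: real assume "e > 0"
  then obtain n where n: "\<And>\<upsilon>. \<upsilon> \<in> cyl (prefix_of n \<omega>) \<Longrightarrow> cmod (a \<upsilon> - a \<omega>) < e / 2"
    using cont_alg_cyl[OF assms, of "e / 2"] by (metis half_gt_zero)
  have "cmod (av (prefix_of m \<omega>) a - a \<omega>) \<le> e / 2" if "n \<le> m" for m
  proof (rule cmod_av_minus_le)
    fix \<upsilon> assume "\<upsilon> \<in> cyl (prefix_of m \<omega>)"
    then have "\<upsilon> \<in> cyl (prefix_of n \<omega>)"
      using that by (auto simp: in_cyl_iff prefix_of_eq_iff)
    then show "cmod (a \<upsilon> - a \<omega>) \<le> e / 2"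
      using n less_imp_le by blast
  qed (use \<open>e > 0\<close> assms prefix_of_nodes in \<open>auto intro: L2_integrable cont_alg_L2\<close>)
  then have "\<forall>m\<ge>n. norm (av (prefix_of m \<omega>) a - a \<omega>) < e"
    using \<open>e > 0\<close> by fastforce
  then show "\<exists>no. \<forall>m\<ge>no. norm (av (prefix_of m \<omega>) a - a \<omega>) < e"
    by blast
qed

text \<open>Along a path the averages change by multiples of the masses, which decay geometrically,
  and they converge to the value at the end point. Two points with a common prefix are compared
  through the average over it.\<close>

lemma Lip_modulus:
  obtains \<delta> :: "nat \<Rightarrow> real" where "\<delta> \<longlonglongrightarrow> 0"
    "\<And>a n \<omega> \<upsilon>. a \<in> Lip \<Longrightarrow> \<omega> \<in> X \<Longrightarrow> \<upsilon> \<in> X \<Longrightarrow> prefix_of n \<omega> = prefix_of n \<upsilon> \<Longrightarrow>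
      cmod (a \<omega> - a \<upsilon>) \<le> \<delta> n"
proof -
  obtain C \<rho> where C: "0 < C" "0 < \<rho>" "\<rho> < 1"
    "\<And>\<omega> n. \<omega> \<in> X \<Longrightarrow> sqrt (mass (prefix_of n \<omega>)) \<le> C * \<rho> ^ n"
    by (rule sqrt_mass_decay) (rule that, assumption+)
  obtain D where D: "0 < D" "\<And>a w i. a \<in> Lip \<Longrightarrow> w \<noteq> [] \<Longrightarrow> w @ [i] \<in> adm \<Longrightarrow>
    cmod (av (w @ [i]) a - av w a) \<le> D * mass w"
    by (rule Lip_av_step) (rule that, assumption+)
  define b where "b = D * C / (1 - \<rho>)"
  have b: "0 \<le> b"
    using C D by (simp add: b_def)
  have step: "cmod (av (prefix_of (Suc n) \<omega>) a - av (prefix_of n \<omega>) a) \<le> D * C * \<rho> ^ n"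
    if "a \<in> Lip" "\<omega> \<in> X" "n \<ge> 1" for a \<omega> n
  proof -
    \<comment> \<open>Masses are at most 1, so the decay of their square roots suffices.\<close>
    have "mass (prefix_of n \<omega>) \<le> sqrt (mass (prefix_of n \<omega>))"
      by (simp add: sqrt_ge_absD real_le_rsqrt power2_eq_square mult_left_le)
    also have "\<dots> \<le> C * \<rho> ^ n"
      by (rule C(4)[OF that(2)])
    finally have "D * mass (prefix_of n \<omega>) \<le> D * (C * \<rho> ^ n)"
      using D(1) by (intro mult_left_mono) auto
    then show ?thesis
      using D(2)[OF that(1), of "prefix_of n \<omega>" "\<omega> n"] that(3) children_prefix_of[OF that(2), of n]
      by (simp add: prefix_of_Suc children_def mult.assoc)
  qed
  have tail: "cmod (a \<omega> - av (prefix_of n \<omega>) a) \<le> b * \<rho> ^ n"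
    if a: "a \<in> Lip" and \<omega>: "\<omega> \<in> X" and n: "n \<ge> 1" for a \<omega> n
  proof -
    have "cmod (av (prefix_of (n + k) \<omega>) a - av (prefix_of n \<omega>) a) \<le> (\<Sum>j<k. D * C * \<rho> ^ (n + j))" for k
    proof (induction k)
      case (Suc k)
      have "cmod (av (prefix_of (n + Suc k) \<omega>) a - av (prefix_of n \<omega>) a)
          \<le> cmod (av (prefix_of (Suc (n + k)) \<omega>) a - av (prefix_of (n + k) \<omega>) a)
            + cmod (av (prefix_of (n + k) \<omega>) a - av (prefix_of n \<omega>) a)"
        using norm_triangle_ineq[of "av (prefix_of (Suc (n + k)) \<omega>) a - av (prefix_of (n + k) \<omega>) a"
            "av (prefix_of (n + k) \<omega>) a - av (prefix_of n \<omega>) a"] by simp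
      then show ?case
        using Suc step[OF a \<omega>, of "n + k"] n by simp
    qed simp
    moreover have "(\<Sum>j<k. D * C * \<rho> ^ (n + j)) \<le> b * \<rho> ^ n" for k
    proof -
      have "(\<Sum>j<k. D * C * \<rho> ^ (n + j)) = D * C * \<rho> ^ n * (\<Sum>j<k. \<rho> ^ j)"
        by (simp add: sum_distrib_left power_add mult_ac)
      also have "(\<Sum>j<k. \<rho> ^ j) \<le> 1 / (1 - \<rho>)"
        using C by (subst geometric_sum) (auto simp: field_simps)
      finally show ?thesis
        using C D by (simp add: b_def mult_ac)
    qed
    ultimately have le: "cmod (av (prefix_of (n + k) \<omega>) a - av (prefix_of n \<omega>) a) \<le> b * \<rho> ^ n" for k
      using order_trans by blast
    have "(\<lambda>k. av (prefix_of (k + n) \<omega>) a) \<longlonglongrightarrow> a \<omega>"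
      using a by (intro LIMSEQ_ignore_initial_segment av_prefix_tendsto \<omega>) (simp add: Lip_def)
    then have "(\<lambda>k. cmod (av (prefix_of (n + k) \<omega>) a - av (prefix_of n \<omega>) a))
        \<longlonglongrightarrow> cmod (a \<omega> - av (prefix_of n \<omega>) a)"
      by (intro tendsto_intros) (simp add: add.commute)
    then show ?thesis
      by (rule LIMSEQ_le_const2) (use le in blast)
  qed
  \<comment> \<open>The factor 2 stands for the two points. At \<open>n = 0\<close> there is no
    common letter, and the averages over the first letters have to be compared in addition.\<close>
  define \<delta> where "\<delta> n = (if n = 0 then 2 * b + 4 / (\<kappa> * \<kappa>) else 2 * b * \<rho> ^ n)" for n
  show ?thesis
  proof (rule that)
    have "(\<lambda>n. 2 * b * \<rho> ^ n) \<longlonglongrightarrow> 0"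
      using C by (intro tendsto_mult_right_zero LIMSEQ_realpow_zero) auto
    moreover have "\<forall>\<^sub>F n in sequentially. 2 * b * \<rho> ^ n = \<delta> n"
      unfolding eventually_sequentially by (intro exI[of _ 1]) (auto simp: \<delta>_def)
    ultimately show "\<delta> \<longlonglongrightarrow> 0"
      by (rule Lim_transform_eventually)
    fix a n \<omega> \<upsilon> assume a: "a \<in> Lip" and X: "\<omega> \<in> X" "\<upsilon> \<in> X" and eq: "prefix_of n \<omega> = prefix_of n \<upsilon>"
    show "cmod (a \<omega> - a \<upsilon>) \<le> \<delta> n"
    proof (cases "n = 0")
      case False
      then show ?thesis
        using tail[OF a X(1), of n] tail[OF a X(2), of n] eq
          norm_triangle_ineq4[of "a \<omega> - av (prefix_of n \<omega>) a" "a \<upsilon> - av (prefix_of n \<upsilon>) a"]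
        by (simp add: \<delta>_def)
    next
      case True
      have 1: "cmod (a \<omega> - av [\<omega> 0] a) \<le> b * \<rho>" "cmod (a \<upsilon> - av [\<upsilon> 0] a) \<le> b * \<rho>"
        using tail[OF a X(1), of 1] tail[OF a X(2), of 1] by (simp_all add: prefix_of_Suc)
      have 2: "cmod (av [\<omega> 0] a - av [\<upsilon> 0] a) \<le> 4 / (\<kappa> * \<kappa>)"
        by (intro Lip_first_letter a letter_in_alphabet X)
      have 3: "b * \<rho> \<le> b"
        using b C by (simp add: mult_left_le)
      have "a \<omega> - a \<upsilon> = (a \<omega> - av [\<omega> 0] a) + (av [\<omega> 0] a - av [\<upsilon> 0] a) - (a \<upsilon> - av [\<upsilon> 0] a)"
        by simp
      then have "cmod (a \<omega> - a \<upsilon>) \<le> cmod (a \<omega> - av [\<omega> 0] a) + cmod (av [\<omega> 0] a - av [\<upsilon> 0] a)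
          + cmod (a \<upsilon> - av [\<upsilon> 0] a)"
        by (simp only:) (intro order_trans[OF norm_triangle_ineq4] add_mono order_refl norm_triangle_ineq)
      then show ?thesis
        using 1 2 3 True by (simp add: \<delta>_def)
    qed
  qed
qed

section \<open>States\<close>

abbreviation "CA \<equiv> cont_alg (shift_top l A)"
abbreviation "S \<equiv> state_space (shift_top l A)"

text \<open>The condition at \<open>(0, 0)\<close> preserves the value 0 off the space; continuity
  on pairs treats all pointwise operations at once.\<close>

lemma CA_combine:
  fixes F :: "complex \<times> complex \<Rightarrow> complex"
  assumes "a \<in> CA" "b \<in> CA" "continuous_on UNIV F" "F (0, 0) = 0"
  shows "(\<lambda>x. F (a x, b x)) \<in> CA"
proof -
  have "continuous_map (shift_top l A) (prod_topology euclidean euclidean) (\<lambda>x. (a x, b x))"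
    using assms(1,2) by (intro continuous_map_pairedI) (auto simp: cont_alg_def)
  then have "continuous_map (shift_top l A) euclidean (F \<circ> (\<lambda>x. (a x, b x)))"
    by (rule continuous_map_compose) (simp add: euclidean_product_topology assms(3))
  then show ?thesis
    using assms by (auto simp: cont_alg_def o_def)
qed

lemma CA_add: "a \<in> CA \<Longrightarrow> b \<in> CA \<Longrightarrow> (\<lambda>x. a x + b x) \<in> CA"
  using CA_combine[of a b "\<lambda>p. fst p + snd p"] by (simp add: continuous_intros)

lemma CA_diff: "a \<in> CA \<Longrightarrow> b \<in> CA \<Longrightarrow> (\<lambda>x. a x - b x) \<in> CA"
  using CA_combine[of a b "\<lambda>p. fst p - snd p"] by (simp add: continuous_intros)

lemma CA_scale: "a \<in> CA \<Longrightarrow> (\<lambda>x. z * a x) \<in> CA"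
  using CA_combine[of a a "\<lambda>p. z * fst p"] by (simp add: continuous_intros)

lemma CA_indicator: "(indicator (cyl w)) \<in> CA"
  by (rule cyl_fun_cont_alg[OF cyl_fun_indicator[OF order_refl]])

lemma CA_one: "(indicator X) \<in> CA"
  using CA_indicator[of "[]"] by simp

lemma state_add: "p \<in> S \<Longrightarrow> a \<in> CA \<Longrightarrow> b \<in> CA \<Longrightarrow> p (\<lambda>x. a x + b x) = p a + p b"
  by (simp add: state_space_def)

lemma state_scale: "p \<in> S \<Longrightarrow> a \<in> CA \<Longrightarrow> p (\<lambda>x. z * a x) = z * p a"
  by (simp add: state_space_def)

lemma state_positive: "p \<in> S \<Longrightarrow> a \<in> CA \<Longrightarrow> p (\<lambda>x. cnj (a x) * a x) \<in> \<real>\<^sub>\<ge>\<^sub>0"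
  by (simp add: state_space_def)

lemma state_diff:
  assumes "p \<in> S" "a \<in> CA" "b \<in> CA"
  shows "p (\<lambda>x. a x - b x) = p a - p b"
  using state_add[OF assms(1,2) CA_scale[OF assms(3)], of "-1"] state_scale[OF assms(1,3), of "-1"]
  by simp

lemma state_sum:
  assumes "p \<in> S" "finite I" "\<And>i. i \<in> I \<Longrightarrow> f i \<in> CA"
  shows "(\<lambda>x. \<Sum>i\<in>I. f i x) \<in> CA \<and> p (\<lambda>x. \<Sum>i\<in>I. f i x) = (\<Sum>i\<in>I. p (f i))"
  using assms(2,3)
proof (induction I rule: finite_induct)
  case empty
  show ?case
    using CA_scale[OF CA_one, of 0] state_scale[OF assms(1) CA_one, of 0] by simp
next
  case (insert i I)
  then show ?case
    using CA_add[of "f i" "\<lambda>x. \<Sum>i\<in>I. f i x"] state_add[OF assms(1), of "f i" "\<lambda>x. \<Sum>i\<in>I. f i x"]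
    by simp
qed

lemma state_norm: "p \<in> S \<Longrightarrow>
    (SUP a \<in> {a \<in> CA. \<forall>x\<in>X. cmod (a x) \<le> 1}. ereal (cmod (p a))) = 1"
  by (simp add: state_space_def)

lemma state_le_1:
  assumes "p \<in> S" "a \<in> CA" "\<And>x. x \<in> X \<Longrightarrow> cmod (a x) \<le> 1"
  shows "cmod (p a) \<le> 1"
proof -
  have "ereal (cmod (p a)) \<le> (SUP a \<in> {a \<in> CA. \<forall>x\<in>X. cmod (a x) \<le> 1}. ereal (cmod (p a)))"
    by (rule SUP_upper) (use assms in auto)
  then show ?thesis
    unfolding state_norm[OF assms(1)] by simp
qed

lemma state_bound:
  assumes "p \<in> S" "a \<in> CA" "\<And>x. x \<in> X \<Longrightarrow> cmod (a x) \<le> B" "0 \<le> B"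
  shows "cmod (p a) \<le> B"
proof (cases "B = 0")
  case True
  then have "a = (\<lambda>x. 0 * a x)"
    using assms by (auto simp: cont_alg_def fun_eq_iff)
  then have "p a = 0 * p a"
    using state_scale[OF assms(1,2), of 0] by simp
  then show ?thesis
    using True by simp
next
  case False
  have "cmod (p (\<lambda>x. of_real (1 / B) * a x)) \<le> 1"
  proof (rule state_le_1[OF assms(1) CA_scale[OF assms(2)]])
    fix x assume "x \<in> X"
    then show "cmod (of_real (1 / B) * a x) \<le> 1"
      unfolding norm_mult norm_of_real using False assms(3)[of x] assms(4) by (simp add: field_simps)
  qed
  then have "1 / B * cmod (p a) \<le> 1"
    unfolding state_scale[OF assms(1,2)] norm_mult norm_of_real using assms(4) by simp
  then show ?thesis
    using False assms(4) by (simp add: field_simps)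
qed

text \<open>\<open>1 - f\<close> is the square of a real continuous function, hence of the form to
  which positivity of the state applies.\<close>

lemma state_real_le:
  assumes p: "p \<in> S" and f: "f \<in> CA" "\<And>x. x \<in> X \<Longrightarrow> Im (f x) = 0" "\<And>x. x \<in> X \<Longrightarrow> Re (f x) \<le> 1"
  shows "p (indicator X) - p f \<in> \<real>\<^sub>\<ge>\<^sub>0"
proof -
  \<comment> \<open>The absolute value makes the root continuous on all of the complex plane, off
    the range of \<open>f\<close> as well.\<close>
  define g where "g x = indicator X x * complex_of_real (sqrt \<bar>1 - Re (f x)\<bar>)" for x
  have g: "g \<in> CA"
    unfolding g_def
    using CA_combine[OF CA_one f(1), of "\<lambda>p. fst p * complex_of_real (sqrt \<bar>1 - Re (snd p)\<bar>)"]
    by (simp add: continuous_intros)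
  have "cnj (g x) * g x = indicator X x - f x" for x
  proof (cases "x \<in> X")
    case True
    have "cnj (g x) * g x = complex_of_real (sqrt \<bar>1 - Re (f x)\<bar> * sqrt \<bar>1 - Re (f x)\<bar>)"
      using True by (simp add: g_def del: real_sqrt_mult_self)
    also have "sqrt \<bar>1 - Re (f x)\<bar> * sqrt \<bar>1 - Re (f x)\<bar> = 1 - Re (f x)"
      using f(3)[OF True] by simp
    also have "complex_of_real (1 - Re (f x)) = indicator X x - f x"
      using True f(2)[OF True] by (simp add: complex_eq_iff)
    finally show ?thesis .
  next
    case False
    then show ?thesis
      using f(1) by (simp add: g_def cont_alg_def)
  qed
  then show ?thesis
    using state_positive[OF p g] state_diff[OF p CA_one f(1)] by simp
qed

text \<open>States are defined by positivity and norm 1, so this needs an argument: positivity makes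
  the value at the unit dominate every value on the unit ball, hence equal to the norm.\<close>

lemma state_one:
  assumes p: "p \<in> S"
  shows "p (indicator X) = 1"
proof -
  let ?one = "indicator X :: _ \<Rightarrow> complex"
  have "(\<lambda>x. cnj (?one x) * ?one x) = ?one"
    by (auto simp: fun_eq_iff indicator_def)
  then have p1: "p ?one \<in> \<real>\<^sub>\<ge>\<^sub>0"
    using state_positive[OF p CA_one] by simp
  have "cmod (p a) \<le> Re (p ?one)" if a: "a \<in> CA" "\<forall>x\<in>X. cmod (a x) \<le> 1" for a
  proof -
    \<comment> \<open>A phase that turns \<open>p a\<close> into its modulus, so that only the real
      part of \<open>b\<close> has to be estimated.\<close>
    define u where "u = (if p a = 0 then 1 else cnj (p a) / of_real (cmod (p a)))"
    have u: "cmod u = 1" "u * p a = of_real (cmod (p a))"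
      using complex_norm_square[of "p a"]
      by (auto simp: u_def norm_divide power2_eq_square field_simps)
    define b where "b x = u * a x" for x
    have b: "b \<in> CA" "p b = of_real (cmod (p a))"
      using CA_scale[OF a(1), of u] state_scale[OF p a(1), of u] u(2) by (simp_all add: b_def[abs_def])
    have b1: "cmod (b x) \<le> 1" if "x \<in> X" for x
      using a(2) that u(1) by (simp add: b_def norm_mult)
    define f1 where "f1 x = complex_of_real (Re (b x))" for x
    define f2 where "f2 x = complex_of_real (Im (b x))" for x
    have f: "f1 \<in> CA" "f2 \<in> CA"
      unfolding f1_def f2_def
      using CA_combine[OF b(1) b(1), of "\<lambda>p. complex_of_real (Re (fst p))"]
        CA_combine[OF b(1) b(1), of "\<lambda>p. complex_of_real (Im (fst p))"]
      by (simp_all add: continuous_intros)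
    have le: "Re (b x) \<le> 1" "Im (b x) \<le> 1" if "x \<in> X" for x
      using b1[OF that] complex_Re_le_cmod[of "b x"] abs_Im_le_cmod[of "b x"] by linarith+
    \<comment> \<open>The first difference gives the estimate. The second shows that
      \<open>p f2\<close> is real, so the imaginary part of \<open>b\<close> does not contribute to
      the real part of \<open>p b\<close>.\<close>
    have "p ?one - p f1 \<in> \<real>\<^sub>\<ge>\<^sub>0" "p ?one - p f2 \<in> \<real>\<^sub>\<ge>\<^sub>0"
      by (rule state_real_le[OF p f(1)], auto simp: f1_def le)
        (rule state_real_le[OF p f(2)], auto simp: f2_def le)
    then have r: "Re (p f1) \<le> Re (p ?one)" "Im (p f2) = 0"
      using p1 by (auto simp: complex_nonneg_Reals_iff)
    have "b = (\<lambda>x. f1 x + \<i> * f2 x)"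
      by (auto simp: f1_def f2_def fun_eq_iff complex_eq_iff)
    then have "p b = p f1 + \<i> * p f2"
      using state_add[OF p f(1) CA_scale[OF f(2)], of \<i>] state_scale[OF p f(2), of \<i>] by simp
    then have "Re (p b) = Re (p f1)"
      using r(2) by simp
    then show ?thesis
      using b(2) r(1) by simp
  qed
  then have "(SUP a \<in> {a \<in> CA. \<forall>x\<in>X. cmod (a x) \<le> 1}. ereal (cmod (p a))) \<le> ereal (Re (p ?one))"
    by (intro SUP_least) simp
  then have "1 \<le> Re (p ?one)"
    unfolding state_norm[OF p] by (simp add: one_ereal_def)
  moreover have "cmod (p ?one) \<le> 1"
    by (rule state_le_1[OF p CA_one]) (simp add: indicator_def)
  ultimately show ?thesis
    using p1 complex_Re_le_cmod[of "p ?one"] by (simp add: complex_nonneg_Reals_iff complex_eq_iff)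
qed

lemma state_extensional: "p \<in> S \<Longrightarrow> p \<in> extensional CA"
  by (simp add: state_space_def)

lemma Lip_CA: "a \<in> Lip \<Longrightarrow> a \<in> CA"
  by (simp add: Lip_def)

lemma Lip_of_cyl_fun:
  assumes "cyl_fun n b"
  obtains c :: real where "c > 0" "(\<lambda>x. of_real c * b x) \<in> Lip"
proof -
  obtain c :: real where "c > 0"
    "densely_defined \<mu> (commutator dirac_graph mult_rep (\<lambda>x. of_real c * b x))"
    "extends_boundedly \<mu> 1 (commutator dirac_graph mult_rep (\<lambda>x. of_real c * b x))"
    by (rule scaled_cyl_fun_unit_ball[OF assms]) (rule that, assumption+)
  then show ?thesis
    using that cyl_fun_cont_alg[OF cyl_fun_scale[OF assms, of "of_real c"]] by (simp add: Lip_def)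
qed

lemma zero_Lip: "(\<lambda>_. 0) \<in> Lip"
  using Lip_of_cyl_fun[OF cyl_fun_zero[of 0]] by auto

text \<open>A quantitative form of total boundedness: up to \<open>2 * \<delta> n\<close>, uniformly
  over \<open>Lip\<close>, the difference of two states is controlled by their values at finitely
  many indicators.\<close>

lemma Lip_state_diff:
  assumes \<delta>: "\<And>a n \<omega> \<upsilon>. a \<in> Lip \<Longrightarrow> \<omega> \<in> X \<Longrightarrow> \<upsilon> \<in> X \<Longrightarrow> prefix_of n \<omega> = prefix_of n \<upsilon> \<Longrightarrow>
      cmod (a \<omega> - a \<upsilon>) \<le> \<delta> n"
    and p: "p \<in> S" and q: "q \<in> S" and a: "a \<in> Lip"
  shows "cmod (p a - q a) \<le> 2 * \<delta> n
    + \<delta> 0 * (\<Sum>w\<in>level n. cmod (p (indicator (cyl w)) - q (indicator (cyl w))))"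
proof -
  let ?i = "\<lambda>w. indicator (cyl w) :: (nat \<Rightarrow> nat) \<Rightarrow> complex"
  obtain o0 where o0: "o0 \<in> X"
    using node_extends[of "[]"] by auto
  have \<delta>0: "0 \<le> \<delta> m" for m
    using order_trans[OF norm_ge_zero \<delta>[OF a o0 o0 refl]] .
  \<comment> \<open>Subtracting the value at a base point changes no difference of states, as both
    send the unit to 1, and it bounds all coefficients by \<open>\<delta> 0\<close>.\<close>
  define v where "v w = value_on w a - a o0" for w
  have pt: "\<exists>\<upsilon>. \<upsilon> \<in> cyl w \<and> value_on w a = a \<upsilon>" if w: "w \<in> level n" for w
  proof -
    obtain \<omega> where "\<omega> \<in> cyl w"
      by (rule node_extends[OF level_node[OF w]])
    then have "(SOME \<omega>. \<omega> \<in> cyl w) \<in> cyl w"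
      by (rule someI[of "\<lambda>\<omega>. \<omega> \<in> cyl w"])
    then show ?thesis
      unfolding value_on_def by blast
  qed
  have v: "cmod (v w) \<le> \<delta> 0" if w: "w \<in> level n" for w
  proof -
    obtain \<upsilon> where "\<upsilon> \<in> cyl w" "value_on w a = a \<upsilon>"
      using pt[OF w] by blast
    then show ?thesis
      using \<delta>[OF a _ o0, of \<upsilon> 0] cyl_subset by (auto simp: v_def)
  qed
  define f where "f x = (\<Sum>w\<in>level n. v w * ?i w x)" for x
  define r where "r x = (a x - a o0 * indicator X x) - f x" for x
  have a0: "(\<lambda>x. a x - a o0 * indicator X x) \<in> CA"
    by (intro CA_diff CA_scale CA_one Lip_CA a)
  have state_f: "f \<in> CA \<and> s f = (\<Sum>w\<in>level n. v w * s (?i w))" if "s \<in> S" for s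
    unfolding f_def[abs_def] using state_sum[OF that, of "level n" "\<lambda>w x. v w * ?i w x"]
    by (simp add: CA_scale CA_indicator state_scale[OF that])
  have r: "r \<in> CA"
    unfolding r_def[abs_def] by (intro CA_diff a0) (use state_f[OF p] in blast)
  have r_le: "cmod (r x) \<le> \<delta> n" if x: "x \<in> X" for x
  proof -
    obtain \<upsilon> where \<upsilon>: "\<upsilon> \<in> cyl (prefix_of n x)" "value_on (prefix_of n x) a = a \<upsilon>"
      using pt[OF prefix_of_level[OF x]] by blast
    have "f x = v (prefix_of n x)"
      unfolding f_def by (rule sum_level[OF x])
    then have "r x = a x - a \<upsilon>"
      using x \<upsilon>(2) by (simp add: r_def v_def)
    then show ?thesis
      using \<delta>[OF a x, of \<upsilon> n] \<upsilon>(1) by (simp add: in_cyl_iff)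
  qed
  have dec: "s a = a o0 + (\<Sum>w\<in>level n. v w * s (?i w)) + s r" if s: "s \<in> S" for s
  proof -
    have "s r = (s a - a o0 * s (indicator X)) - s f"
      unfolding r_def[abs_def] using state_f[OF s]
      by (simp add: state_diff[OF s] a0 CA_scale CA_one Lip_CA[OF a] state_scale[OF s])
    then show ?thesis
      using state_f[OF s] state_one[OF s] by simp
  qed
  have "p a - q a = (\<Sum>w\<in>level n. v w * (p (?i w) - q (?i w))) + (p r - q r)"
    unfolding dec[OF p] dec[OF q] by (simp add: right_diff_distrib sum_subtractf)
  then have "cmod (p a - q a) \<le> cmod (\<Sum>w\<in>level n. v w * (p (?i w) - q (?i w))) + (cmod (p r) + cmod (q r))"
    by (simp only:) (intro order_trans[OF norm_triangle_ineq] add_mono order_refl norm_triangle_ineq4)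
  also have "cmod (\<Sum>w\<in>level n. v w * (p (?i w) - q (?i w))) \<le> (\<Sum>w\<in>level n. \<delta> 0 * cmod (p (?i w) - q (?i w)))"
    by (rule sum_norm_le) (simp add: norm_mult v mult_right_mono)
  also have "cmod (p r) + cmod (q r) \<le> \<delta> n + \<delta> n"
    by (intro add_mono state_bound[OF p r r_le \<delta>0] state_bound[OF q r r_le \<delta>0])
  finally show ?thesis
    by (simp add: sum_distrib_left)
qed

section \<open>The metric on the state space\<close>

definition dist_C :: "(((nat \<Rightarrow> nat) \<Rightarrow> complex) \<Rightarrow> complex) \<Rightarrow> (((nat \<Rightarrow> nat) \<Rightarrow> complex) \<Rightarrow> complex) \<Rightarrow> ereal" where
  "dist_C = connes_dist (shift_top l A) \<mu> mult_rep dirac_graph"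

lemma dist_C_SUP: "dist_C p q = (SUP a \<in> Lip. ereal (cmod (p a - q a)))"
  by (simp add: dist_C_def connes_dist_def Lip_def)

lemma dist_C_finite:
  assumes "p \<in> S" "q \<in> S"
  shows "\<bar>dist_C p q\<bar> \<noteq> \<infinity>"
proof -
  obtain \<delta> :: "nat \<Rightarrow> real" where \<delta>: "\<delta> \<longlonglongrightarrow> 0"
    "\<And>a n \<omega> \<upsilon>. a \<in> Lip \<Longrightarrow> \<omega> \<in> X \<Longrightarrow> \<upsilon> \<in> X \<Longrightarrow> prefix_of n \<omega> = prefix_of n \<upsilon> \<Longrightarrow>
      cmod (a \<omega> - a \<upsilon>) \<le> \<delta> n"
    by (rule Lip_modulus) (rule that, assumption+)
  \<comment> \<open>Length 0 is enough for finiteness.\<close>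
  let ?B = "2 * \<delta> 0 + \<delta> 0 * (\<Sum>w\<in>level 0. cmod (p (indicator (cyl w)) - q (indicator (cyl w))))"
  have "dist_C p q \<le> ereal ?B"
    unfolding dist_C_SUP
  proof (intro SUP_least)
    fix a assume a: "a \<in> Lip"
    show "ereal (cmod (p a - q a)) \<le> ereal ?B"
      unfolding ereal_less_eq(3) by (rule Lip_state_diff[OF \<delta>(2) assms a])
  qed
  moreover have "0 \<le> dist_C p q"
    unfolding dist_C_SUP by (rule SUP_upper2[OF zero_Lip]) simp
  ultimately show ?thesis
    by auto
qed

definition rdist :: "(((nat \<Rightarrow> nat) \<Rightarrow> complex) \<Rightarrow> complex) \<Rightarrow> (((nat \<Rightarrow> nat) \<Rightarrow> complex) \<Rightarrow> complex) \<Rightarrow> real" where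
  "rdist p q = real_of_ereal (dist_C p q)"

lemma ereal_rdist: "p \<in> S \<Longrightarrow> q \<in> S \<Longrightarrow> ereal (rdist p q) = dist_C p q"
  unfolding rdist_def using dist_C_finite by (simp add: ereal_real)

lemma le_rdist:
  assumes "p \<in> S" "q \<in> S" "a \<in> Lip"
  shows "cmod (p a - q a) \<le> rdist p q"
proof -
  have "ereal (cmod (p a - q a)) \<le> ereal (rdist p q)"
    unfolding ereal_rdist[OF assms(1,2)] dist_C_SUP by (rule SUP_upper[OF assms(3)])
  then show ?thesis
    by simp
qed

lemma rdist_le:
  assumes "p \<in> S" "q \<in> S" "\<And>a. a \<in> Lip \<Longrightarrow> cmod (p a - q a) \<le> B"
  shows "rdist p q \<le> B"
proof -
  have "ereal (rdist p q) \<le> ereal B"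
    unfolding ereal_rdist[OF assms(1,2)] dist_C_SUP by (intro SUP_least) (simp add: assms(3))
  then show ?thesis
    by simp
qed

lemma rdist_nonneg: "p \<in> S \<Longrightarrow> q \<in> S \<Longrightarrow> 0 \<le> rdist p q"
  using le_rdist[OF _ _ zero_Lip] norm_ge_zero order_trans by blast

text \<open>Evaluation at \<open>a\<close> is continuous for the metric: \<open>a\<close> is
  uniformly close to a locally constant \<open>f\<close>, and a positive multiple
  \<open>c * f\<close> lies in \<open>Lip\<close>. This is where density of the multiples of
  \<open>Lip\<close> is used.\<close>

lemma state_close:
  assumes p: "p \<in> S" and q: "q \<in> S" and a: "a \<in> CA" and e: "e > 0"
  obtains r where "r > 0" "\<And>q. q \<in> S \<Longrightarrow> rdist p q < r \<Longrightarrow> cmod (p a - q a) < e"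
proof -
  obtain n f where f: "cyl_fun n f" "\<And>\<omega>. cmod (a \<omega> - f \<omega>) < e / 3"
    by (rule cont_alg_approx[OF a, of "e / 3"]) (use e in simp, rule that, assumption+)
  obtain c :: real where c: "c > 0" "(\<lambda>x. of_real c * f x) \<in> Lip"
    by (rule Lip_of_cyl_fun[OF f(1)]) (rule that, assumption+)
  have fCA: "f \<in> CA"
    by (rule cyl_fun_cont_alg[OF f(1)])
  have "cmod (p a - q a) < e" if q: "q \<in> S" and d: "rdist p q < c * (e / 3)" for q
  proof -
    have "cmod (of_real c * p f - of_real c * q f) < c * (e / 3)"
      using le_rdist[OF p q c(2)] d state_scale[OF p fCA] state_scale[OF q fCA] by simp
    then have "c * cmod (p f - q f) < c * (e / 3)"
      using c(1) by (simp add: norm_mult flip: right_diff_distrib)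
    then have pf: "cmod (p f - q f) < e / 3"
      using c(1) by simp
    have af: "cmod (s a - s f) \<le> e / 3" if "s \<in> S" for s
      unfolding state_diff[OF that a fCA, symmetric]
      by (rule state_bound[OF that CA_diff[OF a fCA]]) (use f(2) less_imp_le e in auto)
    have "p a - q a = (p a - p f) + (p f - q f) - (q a - q f)"
      by simp
    then have "cmod (p a - q a) \<le> cmod (p a - p f) + cmod (p f - q f) + cmod (q a - q f)"
      by (simp only:) (intro order_trans[OF norm_triangle_ineq4] add_mono order_refl norm_triangle_ineq)
    then show ?thesis
      using af[OF p] af[OF q] pf by linarith
  qed
  then show ?thesis
    using that[of "c * (e / 3)"] c(1) e by simp
qed

lemma rdist_commute: "rdist p q = rdist q p"
  by (simp add: rdist_def dist_C_SUP norm_minus_commute)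

lemma rdist_eq_0_iff:
  assumes p: "p \<in> S" and q: "q \<in> S"
  shows "rdist p q = 0 \<longleftrightarrow> p = q"
proof
  assume 0: "rdist p q = 0"
  show "p = q"
  proof (rule extensionalityI[OF state_extensional[OF p] state_extensional[OF q]])
    fix a assume a: "a \<in> CA"
    have "cmod (p a - q a) < e" if e: "e > 0" for e
    proof -
      obtain r where "r > 0" "\<And>q. q \<in> S \<Longrightarrow> rdist p q < r \<Longrightarrow> cmod (p a - q a) < e"
        by (rule state_close[OF p q a e]) (rule that, assumption+)
      then show ?thesis
        using q 0 by simp
    qed
    then have "\<not> 0 < cmod (p a - q a)"
      by blast
    then show "p a = q a"
      by simp
  qed
next
  assume "p = q"
  then have "rdist p q \<le> 0"
    by (intro rdist_le p q) simp
  then show "rdist p q = 0"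
    using rdist_nonneg[OF p q] by simp
qed

lemma Metric_space_rdist: "Metric_space S rdist"
proof
  \<comment> \<open>\<open>Metric_space\<close> asks for this, and for symmetry, at all functionals
    and not just at states.\<close>
  show "0 \<le> rdist p q" for p q
  proof -
    have "0 \<le> dist_C p q"
      unfolding dist_C_SUP by (rule SUP_upper2[OF zero_Lip]) simp
    then show ?thesis
      by (simp add: rdist_def real_of_ereal_pos)
  qed
  show "rdist p q = rdist q p" for p q
    by (rule rdist_commute)
  show "rdist p q = 0 \<longleftrightarrow> p = q" if "p \<in> S" "q \<in> S" for p q
    by (rule rdist_eq_0_iff[OF that])
  show "rdist p r \<le> rdist p q + rdist q r" if "p \<in> S" "q \<in> S" "r \<in> S" for p q r
  proof (rule rdist_le[OF that(1,3)])
    fix a assume a: "a \<in> Lip"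
    show "cmod (p a - r a) \<le> rdist p q + rdist q r"
      using norm_triangle_ineq[of "p a - q a" "q a - r a"] le_rdist[OF that(1,2) a] le_rdist[OF that(2,3) a]
      by simp
  qed
qed

lemma finite_metric_on_dist: "finite_metric_on S dist_C"
  using dist_C_finite Metric_space_rdist by (simp add: finite_metric_on_def rdist_def[abs_def])

lemma state_space_subset: "S \<subseteq> (\<Pi>\<^sub>E a\<in>CA. UNIV)"
  using state_extensional by (auto simp: PiE_def)

lemma topspace_weak_star: "topspace (weak_star_top (shift_top l A)) = S"
  using state_space_subset by (simp add: weak_star_top_def topspace_subtopology Int_absorb1)

lemma continuous_eval_weak_star:
  assumes "a \<in> CA"
  shows "continuous_map (weak_star_top (shift_top l A)) euclidean (\<lambda>p. p a)"
  unfolding weak_star_top_def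
  by (intro continuous_map_from_subtopology continuous_map_product_projection assms)

text \<open>A metric ball contains a weak-* neighbourhood given by finitely many indicators, by
  \<open>Lip_state_diff\<close>. Conversely all evaluations are continuous for the metric, by
  \<open>state_close\<close>.\<close>

lemma mtopology_eq_weak_star:
  "Metric_space.mtopology S rdist = weak_star_top (shift_top l A)"
proof -
  interpret M: Metric_space S rdist
    by (rule Metric_space_rdist)
  let ?W = "weak_star_top (shift_top l A)"
  have "openin M.mtopology U \<longleftrightarrow> openin ?W U" for U
  proof
    assume U: "openin M.mtopology U"
    show "openin ?W U"
    proof (subst openin_subopen, intro ballI)
      fix p assume pU: "p \<in> U"
      then obtain r where r: "r > 0" "M.mball p r \<subseteq> U"
        using U by (auto simp: M.openin_mtopology)
      have p: "p \<in> S"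
        using U pU by (auto simp: M.openin_mtopology)
      obtain \<delta> :: "nat \<Rightarrow> real" where \<delta>: "\<delta> \<longlonglongrightarrow> 0"
        "\<And>a n \<omega> \<upsilon>. a \<in> Lip \<Longrightarrow> \<omega> \<in> X \<Longrightarrow> \<upsilon> \<in> X \<Longrightarrow> prefix_of n \<omega> = prefix_of n \<upsilon> \<Longrightarrow>
          cmod (a \<omega> - a \<upsilon>) \<le> \<delta> n"
        by (rule Lip_modulus) (rule that, assumption+)
      obtain o0 where o0: "o0 \<in> X"
        using node_extends[of "[]"] by auto
      have \<delta>0: "0 \<le> \<delta> m" for m
        using order_trans[OF norm_ge_zero \<delta>(2)[OF zero_Lip o0 o0 refl]] .
      have "r / 8 > 0"
        using r(1) by simp
      \<comment> \<open>The term \<open>2 * \<delta> n\<close> uses up less than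
        \<open>r / 4\<close>; the choice of \<open>\<eta>\<close> below gives another
        \<open>r / 4\<close>. The summands 1 in \<open>K\<close> keep it positive.\<close>
      from order_tendstoD(2)[OF \<delta>(1) this] obtain n where n: "\<delta> n < r / 8"
        unfolding eventually_sequentially by blast
      define K where "K = (\<delta> 0 + 1) * (real (card (level n)) + 1)"
      have K: "K > 0"
        using \<delta>0[of 0] by (simp add: K_def)
      define \<eta> where "\<eta> = r / (4 * K)"
      have \<eta>: "\<eta> > 0"
        using r(1) K by (simp add: \<eta>_def)
      let ?V = "(\<Inter>w\<in>level n. {q \<in> topspace ?W. q (indicator (cyl w)) \<in> ball (p (indicator (cyl w))) \<eta>}) \<inter> topspace ?W"
      have "openin ?W ?V"
        by (intro openin_INT openin_continuous_map_preimage[OF continuous_eval_weak_star[OF CA_indicator]])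
          auto
      moreover have "p \<in> ?V"
        using p \<eta> by (simp add: topspace_weak_star)
      moreover have "?V \<subseteq> U"
      proof
        fix q assume q: "q \<in> ?V"
        then have qS: "q \<in> S"
          by (simp add: topspace_weak_star)
        have close: "cmod (p (indicator (cyl w)) - q (indicator (cyl w))) \<le> \<eta>" if "w \<in> level n" for w
          using q that by (auto simp: dist_norm intro: less_imp_le)
        have "rdist p q \<le> 2 * \<delta> n + \<delta> 0 * (real (card (level n)) * \<eta>)"
        proof (rule rdist_le[OF p qS])
          fix a assume a: "a \<in> Lip"
          have "(\<Sum>w\<in>level n. cmod (p (indicator (cyl w)) - q (indicator (cyl w)))) \<le> real (card (level n)) * \<eta>"
            by (rule sum_bounded_above) (rule close)
          then have "\<delta> 0 * (\<Sum>w\<in>level n. cmod (p (indicator (cyl w)) - q (indicator (cyl w))))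
              \<le> \<delta> 0 * (real (card (level n)) * \<eta>)"
            by (rule mult_left_mono) (rule \<delta>0)
          then show "cmod (p a - q a) \<le> 2 * \<delta> n + \<delta> 0 * (real (card (level n)) * \<eta>)"
            using Lip_state_diff[where \<delta> = \<delta> and n = n, OF \<delta>(2) p qS a] by linarith
        qed
        also have "\<delta> 0 * (real (card (level n)) * \<eta>) \<le> K * \<eta>"
          unfolding K_def mult.assoc[symmetric] using \<delta>0[of 0] \<eta> by (intro mult_right_mono mult_mono) auto
        also have "K * \<eta> = r / 4"
          using K by (simp add: \<eta>_def)
        finally have "rdist p q < r"
          using n r(1) by simp
        then show "q \<in> U"
          using r(2) p qS by auto
      qed
      ultimately show "\<exists>T. openin ?W T \<and> p \<in> T \<and> T \<subseteq> U"
        by blast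
    qed
  next
    assume U: "openin ?W U"
    have "continuous_map M.mtopology euclidean (\<lambda>q. q a)" if a: "a \<in> CA" for a
      unfolding continuous_map_def
    proof (intro conjI allI impI)
      fix V :: "complex set" assume V: "openin euclidean V"
      show "openin M.mtopology {q \<in> topspace M.mtopology. q a \<in> V}"
        unfolding M.openin_mtopology
      proof (intro conjI allI impI)
        fix p assume "p \<in> {q \<in> topspace M.mtopology. q a \<in> V}"
        then have p: "p \<in> S" "p a \<in> V"
          by auto
        obtain e where e: "e > 0" "ball (p a) e \<subseteq> V"
          using V p(2) by (auto simp: open_contains_ball)
        obtain r where r: "r > 0" "\<And>q. q \<in> S \<Longrightarrow> rdist p q < r \<Longrightarrow> cmod (p a - q a) < e"
          by (rule state_close[OF p(1) p(1) a e(1)]) (rule that, assumption+)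
        have "M.mball p r \<subseteq> {q \<in> topspace M.mtopology. q a \<in> V}"
        proof
          fix q assume "q \<in> M.mball p r"
          then have "q \<in> S" "rdist p q < r"
            by auto
          then show "q \<in> {q \<in> topspace M.mtopology. q a \<in> V}"
            using r(2) e(2) by (auto simp: dist_norm)
        qed
        then show "\<exists>r>0. M.mball p r \<subseteq> {q \<in> topspace M.mtopology. q a \<in> V}"
          using r(1) by blast
      qed auto
    qed auto
    then have "continuous_map M.mtopology (product_topology (\<lambda>_. euclidean) CA) (\<lambda>q. q)"
      using state_extensional by (auto simp: continuous_map_componentwise)
    then have "continuous_map M.mtopology ?W (\<lambda>q. q)"
      unfolding weak_star_top_def by (simp add: continuous_map_into_subtopology)
    from openin_continuous_map_preimage[OF this U] have "openin M.mtopology {q \<in> S. q \<in> U}"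
      by simp
    moreover have "{q \<in> S. q \<in> U} = U"
      using openin_subset[OF U] by (auto simp: topspace_weak_star)
    ultimately show "openin M.mtopology U"
      by simp
  qed
  then show ?thesis
    by (simp add: topology_eq)
qed

section \<open>The spectral triple\<close>

lemma faithful_mult_rep: "faithful_representation (shift_top l A) \<mu> mult_rep"
  unfolding faithful_representation_def
proof (intro conjI ballI allI impI)
  fix a assume a: "a \<in> CA"
  obtain B where B: "0 \<le> B" "\<And>\<omega>. cmod (a \<omega>) \<le> B"
    by (rule cont_alg_bounded[OF a]) (rule that, assumption+)
  have "L2_norm \<mu> (\<lambda>x. a x * f x) \<le> B * L2_norm \<mu> f" if "f \<in> L2 \<mu>" for f
    using B by (intro L2_dominated(2)[OF that] L2_measurable cont_alg_mult_L2[OF a that])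
      (simp_all add: norm_mult mult_right_mono)
  then have "bounded_operator \<mu> B (mult_rep a)"
    unfolding bounded_operator_def mult_rep_def
    by (intro conjI ballI allI AE_I2 cont_alg_mult_L2[OF a]) (simp_all add: algebra_simps)
  then show "\<exists>c. bounded_operator \<mu> c (mult_rep a)" ..
next
  fix a b h :: "(nat \<Rightarrow> nat) \<Rightarrow> complex" and z :: complex
  show "AE x in \<mu>. mult_rep (\<lambda>y. a y + z * b y) h x = mult_rep a h x + z * mult_rep b h x"
    by (simp add: mult_rep_def algebra_simps)
  show "AE x in \<mu>. mult_rep (\<lambda>y. a y * b y) h x = mult_rep a (mult_rep b h) x"
    by (simp add: mult_rep_def algebra_simps)
next
  fix a h g :: "(nat \<Rightarrow> nat) \<Rightarrow> complex"
  show "L2_inner \<mu> (mult_rep a h) g = L2_inner \<mu> h (mult_rep (\<lambda>y. cnj (a y)) g)"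
    unfolding L2_inner_def mult_rep_def
    by (intro Bochner_Integration.integral_cong) (simp_all add: algebra_simps)
next
  fix h :: "(nat \<Rightarrow> nat) \<Rightarrow> complex"
  show "AE x in \<mu>. mult_rep (indicator (topspace (shift_top l A))) h x = h x"
    by (rule AE_I2) (simp add: mult_rep_def)
next
  fix a assume a: "a \<in> CA" and zero: "\<forall>h\<in>L2 \<mu>. AE x in \<mu>. mult_rep a h x = 0"
  have "indicator X \<in> L2 \<mu>"
    using L2_indicator[OF cyl_sets[of "[]"]] by simp
  then have "AE x in \<mu>. a x * indicator X x = 0"
    using zero by (simp add: mult_rep_def)
  then have "AE x in \<mu>. a x = 0"
    by (rule AE_mp) (auto intro!: AE_I2)
  \<comment> \<open>Every value of a continuous function is a limit of averages over cylinders
    around the point, so vanishing almost everywhere becomes vanishing everywhere.\<close>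
  then have av: "av w a = 0" for w
    using av_cong_AE[of a "\<lambda>_. 0" w] cont_alg_measurable[OF a] by simp
  show "a = (\<lambda>_. 0)"
  proof
    fix \<omega>
    show "a \<omega> = 0"
    proof (cases "\<omega> \<in> X")
      case True
      then show ?thesis
        using av_prefix_tendsto[OF a True] by (simp add: av LIMSEQ_const_iff)
    next
      case False
      then show ?thesis
        using a by (simp add: cont_alg_def)
    qed
  qed
qed

lemma spectral_triple_dirac_graph: "spectral_triple (shift_top l A) \<mu> mult_rep dirac_graph"
  unfolding spectral_triple_def
proof (intro conjI ballI allI impI faithful_mult_rep linear_dirac_graph
    essentially_self_adjoint_dirac_graph unbounded_dirac_graph compact_resolvent_dirac_graph)
  fix a and e :: real assume a: "a \<in> CA" "e > 0"
  obtain n f where f: "cyl_fun n f" "\<And>\<omega>. cmod (a \<omega> - f \<omega>) < e"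
    by (rule cont_alg_approx[OF a]) (rule that, assumption+)
  obtain c where c: "c > 0" "bounded_operator \<mu> c (comm n f)"
    by (rule bounded_operator_comm[OF f(1)]) (rule that, assumption+)
  show "\<exists>b\<in>CA. (\<forall>x\<in>topspace (shift_top l A). cmod (a x - b x) < e) \<and>
      densely_defined \<mu> (commutator dirac_graph mult_rep b) \<and>
      (\<exists>c. extends_boundedly \<mu> c (commutator dirac_graph mult_rep b))"
    using f(2) densely_defined_commutator[OF f(1)] extends_boundedly_commutator[OF f(1) c(2)]
    by (intro bexI[OF _ cyl_fun_cont_alg[OF f(1)]]) auto
qed

end

section \<open>The Haar basis\<close>

context shift_measure
begin

text \<open>Preservation of the inner product says that the columns of a square matrix are
  orthonormal. Its rows are then orthonormal too, which is the completeness relation needed; the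
  prescribed last column contributes \<open>1 / mass y\<close>.\<close>

lemma haar_orthogonality:
  assumes haar: "haar_data l A \<mu> \<theta> U" and y: "y \<in> adm"
  defines "n \<equiv> n_succ l A y" and "w \<equiv> child_mass l A \<mu> \<theta> y"
    and "u \<equiv> \<lambda>i k. vec_index (mult_mat_vec (U y) (word_onb l A \<mu> \<theta> y i)) k"
  assumes w_pos: "\<And>k. k < n \<Longrightarrow> 0 < w k" and n: "0 < n" and k: "k < n" "k' < n"
  shows "(\<Sum>i<n - 1. u i k * u i k') = (if k = k' then 1 / w k else 0) - 1 / mass y"
    and "i < n \<Longrightarrow> 1 / sqrt (w k) * word_inner l A \<mu> \<theta> y (word_onb l A \<mu> \<theta> y k)
      (mult_mat_vec (U y) (word_onb l A \<mu> \<theta> y i)) = u i k"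
proof -
  let ?f = "word_onb l A \<mu> \<theta> y"
  have U: "U y \<in> carrier_mat n n"
    "\<And>r s. r \<in> carrier_vec n \<Longrightarrow> s \<in> carrier_vec n \<Longrightarrow>
      word_inner l A \<mu> \<theta> y (mult_mat_vec (U y) r) (mult_mat_vec (U y) s) = word_inner l A \<mu> \<theta> y r s"
    "mult_mat_vec (U y) (?f (n - 1)) = vec n (\<lambda>_. 1 / sqrt (mass y))"
    using haar y by (auto simp: haar_data_def haar_rotations_def n_def)
  have f: "?f i \<in> carrier_vec n" for i
    by (simp add: word_onb_def n_def)
  have f_index: "vec_index (?f i) k = (if k = i then 1 / sqrt (w i) else 0)" if "i < n" "k < n" for i k
    using that by (simp add: word_onb_def n_def w_def)
  have inner: "word_inner l A \<mu> \<theta> y r s = (\<Sum>j<n. w j * vec_index r j * vec_index s j)" for r s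
    by (simp add: word_inner_def n_def w_def)
  have inner_f: "word_inner l A \<mu> \<theta> y (?f k) s = sqrt (w k) * vec_index s k" if "k < n" for k s
  proof -
    have "word_inner l A \<mu> \<theta> y (?f k) s = (\<Sum>j<n. if j = k then w k * (1 / sqrt (w k)) * vec_index s k else 0)"
      unfolding inner using that by (intro sum.cong) (auto simp: f_index)
    also have "\<dots> = w k * (1 / sqrt (w k)) * vec_index s k"
      using that by simp
    also have "w k * (1 / sqrt (w k)) = sqrt (w k)"
      using w_pos[OF that] by (simp add: real_div_sqrt)
    finally show ?thesis .
  qed
  show "1 / sqrt (w k) * word_inner l A \<mu> \<theta> y (?f k) (mult_mat_vec (U y) (?f i)) = u i k" if "i < n"
    using w_pos[OF k(1)] by (simp add: inner_f[OF k(1)] u_def)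
  have orth: "(\<Sum>j<n. w j * u i j * u i' j) = (if i = i' then 1 else 0)" if "i < n" "i' < n" for i i'
  proof -
    have "(\<Sum>j<n. w j * u i j * u i' j) = word_inner l A \<mu> \<theta> y (?f i) (?f i')"
      using U(2)[OF f f, of i i'] by (simp add: inner u_def)
    also have "\<dots> = (if i = i' then 1 else 0)"
      using w_pos[OF that(1)] w_pos[OF that(2)] that by (auto simp: inner_f f_index)
    finally show ?thesis .
  qed
  \<comment> \<open>The factors \<open>sqrt (w j)\<close> turn the weighted inner product into the
    standard one.\<close>
  define Q where "Q = mat n n (\<lambda>(j, i). sqrt (w j) * u i j)"
  have Q: "Q \<in> carrier_mat n n" "transpose_mat Q \<in> carrier_mat n n"
    by (simp_all add: Q_def)
  have "transpose_mat Q * Q = 1\<^sub>m n"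
  proof (rule eq_matI)
    fix i i' assume "i < dim_row (1\<^sub>m n)" "i' < dim_col (1\<^sub>m n)"
    then have ii: "i < n" "i' < n"
      by auto
    have "(transpose_mat Q * Q) $$ (i, i') = (\<Sum>j<n. (sqrt (w j) * u i j) * (sqrt (w j) * u i' j))"
      using ii by (simp add: Q_def scalar_prod_def atLeast0LessThan)
    also have "\<dots> = (\<Sum>j<n. w j * u i j * u i' j)"
    proof (intro sum.cong refl)
      fix j assume "j \<in> {..<n}"
      then have "sqrt (w j) * sqrt (w j) = w j"
        using w_pos[of j] by simp
      then show "(sqrt (w j) * u i j) * (sqrt (w j) * u i' j) = w j * u i j * u i' j"
        by (metis mult.assoc mult.left_commute)
    qed
    finally show "(transpose_mat Q * Q) $$ (i, i') = 1\<^sub>m n $$ (i, i')"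
      using ii by (simp add: orth)
  qed (simp_all add: Q_def)
  then have "Q * transpose_mat Q = 1\<^sub>m n"
    by (rule mat_mult_left_right_inverse[OF Q(2,1)])
  then have "(Q * transpose_mat Q) $$ (k, k') = (if k = k' then 1 else 0)"
    using k by simp
  moreover have "(Q * transpose_mat Q) $$ (k, k') = (\<Sum>i<n. (sqrt (w k) * u i k) * (sqrt (w k') * u i k'))"
    using k by (simp add: Q_def scalar_prod_def atLeast0LessThan)
  moreover have "\<dots> = sqrt (w k) * sqrt (w k') * (\<Sum>i<n. u i k * u i k')"
    unfolding sum_distrib_left by (intro sum.cong) (simp_all add: mult_ac)
  ultimately have "sqrt (w k) * sqrt (w k') * (\<Sum>i<n. u i k * u i k') = (if k = k' then 1 else 0)"
    by simp
  then have full: "(\<Sum>i<n. u i k * u i k') = (if k = k' then 1 / w k else 0)"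
    using w_pos[OF k(1)] w_pos[OF k(2)]
    by (cases "k = k'") (simp_all add: field_simps flip: mult.assoc)
  have "(\<Sum>i<n. u i k * u i k') = (\<Sum>i<n - 1. u i k * u i k') + u (n - 1) k * u (n - 1) k'"
    using n sum.lessThan_Suc[of "\<lambda>i. u i k * u i k'" "n - 1"] by simp
  moreover have "u (n - 1) j = 1 / sqrt (mass y)" if "j < n" for j
    unfolding u_def U(3) using that by simp
  then have "u (n - 1) k * u (n - 1) k' = 1 / mass y"
    using k by simp
  ultimately show "(\<Sum>i<n - 1. u i k * u i k') = (if k = k' then 1 / w k else 0) - 1 / mass y"
    using full by simp
qed

text \<open>By the completeness relation the Haar functions at \<open>y\<close> sum to a kernel with
  \<open>1 / w k\<close> on the diagonal blocks and \<open>- 1 / mass y\<close> throughout. So the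
  operator does not depend on the chosen bijections and rotations.\<close>

lemma haar_projection:
  assumes haar: "haar_data l A \<mu> \<theta> U" and y: "y \<in> adm" and h: "h \<in> L2 \<mu>"
  shows "(\<Sum>i<n_succ l A y - 1. L2_inner \<mu> h (haar_fun l A \<mu> \<theta> U y i) * haar_fun l A \<mu> \<theta> U y i \<omega>)
    = P y h \<omega>"
proof -
  define n where "n = n_succ l A y"
  define letter where "letter k = inv_into (successors l A y) (\<theta> y) k" for k
  have "bij_betw (\<theta> y) (successors l A y) {..<n}"
    using haar y by (simp add: haar_data_def n_def)
  then have bij: "bij_betw letter {..<n} (children y)"
    unfolding letter_def[abs_def] children_adm[OF y] by (rule bij_betw_inv_into)
  have ynode: "y \<in> nodes"
    using y by simp
  have n: "0 < n"
    using n_succ_adm[OF y] children_nonempty[OF ynode] by (simp add: n_def card_gt_0_iff)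
  define w where "w k = mass (y @ [letter k])" for k
  have child: "y @ [letter k] \<in> nodes" if "k < n" for k
    using bij that by (auto simp: bij_betw_def children_def)
  have w: "child_mass l A \<mu> \<theta> y = w"
    by (simp add: fun_eq_iff child_mass_def child_word_def w_def letter_def)
  have w_pos: "0 < w k" if "k < n" for k
    unfolding w_def by (rule mass_pos[OF child[OF that]])
  define u where "u i k = vec_index (mult_mat_vec (U y) (word_onb l A \<mu> \<theta> y i)) k" for i k
  have orth: "(\<Sum>i<n - 1. u i k * u i k') = (if k = k' then 1 / w k else 0) - 1 / mass y"
    if "k < n" "k' < n" for k k'
    using haar_orthogonality(1)[OF haar y, of k k'] that w_pos n by (simp add: w u_def flip: n_def)
  let ?ind = "\<lambda>k. indicator (cyl (y @ [letter k])) :: _ \<Rightarrow> complex"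
  have haar_eq: "haar_fun l A \<mu> \<theta> U y i = (\<lambda>\<omega>. \<Sum>k<n. of_real (u i k) * ?ind k \<omega>)" if "i < n" for i
  proof
    fix \<omega>
    show "haar_fun l A \<mu> \<theta> U y i \<omega> = (\<Sum>k<n. of_real (u i k) * ?ind k \<omega>)"
      unfolding haar_fun_def n_def[symmetric]
    proof (intro sum.cong refl)
      fix k assume "k \<in> {..<n}"
      then have "1 / sqrt (child_mass l A \<mu> \<theta> y k) * word_inner l A \<mu> \<theta> y (word_onb l A \<mu> \<theta> y k)
          (mult_mat_vec (U y) (word_onb l A \<mu> \<theta> y i)) = u i k"
        using haar_orthogonality(2)[OF haar y, of k k i] that w_pos n by (simp add: w u_def flip: n_def)
      then show "of_real (1 / sqrt (child_mass l A \<mu> \<theta> y k) * word_inner l A \<mu> \<theta> y (word_onb l A \<mu> \<theta> y k)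
          (mult_mat_vec (U y) (word_onb l A \<mu> \<theta> y i))) * indicator (cyl (child_word l A \<theta> y k)) \<omega>
          = of_real (u i k) * ?ind k \<omega>"
        by (simp only: child_word_def letter_def)
    qed
  qed
  have inner_eq: "L2_inner \<mu> h (haar_fun l A \<mu> \<theta> U y i) = (\<Sum>k<n. of_real (u i k) * cyl_int (y @ [letter k]) h)"
    if "i < n" for i
  proof -
    have "L2_inner \<mu> h (haar_fun l A \<mu> \<theta> U y i)
        = (\<Sum>k<n. L2_inner \<mu> h (\<lambda>\<omega>. of_real (u i k) * ?ind k \<omega>))"
      unfolding haar_eq[OF that] by (intro L2_inner_sum_right h L2_scale L2_indicator cyl_sets)
    then show ?thesis
      by (simp add: L2_inner_scale_right L2_inner_commute[of \<mu> h] L2_inner_indicator)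
  qed
  let ?I = "\<lambda>k. cyl_int (y @ [letter k]) h"
  have "(\<Sum>i<n - 1. L2_inner \<mu> h (haar_fun l A \<mu> \<theta> U y i) * haar_fun l A \<mu> \<theta> U y i \<omega>)
      = (\<Sum>i<n - 1. (\<Sum>k<n. of_real (u i k) * ?I k) * (\<Sum>k'<n. of_real (u i k') * ?ind k' \<omega>))"
  proof (intro sum.cong refl)
    fix i assume "i \<in> {..<n - 1}"
    then have i: "i < n"
      by simp
    show "L2_inner \<mu> h (haar_fun l A \<mu> \<theta> U y i) * haar_fun l A \<mu> \<theta> U y i \<omega>
        = (\<Sum>k<n. of_real (u i k) * ?I k) * (\<Sum>k'<n. of_real (u i k') * ?ind k' \<omega>)"
      by (simp only: inner_eq[OF i]) (simp only: haar_eq[OF i])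
  qed
  also have "\<dots> = (\<Sum>i<n - 1. \<Sum>k<n. \<Sum>k'<n. of_real (u i k * u i k') * (?I k * ?ind k' \<omega>))"
    unfolding sum_product by (intro sum.cong refl) (simp add: mult_ac)
  also have "\<dots> = (\<Sum>k<n. \<Sum>i<n - 1. \<Sum>k'<n. of_real (u i k * u i k') * (?I k * ?ind k' \<omega>))"
    by (rule sum.swap)
  also have "\<dots> = (\<Sum>k<n. \<Sum>k'<n. \<Sum>i<n - 1. of_real (u i k * u i k') * (?I k * ?ind k' \<omega>))"
    by (intro sum.cong refl sum.swap)
  also have "\<dots> = (\<Sum>k<n. \<Sum>k'<n. of_real (\<Sum>i<n - 1. u i k * u i k') * (?I k * ?ind k' \<omega>))"
    by (simp only: of_real_sum sum_distrib_right)
  also have "\<dots> = (\<Sum>k<n. \<Sum>k'<n. (if k = k' then of_real (1 / w k) * (?I k * ?ind k \<omega>) else 0)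
      - of_real (1 / mass y) * (?I k * ?ind k' \<omega>))"
  proof (intro sum.cong refl)
    fix k k' assume "k \<in> {..<n}" "k' \<in> {..<n}"
    then have k: "k < n" "k' < n"
      by auto
    show "of_real (\<Sum>i<n - 1. u i k * u i k') * (?I k * ?ind k' \<omega>)
        = (if k = k' then of_real (1 / w k) * (?I k * ?ind k \<omega>) else 0)
          - of_real (1 / mass y) * (?I k * ?ind k' \<omega>)"
      unfolding orth[OF k] by (cases "k = k'") (simp_all only: simp_thms of_real_diff left_diff_distrib if_True if_False of_real_0 mult_zero_left)
  qed
  also have "\<dots> = (\<Sum>k<n. of_real (1 / w k) * (?I k * ?ind k \<omega>))
      - of_real (1 / mass y) * ((\<Sum>k<n. ?I k) * (\<Sum>k'<n. ?ind k' \<omega>))"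
    unfolding sum_subtractf sum_product
    unfolding sum_distrib_left
    by (intro arg_cong2[where f = "(-)"] refl sum.cong) simp
  also have "\<dots> = (\<Sum>k<n. av (y @ [letter k]) h * ?ind k \<omega>)
      - of_real (1 / mass y) * ((\<Sum>k<n. ?I k) * (\<Sum>k'<n. ?ind k' \<omega>))"
    by (simp add: av_def w_def)
  also have "\<dots> = (\<Sum>i\<in>children y. av (y @ [i]) h * indicator (cyl (y @ [i])) \<omega>)
      - of_real (1 / mass y) * ((\<Sum>i\<in>children y. cyl_int (y @ [i]) h) * (\<Sum>i\<in>children y. indicator (cyl (y @ [i])) \<omega>))"
    by (simp only: sum.reindex_bij_betw[OF bij, of "\<lambda>i. av (y @ [i]) h * indicator (cyl (y @ [i])) \<omega>"]
      sum.reindex_bij_betw[OF bij, of "\<lambda>i. cyl_int (y @ [i]) h"]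
      sum.reindex_bij_betw[OF bij, of "\<lambda>i. indicator (cyl (y @ [i])) \<omega> :: complex"])
  also have "(\<Sum>i\<in>children y. cyl_int (y @ [i]) h) = cyl_int y h"
    by (rule cyl_int_children[OF L2_integrable[OF h], symmetric])
  also have "(\<Sum>i\<in>children y. av (y @ [i]) h * indicator (cyl (y @ [i])) \<omega>)
      - of_real (1 / mass y) * (cyl_int y h * (\<Sum>i\<in>children y. indicator (cyl (y @ [i])) \<omega>)) = P y h \<omega>"
  proof (cases "\<omega> \<in> X")
    case True
    have "P y h \<omega> = (\<Sum>i\<in>children y. av (y @ [i]) h * indicator (cyl (y @ [i])) \<omega>)
        - av y h * (\<Sum>i\<in>children y. indicator (cyl (y @ [i])) \<omega>)"
      unfolding P_expand[OF True] left_diff_distrib sum_subtractf sum_distrib_left ..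
    then show ?thesis
      by (simp add: av_def)
  next
    case False
    then have "\<omega> \<notin> cyl v" for v
      using cyl_subset by blast
    then show ?thesis
      using False by (simp add: P_outside)
  qed
  finally show ?thesis
    by (simp add: n_def)
qed

lemma dirac_partial_sum_eq:
  assumes haar: "haar_data l A \<mu> \<theta> U" and h: "h \<in> L2 \<mu>" and F: "finite F" "F \<subseteq> adm"
  shows "dirac_partial_sum l A \<mu> \<theta> U F h \<omega> = partial_sum F h \<omega>"
proof -
  have inner: "L2_inner \<mu> h (indicator (cyl v)) = cyl_int v h" for v
    by (subst L2_inner_commute) (simp add: L2_inner_indicator)
  have root: "(\<Sum>x=1..l. of_real (1 / mass [x]) * L2_inner \<mu> h (indicator (cyl [x])) * indicator (cyl [x]) \<omega>)
      - L2_inner \<mu> h (indicator X) * indicator X \<omega> = P [] h \<omega>"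
  proof (cases "\<omega> \<in> X")
    case True
    have "(\<Sum>x=1..l. of_real (1 / mass [x]) * L2_inner \<mu> h (indicator (cyl [x])) * indicator (cyl [x]) \<omega>)
        = (\<Sum>i\<in>children []. av ([] @ [i]) h * indicator (cyl ([] @ [i])) \<omega>)"
      unfolding children_Nil by (intro sum.cong refl) (simp add: inner av_def)
    also have "\<dots> = indicator (cyl []) \<omega> * av ([] @ [\<omega> (length ([] :: nat list))]) h"
      by (rule sum_children_indicator[OF True])
    finally show ?thesis
      using True inner[of "[]"] by (simp add: P_def av_def prefix_of_Suc)
  next
    case False
    then have "\<omega> \<notin> cyl v" for v
      using cyl_subset by blast
    then show ?thesis
      using False by (simp add: P_outside)
  qed
  have "of_real ((real (n_succ l A y) - 1) / mass y) *
      (\<Sum>k<n_succ l A y - 1. L2_inner \<mu> h (haar_fun l A \<mu> \<theta> U y k) * haar_fun l A \<mu> \<theta> U y k \<omega>)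
      = of_real (eig y) * P y h \<omega>" if "y \<in> F" for y
  proof -
    have y: "y \<in> adm"
      using that F by blast
    then have "eig y = (real (n_succ l A y) - 1) / mass y"
      by (auto simp: eig_def adm_words_def)
    then show ?thesis
      unfolding haar_projection[OF haar y h] by simp
  qed
  then have "(\<Sum>y\<in>F. of_real ((real (n_succ l A y) - 1) / mass y) *
      (\<Sum>k<n_succ l A y - 1. L2_inner \<mu> h (haar_fun l A \<mu> \<theta> U y k) * haar_fun l A \<mu> \<theta> U y k \<omega>))
      = (\<Sum>y\<in>F. of_real (eig y) * P y h \<omega>)"
    by (intro sum.cong refl)
  moreover have "[] \<notin> F"
    using F by (auto simp: adm_words_def)
  ultimately show ?thesis
    using root F(1) by (simp add: dirac_partial_sum_def partial_sum_def eig_def)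
qed

lemma dirac_eq_dirac_graph:
  assumes "haar_data l A \<mu> \<theta> U"
  shows "dirac l A \<mu> \<theta> U = dirac_graph"
proof -
  have "((\<lambda>F. L2_norm \<mu> (\<lambda>\<omega>. dirac_partial_sum l A \<mu> \<theta> U F h \<omega> - f \<omega>)) \<longlongrightarrow> 0) (finite_subsets_at_top adm)
      \<longleftrightarrow> ((\<lambda>F. L2_norm \<mu> (\<lambda>\<omega>. partial_sum F h \<omega> - f \<omega>)) \<longlongrightarrow> 0) (finite_subsets_at_top adm)"
    if "h \<in> L2 \<mu>" for h f
  proof (rule tendsto_cong)
    have "\<forall>\<^sub>F F in finite_subsets_at_top adm. finite F \<and> F \<subseteq> adm"
      unfolding eventually_finite_subsets_at_top by auto
    then show "\<forall>\<^sub>F F in finite_subsets_at_top adm.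
        L2_norm \<mu> (\<lambda>\<omega>. dirac_partial_sum l A \<mu> \<theta> U F h \<omega> - f \<omega>)
        = L2_norm \<mu> (\<lambda>\<omega>. partial_sum F h \<omega> - f \<omega>)"
      by (rule eventually_mono) (simp add: dirac_partial_sum_eq[OF assms that])
  qed
  then show ?thesis
    unfolding dirac_def dirac_graph_eq by auto
qed

end

section \<open>Gibbs measures\<close>

lemma shift_dist_le_1: "0 \<le> shift_dist \<omega> \<upsilon> \<and> shift_dist \<omega> \<upsilon> \<le> 1"
  by (simp add: shift_dist_def power_le_one)

text \<open>The metric takes values in the unit interval, so one reference point bounds the
  potential everywhere.\<close>

lemma holder_potential_bounded:
  assumes "holder_potential l A \<phi>"
  obtains B where "\<And>\<omega>. \<omega> \<in> shift_space l A \<Longrightarrow> \<bar>\<phi> \<omega>\<bar> \<le> B"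
proof (cases "shift_space l A = {}")
  case False
  then obtain o0 where o0: "o0 \<in> shift_space l A"
    by blast
  obtain C \<beta> where C: "\<beta> > 0" "\<And>\<omega> \<upsilon>. \<omega> \<in> shift_space l A \<Longrightarrow> \<upsilon> \<in> shift_space l A \<Longrightarrow>
      \<bar>\<phi> \<omega> - \<phi> \<upsilon>\<bar> \<le> C * shift_dist \<omega> \<upsilon> powr \<beta>"
    using assms by (auto simp: holder_potential_def)
  have "\<bar>\<phi> \<omega>\<bar> \<le> \<bar>\<phi> o0\<bar> + \<bar>C\<bar>" if "\<omega> \<in> shift_space l A" for \<omega>
  proof -
    have "shift_dist \<omega> o0 powr \<beta> \<le> 1"
      using shift_dist_le_1[of \<omega> o0] C(1) by (simp add: powr_le1)
    then have "\<bar>C\<bar> * shift_dist \<omega> o0 powr \<beta> \<le> \<bar>C\<bar>"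
      by (simp add: mult_left_le)
    moreover have "C * shift_dist \<omega> o0 powr \<beta> \<le> \<bar>C\<bar> * shift_dist \<omega> o0 powr \<beta>"
      by (rule mult_right_mono) auto
    ultimately show ?thesis
      using C(2)[OF that o0] by linarith
  qed
  then show ?thesis
    by (rule that)
qed (use that in blast)

text \<open>The ratio of the masses of child and parent is governed by the Gibbs bounds at a common
  point, whose Birkhoff sums differ by one bounded summand.\<close>

lemma (in subshift) gibbs_shift_measure:
  assumes holder: "holder_potential l A \<phi>" and gibbs: "gibbs_measure l A \<phi> \<mu>"
  obtains \<kappa> where "shift_measure l A \<mu> \<kappa>"
proof -
  have mu: "prob_space \<mu>" "sets \<mu> = sets (shift_borel l A)"
    using gibbs by (auto simp: gibbs_measure_def)
  interpret prob_space \<mu>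
    by (rule mu(1))
  let ?p = "pressure l A \<phi>"
  obtain c where c: "c > 1" and
    ratio: "\<And>k \<omega>. k \<ge> 1 \<Longrightarrow> \<omega> \<in> X \<Longrightarrow>
      1 / c \<le> measure \<mu> (cyl (prefix_of k \<omega>)) / exp (birkhoff_sum k \<phi> \<omega> - real k * ?p) \<and>
      measure \<mu> (cyl (prefix_of k \<omega>)) / exp (birkhoff_sum k \<phi> \<omega> - real k * ?p) \<le> c"
    using gibbs unfolding gibbs_measure_def by blast
  obtain B where B: "\<And>\<omega>. \<omega> \<in> X \<Longrightarrow> \<bar>\<phi> \<omega>\<bar> \<le> B"
    using holder_potential_bounded[OF holder] by blast
  have shift: "(shift_map ^^ k) \<omega> \<in> X" if "\<omega> \<in> X" for k \<omega>
    using that by (induction k) (auto simp: shift_map_def shift_space_def)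
  \<comment> \<open>A factor \<open>c\<close> comes from each of the two Gibbs bounds, the
    exponential from the one additional summand and the pressure.\<close>
  define \<kappa> where "\<kappa> = exp (- B - ?p) / c\<^sup>2"
  have "\<kappa> * measure \<mu> (cyl w) \<le> measure \<mu> (cyl (w @ [i]))" if wi: "w @ [i] \<in> adm" for w i
  proof -
    obtain \<omega> where "\<omega> \<in> cyl (w @ [i])"
      using adm_extends[OF wi] by blast
    then have \<omega>: "\<omega> \<in> X" "prefix_of (Suc (length w)) \<omega> = w @ [i]"
      by (auto simp: in_cyl_iff)
    then have w: "prefix_of (length w) \<omega> = w"
      by (simp add: prefix_of_Suc)
    define k where "k = length w"
    define G where "G = exp (birkhoff_sum k \<phi> \<omega> - real k * ?p)"
    have G: "0 < G"
      by (simp add: G_def)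
    have upper: "measure \<mu> (cyl w) \<le> c * G"
    \<comment> \<open>The Gibbs bounds start at length 1; for the root \<open>G\<close> is 1 and the
      mass is at most 1.\<close>
    proof (cases "k = 0")
      case True
      then show ?thesis
        using order_trans[OF prob_le_1[of "cyl w"], of c] c by (simp add: G_def birkhoff_sum_def)
    next
      case False
      then show ?thesis
        using ratio[of k \<omega>] \<omega>(1) w G unfolding G_def[symmetric] k_def[symmetric]
        by (simp add: pos_divide_le_eq)
    qed
    have "exp (birkhoff_sum (Suc k) \<phi> \<omega> - real (Suc k) * ?p) = G * exp (\<phi> ((shift_map ^^ k) \<omega>) - ?p)"
      by (simp add: G_def birkhoff_sum_def algebra_simps flip: exp_add)
    moreover have "exp (- B - ?p) \<le> exp (\<phi> ((shift_map ^^ k) \<omega>) - ?p)"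
      using B[OF shift[OF \<omega>(1)], of k] by simp
    ultimately have "G * exp (- B - ?p) \<le> exp (birkhoff_sum (Suc k) \<phi> \<omega> - real (Suc k) * ?p)"
      using G by simp
    also have "\<dots> \<le> c * measure \<mu> (cyl (w @ [i]))"
      using ratio[of "Suc k" \<omega>] \<omega> c by (simp add: k_def field_simps)
    finally have lower: "G * exp (- B - ?p) \<le> c * measure \<mu> (cyl (w @ [i]))" .
    have "\<kappa> * measure \<mu> (cyl w) \<le> \<kappa> * (c * G)"
      using upper by (intro mult_left_mono) (simp_all add: \<kappa>_def)
    also have "\<dots> = G * exp (- B - ?p) / c"
      using c by (simp add: \<kappa>_def power2_eq_square)
    also have "\<dots> \<le> measure \<mu> (cyl (w @ [i]))"
      using lower c by (simp add: field_simps)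
    finally show ?thesis .
  qed
  moreover have "0 < \<kappa>"
    using c by (simp add: \<kappa>_def)
  ultimately have "shift_measure l A \<mu> \<kappa>"
    using mu by unfold_locales auto
  then show ?thesis
    by (rule that)
qed

theorem theorem4p2:
  fixes l :: nat
    and A :: "nat \<Rightarrow> nat \<Rightarrow> nat"
    and \<phi> :: "(nat \<Rightarrow> nat) \<Rightarrow> real"
    and \<mu> :: "(nat \<Rightarrow> nat) measure"
    and \<theta> :: "nat list \<Rightarrow> nat \<Rightarrow> nat"
    and U :: "nat list \<Rightarrow> real mat"
  assumes "l \<ge> 2"
    and "\<forall>i\<in>{1..l}. \<forall>j\<in>{1..l}. A i j \<in> {0, 1}"
    and "irreducible_mat l A"
    and "aperiodic_mat l A"
    and "holder_potential l A \<phi>"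
    and "gibbs_measure l A \<phi> \<mu>"
    and "haar_data l A \<mu> \<theta> U"
  shows "finite_metric_on (state_space (shift_top l A))
           (connes_dist (shift_top l A) \<mu> mult_rep (dirac l A \<mu> \<theta> U)) \<and>
         Metric_space.mtopology (state_space (shift_top l A))
           (\<lambda>p q. real_of_ereal (connes_dist (shift_top l A) \<mu> mult_rep (dirac l A \<mu> \<theta> U) p q))
         = weak_star_top (shift_top l A) \<and>
         spectral_metric_space (shift_top l A) \<mu> mult_rep (dirac l A \<mu> \<theta> U)"
proof -
  interpret subshift l A
    using assms(1-4) by unfold_locales auto
  obtain \<kappa> where "shift_measure l A \<mu> \<kappa>"
    using gibbs_shift_measure[OF assms(5,6)] by blast
  then interpret shift_measure l A \<mu> \<kappa> .
  have dirac: "connes_dist (shift_top l A) \<mu> mult_rep (dirac l A \<mu> \<theta> U) = dist_C"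
    "dirac l A \<mu> \<theta> U = dirac_graph"
    by (simp_all add: dirac_eq_dirac_graph[OF assms(7)] dist_C_def)
  have "Metric_space.mtopology S (\<lambda>p q. real_of_ereal (dist_C p q)) = weak_star_top (shift_top l A)"
    using mtopology_eq_weak_star by (simp add: rdist_def[abs_def])
  then show ?thesis
    using finite_metric_on_dist spectral_triple_dirac_graph
    unfolding spectral_metric_space_def dirac dist_C_def[symmetric] by blast
qed

end
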